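(* Let $\{(X_{n,k}^{(1)},X_{n,k}^{(2)}):1\le k\le n,\ n\ge1\}$ be a bivariate Gaussian triangular array with correlations $\rho_0(n)$ and $\rho_{ij}(k,n)$ as described in the context. Suppose that $$\lim_{n\to\infty}(1-\rho_0(n))\ln n=\lambda^2\quad\text{for some }\lambda\in[0,\infty].$$ Let $\tau_{ij}\in(0,\infty)$, $i,j\in\{1,2\}$, be constants. Suppose that for all $i,j\in\{1,2\}$ $$\delta_{ij}:=\sup_{n\ge2,\ 1\le k<n}|\rho_{ij}(k,n)|<1,$$ let $\varpi_{ij}\in\left(0,\frac{1-\delta_{ij}}{1+\delta_{ij}}\right)$ and $K_{n,ij}:=[n^{\varpi_{ij}}]$, and assume that for all $i,j\in\{1,2\}$ $$\lim_{n\to\infty}\ \max_{K_{n,ij}\le k<n}\left|\rho_{ij}(k,n)\ln k-\tau_{ij}\right|=0 .$$ Put $\widetilde\tau:=\tau_{12}-\frac12(\tau_{11}+\tau_{22})$, assume that $\tau_{12}\le\sqrt{\tau_{11}\tau_{22}}$ and $\lambda^2\ge-\widetilde\tau$, and put $\widetilde\lambda:=\sqrt{\lambda^2+\widetilde\tau}$ (with $\widetilde\lambda=\infty$ if $\lambda=\infty$). Then $$\lim_{n\to\infty}\ \sup_{x,y\in\mathbb{R}}\left|\mathbb{P}\left(M_n^{(1)}\le u_n(x),\,M_n^{(2)}\le u_n(y)\right)-\mathbb{E}\left\{H_{\widetilde\lambda}\left(x+\tau_{11}-\sqrt{2\tau_{11}}\,Z,\ y+\tau_{22}-\sqrt{2\tau_{22}}\,W\right)\right\}\right|=0,$$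 where $(Z,W)$ is a bivariate Gaussian random vector with zero means, unit variances and correlation $\tau_{12}/\sqrt{\tau_{11}\tau_{22}}$.
   Context: Array: for each $n\ge1$ the random variables $X_{n,k}^{(i)}$, $1\le k\le n$, $i\in\{1,2\}$, are jointly Gaussian with mean zero and unit variance, and $$\mathrm{corr}(X_{n,k}^{(1)},X_{n,k}^{(2)})=\rho_0(n),\qquad \mathrm{corr}(X_{n,k}^{(i)},X_{n,l}^{(j)})=\rho_{ij}(|k-l|,n)\quad(1\le k\ne l\le n,\ i,j\in\{1,2\}),$$ so these correlations depend on $k,l$ only through $|k-l|$. Maxima: $M_n^{(i)}:=\max_{1\le k\le n}X_{n,k}^{(i)}$, $i\in\{1,2\}$. Normalisation (for $n\ge2$): $u_n(s)=a_ns+b_n$, $s\in\mathbb{R}$, with $a_n=\frac{1}{\sqrt{2\ln n}}$ and $b_n=\sqrt{2\ln n}-\frac{1}{2\sqrt{2\ln n}}\ln(4\pi\ln n)$. Hüsler–Reiss distribution: for $\lambda\in(0,\infty)$, $$H_\lambda(x,y)=\exp\left(-\Phi\left(\lambda+\tfrac{x-y}{2\lambda}\right)e^{-y}-\Phi\left(\lambda+\tfrac{y-x}{2\lambda}\right)e^{-x}\right),\quad x,y\in\mathbb{R},$$ where $\Phi$ is the standard Gaussian distribution function; with $\Lambda(x)=\exp(-e^{-x})$, $H_0(x,y)=\min(\Lambda(x),\Lambda(y))$ and $H_\infty(x,y)=\Lambda(x)\Lambda(y)$. Here $[\cdot]$ denotes the integer part. *)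

theory Defs
  imports "HOL-Probability.Probability"
begin

definition covariance :: "'a measure \<Rightarrow> ('a \<Rightarrow> real) \<Rightarrow> ('a \<Rightarrow> real) \<Rightarrow> real" where
  "covariance M X Y =
     prob_space.expectation M
       (\<lambda>\<omega>. (X \<omega> - prob_space.expectation M X) * (Y \<omega> - prob_space.expectation M Y))"

definition correlation :: "'a measure \<Rightarrow> ('a \<Rightarrow> real) \<Rightarrow> ('a \<Rightarrow> real) \<Rightarrow> real" where
  "correlation M X Y =
     covariance M X Y / (sqrt (prob_space.variance M X) * sqrt (prob_space.variance M Y))"

text \<open>The univariate Gaussian law with mean \<open>\<mu>\<close> and standard deviation \<open>\<sigma> \<ge> 0\<close>; for \<open>\<sigma> = 0\<close> it is
  the point mass at \<open>\<mu>\<close>.\<close>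

definition gaussian_law :: "real \<Rightarrow> real \<Rightarrow> real measure" where
  "gaussian_law \<mu> \<sigma> =
     (if \<sigma> = 0 then return borel \<mu> else density lborel (\<lambda>x. ennreal (normal_density \<mu> \<sigma> x)))"

text \<open>A finite family is jointly Gaussian if every linear combination of it is Gaussian, possibly
  degenerate. In particular singular covariance matrices are allowed.\<close>

definition jointly_gaussian :: "'a measure \<Rightarrow> 'i set \<Rightarrow> ('i \<Rightarrow> 'a \<Rightarrow> real) \<Rightarrow> bool" where
  "jointly_gaussian M I X \<longleftrightarrow>
     finite I \<and> (\<forall>i\<in>I. X i \<in> borel_measurable M) \<and>
     (\<forall>c. \<exists>\<mu> \<sigma>. 0 \<le> \<sigma> \<and> distr M borel (\<lambda>\<omega>. \<Sum>i\<in>I. c i * X i \<omega>) = gaussian_law \<mu> \<sigma>)"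

text \<open>The variable \<open>X n i k\<close> is the \<open>k\<close>-th entry of component \<open>i \<in> {1, 2}\<close> in row \<open>n\<close>, and
  \<open>\<rho> i j k n\<close> is the correlation of entries of components \<open>i\<close> and \<open>j\<close> at distance \<open>k\<close> in row \<open>n\<close>.
  Nothing is assumed about the dependence between different rows.\<close>

definition bivariate_gaussian_array ::
    "'a measure \<Rightarrow> (nat \<Rightarrow> nat \<Rightarrow> nat \<Rightarrow> 'a \<Rightarrow> real) \<Rightarrow> (nat \<Rightarrow> real) \<Rightarrow>
     (nat \<Rightarrow> nat \<Rightarrow> nat \<Rightarrow> nat \<Rightarrow> real) \<Rightarrow> bool" where
  "bivariate_gaussian_array M X \<rho>\<^sub>0 \<rho> \<longleftrightarrow>
     (\<forall>n\<ge>1.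
        jointly_gaussian M ({1, 2} \<times> {1..n}) (\<lambda>(i, k). X n i k) \<and>
        (\<forall>i\<in>{1, 2}. \<forall>k\<in>{1..n}.
           prob_space.expectation M (X n i k) = 0 \<and> prob_space.variance M (X n i k) = 1) \<and>
        (\<forall>k\<in>{1..n}. correlation M (X n 1 k) (X n 2 k) = \<rho>\<^sub>0 n) \<and>
        (\<forall>i\<in>{1, 2}. \<forall>j\<in>{1, 2}. \<forall>k\<in>{1..n}. \<forall>l\<in>{1..n}. k \<noteq> l \<longrightarrow>
           correlation M (X n i k) (X n j l) = \<rho> i j (nat \<bar>int k - int l\<bar>) n))"

definition row_max :: "(nat \<Rightarrow> nat \<Rightarrow> nat \<Rightarrow> 'a \<Rightarrow> real) \<Rightarrow> nat \<Rightarrow> nat \<Rightarrow> 'a \<Rightarrow> real" where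
  "row_max X n i \<omega> = Max ((\<lambda>k. X n i k \<omega>) ` {1..n})"

definition norm_a :: "nat \<Rightarrow> real" where
  "norm_a n = 1 / sqrt (2 * ln (real n))"

definition norm_b :: "nat \<Rightarrow> real" where
  "norm_b n = sqrt (2 * ln (real n)) - 1 / (2 * sqrt (2 * ln (real n))) * ln (4 * pi * ln (real n))"

definition norm_u :: "nat \<Rightarrow> real \<Rightarrow> real" where
  "norm_u n s = norm_a n * s + norm_b n"

definition std_normal_cdf :: "real \<Rightarrow> real" where
  "std_normal_cdf x = cdf std_normal_distribution x"

definition gumbel_cdf :: "real \<Rightarrow> real" where
  "gumbel_cdf x = exp (- exp (- x))"

text \<open>The Huesler-Reiss distribution function; only parameters in \<open>[0, \<infinity>]\<close> are meaningful.\<close>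

definition huesler_reiss :: "ereal \<Rightarrow> real \<Rightarrow> real \<Rightarrow> real" where
  "huesler_reiss L x y =
     (if L = 0 then min (gumbel_cdf x) (gumbel_cdf y)
      else if L = \<infinity> then gumbel_cdf x * gumbel_cdf y
      else let l = real_of_ereal L in
        exp (- std_normal_cdf (l + (x - y) / (2 * l)) * exp (- y)
             - std_normal_cdf (l + (y - x) / (2 * l)) * exp (- x)))"

end

theory Submission
  imports Defs "HOL-Real_Asymp.Real_Asymp"
begin

text \<open>
  The array is compared with \<open>Y\<^sub>k = S + \<xi>\<^sub>k\<close>, where \<open>S\<close> is Gaussian with the covariance of the row means and the
  \<open>\<xi>\<^sub>k\<close> are independent copies that restore the covariance of a single pair; this is possible because
  averaging is a contraction, so both covariance matrices are positive semidefinite. The two arrays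
  differ only at positive lags, where the correlations stay away from one, and Berman's normal comparison
  inequality bounds the difference of the box probabilities. Given \<open>S\<close>, the maxima of \<open>Y\<close> are those of
  independent pairs, whose limit is Huesler--Reiss with \<open>\<lambda>\<^sup>2\<close> shifted by \<open>\<tau>'\<close>, and dominated convergence
  over \<open>S\<close> produces the mixture. Monotonicity upgrades pointwise to uniform convergence.

  The comparison inequality is proved without densities of the vectors: for products of trigonometric
  polynomials the expectation is a finite sum of values of the characteristic function, hence explicitly
  differentiable in the covariance, and the indicators of half-lines are approximated by such polynomials.
\<close>

section \<open>Gaussian families and interpolation\<close>

text \<open>The obstacle is the lag-zero correlation \<open>\<rho>\<^sub>0 n\<close>: it may tend to
  one, or equal one, and then the factor 1 / sqrt (1 - r^2) of the comparison inequality is useless.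
  The comparison array therefore has to reproduce the covariance of a single pair exactly, not only
  in the limit, and may differ from the row at positive lags only. The obvious covariance
  \<open>\<tau> i j / ln n\<close> for the common part does not guarantee this: in the boundary case
  where \<open>L\<close> squared equals \<open>- \<tau>'\<close>, the residual covariance that it
  leaves for a pair may fail to be positive semidefinite at finite \<open>n\<close>. The covariance
  of the true row means is admissible for each \<open>n\<close>, and it has the same limits after
  multiplication by ln n, because the short lags are too few to influence an average and at the
  others the correlation is close to \<open>\<tau> i j / ln n\<close>. Since the rows and even the
  limiting pair may be degenerate, no step may rely on invertible covariance matrices.\<close>

text \<open>Stated through the characteristic function, so that singular covariances are included
  and independence on a product space becomes multiplication. The identity sees only the symmetric
  part of \<open>C\<close>; symmetry is therefore a separate hypothesis where single entries are
  used, as in \<open>normal_comparison\<close>.\<close>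

definition gaussian_family ::
    "'a measure \<Rightarrow> 'i set \<Rightarrow> ('i \<Rightarrow> 'a \<Rightarrow> real) \<Rightarrow> ('i \<Rightarrow> 'i \<Rightarrow> real) \<Rightarrow> bool" where
  "gaussian_family M I X C \<longleftrightarrow>
     prob_space M \<and> finite I \<and> (\<forall>i\<in>I. X i \<in> borel_measurable M) \<and>
     (\<forall>t. (\<integral>\<omega>. iexp (\<Sum>i\<in>I. t i * X i \<omega>) \<partial>M) =
          complex_of_real (exp (- (\<Sum>i\<in>I. \<Sum>j\<in>I. t i * t j * C i j) / 2)))"

lemma gaussian_familyD:
  assumes "gaussian_family M I X C"
  shows "prob_space M" "finite I" "\<And>i. i \<in> I \<Longrightarrow> X i \<in> borel_measurable M"
    "(\<integral>\<omega>. iexp (\<Sum>i\<in>I. t i * X i \<omega>) \<partial>M) =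
       complex_of_real (exp (- (\<Sum>i\<in>I. \<Sum>j\<in>I. t i * t j * C i j) / 2))"
  using assms unfolding gaussian_family_def by auto

lemma iexp_sum: "finite I \<Longrightarrow> iexp (\<Sum>i\<in>I. f i) = (\<Prod>i\<in>I. iexp (f i))"
  by (simp add: sum_distrib_left exp_sum)

lemma (in prob_space) integrable_iexp_real:
  assumes "f \<in> borel_measurable M"
  shows "integrable M (\<lambda>x. iexp (f x))"
  using assms by (intro integrable_iexp) auto

text \<open>Expanding the product over all choice functions \<open>m\<close> leaves single
  exponentials, each a value of the characteristic function. The covariance enters only through
  finitely many exponentials of a quadratic form, whatever its rank.\<close>

lemma trig_product_expectation:
  fixes c :: "'i \<Rightarrow> 'k \<Rightarrow> complex" and s :: "'i \<Rightarrow> 'k \<Rightarrow> real"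
  assumes G: "gaussian_family M I X C" and A: "\<And>i. i \<in> I \<Longrightarrow> finite (A i)"
  shows "(\<integral>\<omega>. (\<Prod>i\<in>I. \<Sum>k\<in>A i. c i k * iexp (s i k * X i \<omega>)) \<partial>M) =
    (\<Sum>m\<in>PiE I A. (\<Prod>i\<in>I. c i (m i)) *
       complex_of_real (exp (- (\<Sum>i\<in>I. \<Sum>j\<in>I. s i (m i) * s j (m j) * C i j) / 2)))"
proof -
  note [simp] = gaussian_familyD(2)[OF G] and [measurable] = gaussian_familyD(3)[OF G]
  interpret prob_space M by (rule gaussian_familyD[OF G])
  have eq: "(\<Prod>i\<in>I. \<Sum>k\<in>A i. c i k * iexp (s i k * X i \<omega>)) =
      (\<Sum>m\<in>PiE I A. (\<Prod>i\<in>I. c i (m i)) * iexp (\<Sum>i\<in>I. s i (m i) * X i \<omega>))" for \<omega>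
    by (subst prod_sum_PiE) (simp_all add: A prod.distrib iexp_sum del: of_real_mult of_real_sum)
  have int: "integrable M (\<lambda>\<omega>. iexp (\<Sum>i\<in>I. s i (m i) * X i \<omega>))" for m
    by (rule integrable_iexp_real) simp
  show ?thesis
    unfolding eq using int
    by (subst Bochner_Integration.integral_sum)
       (auto simp: gaussian_familyD(4)[OF G] simp del: of_real_mult of_real_sum)
qed

lemma (in pair_sigma_finite) integral_pair_mult:
  fixes f g :: "_ \<Rightarrow> complex"
  assumes "integrable (M1 \<Otimes>\<^sub>M M2) (\<lambda>(x, y). f x * g y)"
  shows "(\<integral>z. f (fst z) * g (snd z) \<partial>(M1 \<Otimes>\<^sub>M M2)) = integral\<^sup>L M1 f * integral\<^sup>L M2 g"
  using integral_fst'[OF assms] by (simp add: case_prod_unfold)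

text \<open>The weights \<open>sqrt h\<close> and \<open>sqrt (1 - h)\<close> of independent copies
  make the covariance affine in \<open>h\<close>; this is the path along which two laws are
  compared.\<close>

lemma gaussian_family_interpolate:
  assumes X: "gaussian_family M I X C" and Y: "gaussian_family N I Y D" and h: "0 \<le> h" "h \<le> 1"
  shows "gaussian_family (M \<Otimes>\<^sub>M N) I
    (\<lambda>i z. sqrt h * X i (fst z) + sqrt (1 - h) * Y i (snd z))
    (\<lambda>i j. h * C i j + (1 - h) * D i j)"
proof -
  note [simp] = gaussian_familyD(2)[OF X]
    and [measurable] = gaussian_familyD(3)[OF X] gaussian_familyD(3)[OF Y]
  interpret M: prob_space M by (rule gaussian_familyD[OF X])
  interpret N: prob_space N by (rule gaussian_familyD[OF Y])
  interpret P: pair_prob_space M N ..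
  have "(\<integral>\<omega>. iexp (\<Sum>i\<in>I. t i * (sqrt h * X i (fst \<omega>) + sqrt (1 - h) * Y i (snd \<omega>))) \<partial>(M \<Otimes>\<^sub>M N)) =
      complex_of_real (exp (- (\<Sum>i\<in>I. \<Sum>j\<in>I. t i * t j * (h * C i j + (1 - h) * D i j)) / 2))" for t
  proof -
    let ?f = "\<lambda>x. iexp (\<Sum>i\<in>I. (sqrt h * t i) * X i x)"
    let ?g = "\<lambda>y. iexp (\<Sum>i\<in>I. (sqrt (1 - h) * t i) * Y i y)"
    have eq: "iexp (\<Sum>i\<in>I. t i * (sqrt h * X i x + sqrt (1 - h) * Y i y)) = ?f x * ?g y" for x y
      unfolding exp_add[symmetric] distrib_left[symmetric] of_real_add[symmetric] sum.distrib[symmetric]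
      by (intro arg_cong[of _ _ exp] arg_cong2[of _ _ _ _ times] arg_cong[of _ _ of_real] sum.cong refl)
         (simp add: algebra_simps)
    have "integrable (M \<Otimes>\<^sub>M N) (\<lambda>(x, y). ?f x * ?g y)"
      unfolding eq[symmetric] case_prod_unfold by (rule P.integrable_iexp_real) measurable
    from P.integral_pair_mult[OF this]
    have "(\<integral>\<omega>. iexp (\<Sum>i\<in>I. t i * (sqrt h * X i (fst \<omega>) + sqrt (1 - h) * Y i (snd \<omega>))) \<partial>(M \<Otimes>\<^sub>M N)) =
        integral\<^sup>L M ?f * integral\<^sup>L N ?g"
      unfolding eq .
    also have "\<dots> = complex_of_real
       (exp (- (\<Sum>i\<in>I. \<Sum>j\<in>I. (sqrt h * t i) * (sqrt h * t j) * C i j) / 2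
             + - (\<Sum>i\<in>I. \<Sum>j\<in>I. (sqrt (1 - h) * t i) * (sqrt (1 - h) * t j) * D i j) / 2))"
      unfolding gaussian_familyD(4)[OF X] gaussian_familyD(4)[OF Y] by (simp only: exp_add of_real_mult)
    also have "- (\<Sum>i\<in>I. \<Sum>j\<in>I. (sqrt h * t i) * (sqrt h * t j) * C i j) / 2
             + - (\<Sum>i\<in>I. \<Sum>j\<in>I. (sqrt (1 - h) * t i) * (sqrt (1 - h) * t j) * D i j) / 2
        = - (\<Sum>i\<in>I. \<Sum>j\<in>I. t i * t j * (h * C i j + (1 - h) * D i j)) / 2"
    proof -
      have 1: "(sqrt h * t i) * (sqrt h * t j) * C i j + (sqrt (1 - h) * t i) * (sqrt (1 - h) * t j) * D i j
          = t i * t j * (h * C i j + (1 - h) * D i j)" for i j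
      proof -
        have "(sqrt h * t i) * (sqrt h * t j) * C i j + (sqrt (1 - h) * t i) * (sqrt (1 - h) * t j) * D i j
          = t i * t j * ((sqrt h * sqrt h) * C i j + (sqrt (1 - h) * sqrt (1 - h)) * D i j)"
          by (simp only: algebra_simps)
        then show ?thesis using h by simp
      qed
      show ?thesis unfolding 1[symmetric] sum.distrib by (simp add: field_simps)
    qed
    finally show ?thesis .
  qed
  then show ?thesis
    unfolding gaussian_family_def by (auto intro: P.prob_space_axioms)
qed

section \<open>Differentiating Gaussian expectations in the covariance\<close>

text \<open>The derivative is recorded termwise with the same frequencies, so an expectation
  containing \<open>g'\<close> has the same expansion as one containing \<open>g\<close>, with
  coefficients multiplied by \<open>\<i> * s k\<close>.\<close>

definition trig_pair :: "(real \<Rightarrow> real) \<Rightarrow> (real \<Rightarrow> real) \<Rightarrow> 'k set \<Rightarrow> ('k \<Rightarrow> complex) \<Rightarrow> ('k \<Rightarrow> real) \<Rightarrow> bool" where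
  "trig_pair g g' A c s \<longleftrightarrow> finite A \<and>
     (\<forall>x. complex_of_real (g x) = (\<Sum>k\<in>A. c k * iexp (s k * x))) \<and>
     (\<forall>x. complex_of_real (g' x) = (\<Sum>k\<in>A. c k * (\<i> * s k) * iexp (s k * x)))"

lemma trig_pair_continuous:
  assumes "trig_pair g g' A c s"
  shows "continuous_on UNIV g" "continuous_on UNIV g'"
proof -
  have g: "g = (\<lambda>x. Re (\<Sum>k\<in>A. c k * iexp (s k * x)))"
    using assms unfolding trig_pair_def by (metis Re_complex_of_real)
  have g': "g' = (\<lambda>x. Re (\<Sum>k\<in>A. c k * (\<i> * s k) * iexp (s k * x)))"
    using assms unfolding trig_pair_def by (metis Re_complex_of_real)
  show "continuous_on UNIV g" "continuous_on UNIV g'"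
    unfolding g g' by (intro continuous_intros)+
qed

text \<open>Price's identity: differentiating the expectation in the covariance of the entries i and
  j amounts to differentiating \<open>g i\<close> and \<open>g j\<close>. The remaining factors are
  at most one in modulus, so a bound for the two derivatives is enough, and it is requested only
  where the covariances differ. The one half is that of exp (- Q / 2); the sum runs over ordered
  pairs.\<close>

lemma gaussian_trig_comparison:
  fixes M :: "'a measure" and N :: "'b measure" and C D :: "'i \<Rightarrow> 'i \<Rightarrow> real"
  assumes X: "gaussian_family M I X C" and Y: "gaussian_family N I Y D"
    and diag: "\<And>i. i \<in> I \<Longrightarrow> C i i = D i i"
    and g: "\<And>i. i \<in> I \<Longrightarrow> trig_pair (g i) (g' i) (A i) (c i) (s i)"
    and le1: "\<And>i x. i \<in> I \<Longrightarrow> \<bar>g i x\<bar> \<le> 1"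
    and bound: "\<And>h i j. 0 < h \<Longrightarrow> h < 1 \<Longrightarrow> i \<in> I \<Longrightarrow> j \<in> I \<Longrightarrow> i \<noteq> j \<Longrightarrow> C i j \<noteq> D i j \<Longrightarrow>
      (\<integral>z. \<bar>g' i (sqrt h * X i (fst z) + sqrt (1 - h) * Y i (snd z))\<bar> *
           \<bar>g' j (sqrt h * X j (fst z) + sqrt (1 - h) * Y j (snd z))\<bar> \<partial>(M \<Otimes>\<^sub>M N)) \<le> B i j"
  shows "\<bar>(\<integral>\<omega>. (\<Prod>i\<in>I. g i (X i \<omega>)) \<partial>M) - (\<integral>\<omega>. (\<Prod>i\<in>I. g i (Y i \<omega>)) \<partial>N)\<bar>
    \<le> (\<Sum>i\<in>I. \<Sum>j\<in>I - {i}. \<bar>C i j - D i j\<bar> * B i j) / 2"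
proof -
  have [simp]: "finite I" using gaussian_familyD(2)[OF X] .
  have A: "\<And>i. i \<in> I \<Longrightarrow> finite (A i)" using g unfolding trig_pair_def by auto
  define V where "V h i z = sqrt h * X i (fst z) + sqrt (1 - h) * Y i (snd z)" for h :: real and i and z :: "'a \<times> 'b"
  define Q where "Q h m = (\<Sum>i\<in>I. \<Sum>j\<in>I. s i (m i) * s j (m j) * (h * C i j + (1 - h) * D i j))" for h m
  define F where "F h = (\<Sum>m\<in>PiE I A. (\<Prod>i\<in>I. c i (m i)) * complex_of_real (exp (- Q h m / 2)))" for h
  define F' where "F' h = (\<Sum>m\<in>PiE I A. (\<Prod>i\<in>I. c i (m i)) * complex_of_real (exp (- Q h m / 2) *
      (- (\<Sum>i\<in>I. \<Sum>j\<in>I. s i (m i) * s j (m j) * (C i j - D i j)) / 2)))" for h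
  have V: "gaussian_family (M \<Otimes>\<^sub>M N) I (V h) (\<lambda>i j. h * C i j + (1 - h) * D i j)"
    if "0 \<le> h" "h \<le> 1" for h
    unfolding V_def using gaussian_family_interpolate[OF X Y that] .
  have E: "(\<integral>\<omega>. (\<Prod>i\<in>I. g i (Z i \<omega>)) \<partial>K) = Re (\<Sum>m\<in>PiE I A. (\<Prod>i\<in>I. c i (m i)) *
       complex_of_real (exp (- (\<Sum>i\<in>I. \<Sum>j\<in>I. s i (m i) * s j (m j) * S i j) / 2)))"
    if K: "gaussian_family K I Z S" for K :: "'z measure" and Z S
  proof -
    have "complex_of_real (\<integral>\<omega>. (\<Prod>i\<in>I. g i (Z i \<omega>)) \<partial>K) = (\<integral>\<omega>. complex_of_real (\<Prod>i\<in>I. g i (Z i \<omega>)) \<partial>K)"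
      by (rule integral_complex_of_real[symmetric])
    also have "\<dots> = (\<integral>\<omega>. (\<Prod>i\<in>I. \<Sum>k\<in>A i. c i k * iexp (s i k * Z i \<omega>)) \<partial>K)"
      using g unfolding trig_pair_def of_real_prod by (intro Bochner_Integration.integral_cong prod.cong refl) auto
    also note trig_product_expectation[OF K A]
    finally show ?thesis by (metis Re_complex_of_real)
  qed
  have F1: "(\<integral>\<omega>. (\<Prod>i\<in>I. g i (X i \<omega>)) \<partial>M) = Re (F 1)"
    unfolding E[OF X] F_def Q_def by simp
  have F0: "(\<integral>\<omega>. (\<Prod>i\<in>I. g i (Y i \<omega>)) \<partial>N) = Re (F 0)"
    unfolding E[OF Y] F_def Q_def by simp
  have Qd: "((\<lambda>h. Q h m) has_real_derivative
      (\<Sum>i\<in>I. \<Sum>j\<in>I. s i (m i) * s j (m j) * (C i j - D i j))) (at h)" for m h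
    unfolding Q_def by (auto intro!: derivative_eq_intros DERIV_sum simp: algebra_simps)
  have ReF: "Re (F h) = (\<Sum>m\<in>PiE I A. Re (\<Prod>i\<in>I. c i (m i)) * exp (- Q h m / 2))" for h
    unfolding F_def by simp
  have ReF': "Re (F' h) = (\<Sum>m\<in>PiE I A. Re (\<Prod>i\<in>I. c i (m i)) * (exp (- Q h m / 2) *
      (- (\<Sum>i\<in>I. \<Sum>j\<in>I. s i (m i) * s j (m j) * (C i j - D i j)) / 2)))" for h
    unfolding F'_def by (simp del: of_real_mult of_real_minus of_real_divide of_real_sum)
  have "((\<lambda>h. Re (F h)) has_real_derivative Re (F' h)) (at h)" for h
    unfolding ReF ReF' by (auto intro!: derivative_eq_intros DERIV_sum Qd)
  \<comment> \<open>The mean value theorem for the real part requires the bound at a single interior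
    \<open>h\<close>, so nothing has to be integrated along the path.\<close>
  from MVT2[of 0 1 "\<lambda>h. Re (F h)" "\<lambda>h. Re (F' h)", OF _ this]
  obtain h where h: "0 < h" "h < 1" and mvt: "Re (F 1) - Re (F 0) = Re (F' h)" by auto
  let ?P = "M \<Otimes>\<^sub>M N"
  note Vh = V[of h, OF less_imp_le[OF h(1)] less_imp_le[OF h(2)]]
  interpret P: prob_space ?P by (rule gaussian_familyD[OF Vh])
  have [measurable]: "\<And>i. i \<in> I \<Longrightarrow> V h i \<in> borel_measurable ?P" by (rule gaussian_familyD[OF Vh])
  have [measurable]: "\<And>i. i \<in> I \<Longrightarrow> g i \<in> borel_measurable borel" "\<And>i. i \<in> I \<Longrightarrow> g' i \<in> borel_measurable borel"
    using trig_pair_continuous[OF g] by (auto intro: borel_measurable_continuous_onI)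
  \<comment> \<open>Each differentiated factor contributes \<open>\<i> * s\<close>, and the square
    of the imaginary unit gives the minus sign. Two distinct factors are essential; the diagonal
    terms disappear later because \<open>C i i = D i i\<close>.\<close>
  have key: "(\<Sum>m\<in>PiE I A. (\<Prod>k\<in>I. c k (m k)) * complex_of_real (exp (- Q h m / 2) * (s i (m i) * s j (m j)))) =
      - complex_of_real (\<integral>z. g' i (V h i z) * g' j (V h j z) * (\<Prod>k\<in>I - {i, j}. g k (V h k z)) \<partial>?P)"
    if ij: "i \<in> I" "j \<in> I" "i \<noteq> j" for i j
  proof -
    define c' where "c' k l = (if k = i \<or> k = j then c k l * (\<i> * s k l) else c k l)" for k l
    have I: "I = insert i (insert j (I - {i, j}))" using ij by auto
    have split: "(\<Prod>k\<in>I. f k) = f i * f j * (\<Prod>k\<in>I - {i, j}. f k)" for f :: "'i \<Rightarrow> complex"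
      using ij by (subst I, subst prod.insert) (auto simp: mult.assoc)
    have 1: "(\<Prod>k\<in>I. \<Sum>l\<in>A k. c' k l * iexp (s k l * V h k z)) =
        complex_of_real (g' i (V h i z) * g' j (V h j z) * (\<Prod>k\<in>I - {i, j}. g k (V h k z)))" for z
    proof -
      have "(\<Sum>l\<in>A i. c' i l * iexp (s i l * V h i z)) = complex_of_real (g' i (V h i z))"
           "(\<Sum>l\<in>A j. c' j l * iexp (s j l * V h j z)) = complex_of_real (g' j (V h j z))"
        using g ij unfolding trig_pair_def c'_def by auto
      moreover have "(\<Sum>l\<in>A k. c' k l * iexp (s k l * V h k z)) = complex_of_real (g k (V h k z))"
        if "k \<in> I - {i, j}" for k
        using g that unfolding trig_pair_def c'_def by auto
      ultimately show ?thesis unfolding split of_real_mult of_real_prod by simp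
    qed
    have 2: "(\<Prod>k\<in>I. c' k (m k)) = - ((\<Prod>k\<in>I. c k (m k)) * complex_of_real (s i (m i) * s j (m j)))" for m
    proof -
      have "(\<Prod>k\<in>I - {i, j}. c' k (m k)) = (\<Prod>k\<in>I - {i, j}. c k (m k))"
        by (intro prod.cong) (auto simp: c'_def)
      then show ?thesis unfolding split using ij(3)
        by (auto simp: c'_def mult_ac)
    qed
    have "complex_of_real (\<integral>z. g' i (V h i z) * g' j (V h j z) * (\<Prod>k\<in>I - {i, j}. g k (V h k z)) \<partial>?P) =
        (\<integral>z. (\<Prod>k\<in>I. \<Sum>l\<in>A k. c' k l * iexp (s k l * V h k z)) \<partial>?P)"
      unfolding 1 by (rule integral_complex_of_real[symmetric])
    also have "\<dots> = (\<Sum>m\<in>PiE I A. (\<Prod>i\<in>I. c' i (m i)) * complex_of_real (exp (- Q h m / 2)))"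
      unfolding Q_def by (rule trig_product_expectation[OF Vh A])
    also have "\<dots> = - (\<Sum>m\<in>PiE I A. (\<Prod>k\<in>I. c k (m k)) * complex_of_real (exp (- Q h m / 2) * (s i (m i) * s j (m j))))"
      unfolding 2 sum_negf[symmetric] by (intro sum.cong) auto
    finally show ?thesis by simp
  qed
  define T where "T i j = (\<Sum>m\<in>PiE I A. (\<Prod>k\<in>I. c k (m k)) * complex_of_real (exp (- Q h m / 2) * (s i (m i) * s j (m j))))" for i j
  have F'T: "F' h = - (\<Sum>i\<in>I. \<Sum>j\<in>I. complex_of_real (C i j - D i j) * T i j) / 2"
  proof -
    have "F' h = (\<Sum>m\<in>PiE I A. \<Sum>i\<in>I. \<Sum>j\<in>I. - complex_of_real (C i j - D i j) *
       ((\<Prod>k\<in>I. c k (m k)) * complex_of_real (exp (- Q h m / 2) * (s i (m i) * s j (m j)))) / 2)"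
      unfolding F'_def
      by (intro sum.cong refl,
          simp add: sum_distrib_left sum_distrib_right sum_divide_distrib sum_negf[symmetric] mult_ac,
          intro sum.cong refl, simp add: field_simps)
    also have "\<dots> = (\<Sum>i\<in>I. \<Sum>j\<in>I. \<Sum>m\<in>PiE I A. - complex_of_real (C i j - D i j) *
       ((\<Prod>k\<in>I. c k (m k)) * complex_of_real (exp (- Q h m / 2) * (s i (m i) * s j (m j)))) / 2)"
      by (subst sum.swap, intro sum.cong refl, subst sum.swap) simp
    also have "\<dots> = (\<Sum>i\<in>I. \<Sum>j\<in>I. - complex_of_real (C i j - D i j) * T i j / 2)"
      unfolding T_def sum_distrib_left sum_divide_distrib by simp
    also have "\<dots> = - (\<Sum>i\<in>I. \<Sum>j\<in>I. complex_of_real (C i j - D i j) * T i j) / 2"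
      by (simp add: sum_divide_distrib sum_negf[symmetric], intro sum.cong refl, simp add: field_simps)
    finally show ?thesis .
  qed
  have normT: "norm (complex_of_real (C i j - D i j) * T i j) \<le> \<bar>C i j - D i j\<bar> * B i j"
    if ij: "i \<in> I" "j \<in> I" "i \<noteq> j" for i j
  proof (cases "C i j = D i j")
    case False
    \<comment> \<open>Crude bounds by sums of coefficient norms, for integrability only; the
      quantitative estimate is \<open>bound\<close>.\<close>
    obtain b1 b2 where b: "\<And>x. \<bar>g' i x\<bar> \<le> b1" "\<And>x. \<bar>g' j x\<bar> \<le> b2"
    proof -
      have "\<bar>g' k x\<bar> \<le> (\<Sum>l\<in>A k. norm (c k l * (\<i> * s k l)))" if "k \<in> I" for k x
      proof -
        have "\<bar>g' k x\<bar> = norm (\<Sum>l\<in>A k. c k l * (\<i> * s k l) * iexp (s k l * x))"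
          using g[OF that] unfolding trig_pair_def by (metis norm_of_real)
        also have "\<dots> \<le> (\<Sum>l\<in>A k. norm (c k l * (\<i> * s k l) * iexp (s k l * x)))" by (rule norm_sum)
        finally show ?thesis by (simp add: norm_mult)
      qed
      then show ?thesis using that ij by blast
    qed
    have int: "integrable ?P (\<lambda>z. \<bar>g' i (V h i z)\<bar> * \<bar>g' j (V h j z)\<bar>)"
      using b ij by (intro P.integrable_const_bound[of _ "b1 * b2"] AE_I2)
        (auto simp: abs_mult intro!: mult_mono intro: order_trans[OF abs_ge_zero])
    have "norm (T i j) \<le> (\<integral>z. \<bar>g' i (V h i z)\<bar> * \<bar>g' j (V h j z)\<bar> \<partial>?P)"
      unfolding T_def key[OF ij] norm_minus_cancel norm_of_real
    proof (rule order_trans[OF integral_abs_bound integral_mono'[OF int]])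
      fix z
      have "\<bar>\<Prod>k\<in>I - {i, j}. g k (V h k z)\<bar> \<le> 1"
        unfolding abs_prod using le1 by (intro prod_le_1) auto
      then show "\<bar>g' i (V h i z) * g' j (V h j z) * (\<Prod>k\<in>I - {i, j}. g k (V h k z))\<bar> \<le> \<bar>g' i (V h i z)\<bar> * \<bar>g' j (V h j z)\<bar>"
        by (simp add: abs_mult mult_left_le)
    qed auto
    also have "\<dots> \<le> B i j" using bound[OF h ij False] unfolding V_def .
    finally show ?thesis unfolding norm_mult norm_of_real by (intro mult_left_mono) auto
  qed simp
  have "\<bar>Re (F' h)\<bar> \<le> norm (\<Sum>i\<in>I. \<Sum>j\<in>I. complex_of_real (C i j - D i j) * T i j) / 2"
    using abs_Re_le_cmod[of "F' h"] unfolding F'T by (simp add: norm_divide)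
  also have "(\<Sum>i\<in>I. \<Sum>j\<in>I. complex_of_real (C i j - D i j) * T i j) =
      (\<Sum>i\<in>I. \<Sum>j\<in>I - {i}. complex_of_real (C i j - D i j) * T i j)"
    by (rule sum.cong[OF refl], rule sum.mono_neutral_right, auto simp: diag)
  also have "norm \<dots> \<le> (\<Sum>i\<in>I. \<Sum>j\<in>I - {i}. \<bar>C i j - D i j\<bar> * B i j)"
    by (intro sum_norm_le order_trans[OF norm_sum] sum_mono normT) auto
  finally show ?thesis unfolding F1 F0 mvt by simp
qed

section \<open>Trigonometric approximation of indicators\<close>

text \<open>Weierstrass is applied to the derivative and the polynomial is integrated termwise from
  the value at 0; on \<open>\<bar>x\<bar> \<le> 1\<close> the error of the function is then
  controlled by that of the derivative. Explicit coefficients are kept because a cosine will be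
  substituted for \<open>x\<close>.\<close>

lemma polynomial_C1_approximation:
  fixes f f' :: "real \<Rightarrow> real"
  assumes f: "\<And>x. (f has_real_derivative f' x) (at x)" and f': "continuous_on UNIV f'" and e: "0 < e"
  obtains n and a :: "nat \<Rightarrow> real" where
    "\<And>x. \<bar>x\<bar> \<le> 1 \<Longrightarrow> \<bar>(\<Sum>i\<le>n. a i * x ^ i) - f x\<bar> \<le> e"
    "\<And>x. \<bar>x\<bar> \<le> 1 \<Longrightarrow> \<bar>(\<Sum>i\<le>n. a i * (i * x ^ (i - 1))) - f' x\<bar> \<le> e"
proof -
  from Stone_Weierstrass_real_polynomial_function[of "{-1..1::real}" f' "e / 2"] f' e
  obtain q where q: "real_polynomial_function q" "\<And>x. x \<in> {-1..1} \<Longrightarrow> \<bar>f' x - q x\<bar> < e / 2"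
    by (auto intro: continuous_on_subset)
  from q(1) obtain b m where b: "q = (\<lambda>x. \<Sum>i\<le>m. b i * x ^ i)"
    unfolding real_polynomial_function_iff_sum by blast
  define B where "B i = (if i = 0 then 0 else b (i - 1) / i)" for i
  define k where "k = f 0"
  define a where "a i = (if i = 0 then k else B i)" for i
  have p: "(\<Sum>i\<le>Suc m. a i * x ^ i) = k + (\<Sum>i\<le>m. b i / (Suc i) * x ^ Suc i)" for x
    unfolding sum.atMost_Suc_shift by (simp add: a_def B_def)
  have p': "(\<Sum>i\<le>Suc m. a i * (i * x ^ (i - 1))) = q x" for x :: real
  proof -
    have "b i / real (Suc i) * (real (Suc i) * x ^ i) = b i * x ^ i" for i by (simp del: of_nat_Suc)
    then show ?thesis unfolding sum.atMost_Suc_shift b a_def B_def by (simp only: diff_Suc_1 if_False nat.distinct)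
  qed
  have d: "((\<lambda>x. (\<Sum>i\<le>Suc m. a i * x ^ i) - f x) has_real_derivative q x - f' x) (at x)" for x
    unfolding p'[symmetric] by (auto intro!: derivative_eq_intros f DERIV_sum simp: mult_ac simp del: sum.atMost_Suc)
  have "\<bar>(\<Sum>i\<le>Suc m. a i * x ^ i) - f x\<bar> \<le> e" if x: "\<bar>x\<bar> \<le> 1" for x :: real
  proof -
    have "norm (((\<Sum>i\<le>Suc m. a i * x ^ i) - f x) - ((\<Sum>i\<le>Suc m. a i * 0 ^ i) - f 0)) \<le> e / 2 * norm (x - 0)"
    proof (rule field_differentiable_bound[where S="{-1..1::real}" and f'="\<lambda>x. q x - f' x"])
      show "norm (q y - f' y) \<le> e / 2" if "y \<in> {-1..1}" for y
        using q(2)[OF that] by (simp add: abs_minus_commute less_imp_le)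
    qed (use x in \<open>auto simp del: sum.atMost_Suc intro: has_field_derivative_at_within[OF d]\<close>)
    moreover have "(\<Sum>i\<le>Suc m. a i * 0 ^ i) - f 0 = 0"
      unfolding p k_def by simp
    moreover have "e / 2 * norm (x - 0) \<le> e" using x e by (simp add: mult_le_cancel_left1 order_trans[of _ "e/2*2"])
    ultimately show ?thesis by simp
  qed
  moreover have "\<bar>(\<Sum>i\<le>Suc m. a i * (i * x ^ (i - 1))) - f' x\<bar> \<le> e" if "\<bar>x\<bar> \<le> 1" for x :: real
  proof -
    have "x \<in> {-1..1}" using that by auto
    from q(2)[OF this] show ?thesis unfolding p' using e by linarith
  qed
  ultimately show ?thesis using that by blast
qed

lemma has_real_derivative_square_positive_part:
  "((\<lambda>x::real. (max 0 x)\<^sup>2) has_real_derivative 2 * max 0 x) (at x)"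
proof (cases x "0::real" rule: linorder_cases)
  case less
  have "((\<lambda>_. 0) has_real_derivative 0) (at x)" by simp
  then show ?thesis
    using has_field_derivative_transform_within_open[of "\<lambda>_. 0" 0 x "{..<0}" "\<lambda>x::real. (max 0 x)\<^sup>2"] less
    by simp
next
  case greater
  have "((\<lambda>x. x\<^sup>2) has_real_derivative 2 * x) (at x)" by (auto intro!: derivative_eq_intros)
  then show ?thesis
    using has_field_derivative_transform_within_open[of "\<lambda>x. x\<^sup>2" "2 * x" x "{0<..}" "\<lambda>x::real. (max 0 x)\<^sup>2"] greater
    by (simp add: max_def)
next
  case equal
  have "((\<lambda>h::real. (max 0 h)\<^sup>2 / h) \<longlongrightarrow> 0) (at 0)"
  proof (rule Lim_null_comparison)
    show "\<forall>\<^sub>F h in at 0. norm ((max 0 h)\<^sup>2 / h) \<le> \<bar>h\<bar>"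
      by (intro always_eventually allI) (auto simp: max_def power2_eq_square abs_mult)
    show "((\<lambda>h::real. \<bar>h\<bar>) \<longlongrightarrow> 0) (at 0)" by (auto intro!: tendsto_eq_intros)
  qed
  then show ?thesis unfolding equal by (simp add: DERIV_def)
qed

section \<open>A smooth step composed with a cosine\<close>

text \<open>A quadratic spline of class C^1: 1 - 2 t^2 on the first half of the unit interval and 2
  (1 - t)^2 on the second. Squared positive parts give one derivative formula for all pieces, with
  slope at most 2 in modulus.\<close>

definition step_fun :: "real \<Rightarrow> real" where
  "step_fun t = 2 * ((max 0 (1 - t))\<^sup>2 - 2 * (max 0 (1/2 - t))\<^sup>2 + (max 0 (- t))\<^sup>2)"

definition step_fun' :: "real \<Rightarrow> real" where
  "step_fun' t = - 4 * (max 0 (1 - t) - 2 * max 0 (1/2 - t) + max 0 (- t))"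

lemma step_fun_deriv: "(step_fun has_real_derivative step_fun' t) (at t)"
  unfolding step_fun_def[abs_def] step_fun'_def
  by (rule derivative_eq_intros DERIV_chain2[OF has_real_derivative_square_positive_part] refl | simp)+

lemma step_fun_values:
  "t \<le> 0 \<Longrightarrow> step_fun t = 1" "1 \<le> t \<Longrightarrow> step_fun t = 0" "0 \<le> step_fun t" "step_fun t \<le> 1"
  "t \<le> 0 \<Longrightarrow> step_fun' t = 0" "1 \<le> t \<Longrightarrow> step_fun' t = 0" "\<bar>step_fun' t\<bar> \<le> 2"
proof -
  have low: "step_fun t = 1" if "t \<le> 0" for t
    using that by (simp add: step_fun_def max_def power2_eq_square algebra_simps)
  have mid: "step_fun t = 1 - 2 * t\<^sup>2" if "0 \<le> t" "t \<le> 1/2" for t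
    using that by (simp add: step_fun_def max_def power2_eq_square algebra_simps)
  have hi: "step_fun t = 2 * (1 - t)\<^sup>2" if "1/2 \<le> t" "t \<le> 1" for t
    using that by (simp add: step_fun_def max_def power2_eq_square algebra_simps)
  have top: "step_fun t = 0" if "1 \<le> t" for t
    using that by (simp add: step_fun_def max_def)
  show "t \<le> 0 \<Longrightarrow> step_fun t = 1" "1 \<le> t \<Longrightarrow> step_fun t = 0" by (fact low top)+
  show "0 \<le> step_fun t" "step_fun t \<le> 1"
  proof -
    consider "t \<le> 0" | "0 \<le> t" "t \<le> 1/2" | "1/2 \<le> t" "t \<le> 1" | "1 \<le> t" by linarith
    then have "0 \<le> step_fun t \<and> step_fun t \<le> 1"
    proof cases
      case 2
      then have "t\<^sup>2 \<le> (1/2)\<^sup>2" by (intro power_mono)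
      then show ?thesis using mid[OF 2] by (simp add: power2_eq_square)
    next
      case 3
      then have "(1 - t)\<^sup>2 \<le> (1/2)\<^sup>2" by (intro power_mono) auto
      then show ?thesis using hi[OF 3] by (simp add: power2_eq_square)
    qed (auto simp: low top)
    then show "0 \<le> step_fun t" "step_fun t \<le> 1" by auto
  qed
  show "t \<le> 0 \<Longrightarrow> step_fun' t = 0" "1 \<le> t \<Longrightarrow> step_fun' t = 0" "\<bar>step_fun' t\<bar> \<le> 2"
    by (auto simp: step_fun'_def max_def)
qed

text \<open>Uniqueness of the derivative forces the expansion of \<open>g'\<close>, so only that of
  \<open>g\<close> has to be exhibited.\<close>

lemma trig_pairI:
  assumes "finite A" and g: "\<And>x. complex_of_real (g x) = (\<Sum>k\<in>A. c k * iexp (s k * x))"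
    and g': "\<And>x. (g has_real_derivative g' x) (at x)"
  shows "trig_pair g g' A c s"
  unfolding trig_pair_def
proof (intro conjI allI assms(1) g)
  fix x
  have "((\<lambda>x. (\<Sum>k\<in>A. c k * iexp (s k * x))) has_vector_derivative
      (\<Sum>k\<in>A. c k * (\<i> * s k) * iexp (s k * x))) (at x)"
    unfolding of_real_mult
    by (rule has_vector_derivative_sum,
        rule has_vector_derivative_real_field[where f="\<lambda>z. c k * exp (\<i> * (complex_of_real (s k) * z))" for k])
      (auto intro!: derivative_eq_intros)
  moreover have "((\<lambda>x. (\<Sum>k\<in>A. c k * iexp (s k * x))) has_vector_derivative complex_of_real (g' x)) (at x)"
    unfolding g[symmetric] using has_vector_derivative_of_real[of g "g' x" "at x"] g'
    by (simp add: has_real_derivative_iff_has_vector_derivative)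
  ultimately show "complex_of_real (g' x) = (\<Sum>k\<in>A. c k * (\<i> * s k) * iexp (s k * x))"
    by (rule vector_derivative_unique_at[THEN sym])
qed

lemma cos_power_iexp:
  "complex_of_real (cos \<theta> ^ k) = (\<Sum>j\<le>k. complex_of_real ((k choose j) / 2 ^ k) * iexp ((2 * real j - real k) * \<theta>))"
proof -
  have "complex_of_real (cos \<theta> ^ k) = ((iexp \<theta> + iexp (- \<theta>)) / 2) ^ k"
    by (simp add: cos_of_real[symmetric] cos_exp_eq)
  also have "\<dots> = (\<Sum>j\<le>k. of_nat (k choose j) * iexp \<theta> ^ j * iexp (- \<theta>) ^ (k - j)) / 2 ^ k"
    by (simp add: power_divide binomial_ring)
  also have "\<dots> = (\<Sum>j\<le>k. complex_of_real ((k choose j) / 2 ^ k) * iexp ((2 * real j - real k) * \<theta>))"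
    unfolding sum_divide_distrib
  proof (intro sum.cong refl)
    fix j assume "j \<in> {..k}"
    then have j: "real (k - j) = real k - real j" by simp
    have "iexp \<theta> ^ j * iexp (- \<theta>) ^ (k - j) = exp (real j * (\<i> * \<theta>) + real (k - j) * (\<i> * complex_of_real (- \<theta>)))"
      unfolding exp_add exp_of_nat_mult[symmetric] by simp
    also have "real j * (\<i> * \<theta>) + real (k - j) * (\<i> * complex_of_real (- \<theta>)) = \<i> * ((2 * real j - real k) * \<theta>)"
      unfolding j by (simp add: algebra_simps)
    finally show "of_nat (k choose j) * iexp \<theta> ^ j * iexp (- \<theta>) ^ (k - j) / 2 ^ k =
        complex_of_real ((k choose j) / 2 ^ k) * iexp ((2 * real j - real k) * \<theta>)"
      by (simp add: mult.assoc)
  qed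
  finally show ?thesis .
qed

text \<open>The binomial expansion of a power of the cosine has the frequencies
  \<open>(2 * real j - real k) * w\<close>; the phase \<open>p\<close> is absorbed into the
  coefficients.\<close>

lemma trig_pair_polynomial_cos:
  fixes a :: "nat \<Rightarrow> real"
  shows "trig_pair (\<lambda>x. \<Sum>k\<le>n. a k * cos (w * x + p) ^ k)
    (\<lambda>x. - w * sin (w * x + p) * (\<Sum>k\<le>n. a k * (k * cos (w * x + p) ^ (k - 1))))
    (SIGMA k:{..n}. {..k})
    (\<lambda>(k, j). complex_of_real (a k * ((k choose j) / 2 ^ k)) * iexp ((2 * real j - real k) * p))
    (\<lambda>(k, j). (2 * real j - real k) * w)"
proof (rule trig_pairI)
  show "finite (SIGMA k:{..n}. {..k})" by simp
  fix x
  have "complex_of_real (\<Sum>k\<le>n. a k * cos (w * x + p) ^ k) =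
      (\<Sum>k\<le>n. \<Sum>j\<le>k. complex_of_real (a k * ((k choose j) / 2 ^ k)) * iexp ((2 * real j - real k) * (w * x + p)))"
    unfolding of_real_sum of_real_mult[of "a _"] cos_power_iexp sum_distrib_left
    by (simp only: mult.assoc)
  also have "\<dots> = (\<Sum>k\<le>n. \<Sum>j\<le>k. complex_of_real (a k * ((k choose j) / 2 ^ k)) * iexp ((2 * real j - real k) * p) *
      iexp ((2 * real j - real k) * w * x))"
    by (intro sum.cong refl) (simp add: mult.assoc exp_add[symmetric] algebra_simps)
  also have "\<dots> = (\<Sum>y\<in>(SIGMA k:{..n}. {..k}). (case y of (k, j) \<Rightarrow> complex_of_real (a k * ((k choose j) / 2 ^ k)) *
        iexp ((2 * real j - real k) * p)) * iexp ((case y of (k, j) \<Rightarrow> (2 * real j - real k) * w) * x))"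
    by (subst sum.Sigma) (auto simp: case_prod_unfold)
  finally show "complex_of_real (\<Sum>k\<le>n. a k * cos (w * x + p) ^ k) = \<dots>" .
  show "((\<lambda>x. \<Sum>k\<le>n. a k * cos (w * x + p) ^ k) has_real_derivative
      - w * sin (w * x + p) * (\<Sum>k\<le>n. a k * (k * cos (w * x + p) ^ (k - 1)))) (at x)"
    by (auto intro!: derivative_eq_intros DERIV_sum simp: sum_distrib_left sum_negf[symmetric] algebra_simps intro!: sum.cong)
qed

text \<open>On \<open>\<bar>x\<bar> \<le> R\<close> the function cos (w x + pi / 2) is decreasing,
  so the half-line below \<open>u\<close> becomes the part of [-1, 1] above \<open>y1\<close>, and a
  polynomial close to a smooth step in that variable is a trigonometric polynomial in
  \<open>x\<close>. Outside [-R, R] periodicity spoils the approximation; only the global bounds on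
  \<open>g\<close> and \<open>g'\<close> survive there.\<close>

lemma exists_trig_step:
  assumes e: "0 < e" and \<eta>: "0 < \<eta>" "\<eta> \<le> 1" and R: "2 \<le> R" "2 * (\<bar>u\<bar> + e) \<le> R"
  obtains g g' and A :: "(nat \<times> nat) set" and c s where "trig_pair g g' A c s"
    "\<And>x. \<bar>g x\<bar> \<le> 1" "\<And>x. \<bar>g' x\<bar> \<le> 4 / e + \<eta>"
    "\<And>x. \<bar>x\<bar> \<le> R \<Longrightarrow> x \<notin> {u<..<u + e} \<Longrightarrow> \<bar>g x - of_bool (x \<le> u)\<bar> \<le> \<eta>"
    "\<And>x. \<bar>x\<bar> \<le> R \<Longrightarrow> x \<notin> {u<..<u + e} \<Longrightarrow> \<bar>g' x\<bar> \<le> \<eta>"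
proof -
  \<comment> \<open>Chosen so that w x + p maps [-R, R] onto [0, pi], one monotone branch of the
    cosine.\<close>
  define w where "w = pi / (2 * R)"
  define p where "p = pi / 2"
  have w: "0 < w" "w \<le> 1" "w * R = pi / 2" using R pi_less_4 by (auto simp: w_def field_simps)
  define y1 where "y1 = cos (w * u + p)"
  define y2 where "y2 = cos (w * (u + e) + p)"
  define \<kappa> where "\<kappa> = y1 - y2"
  have "\<exists>z>w * u + p. z < w * (u + e) + p \<and> cos (w * (u + e) + p) - cos (w * u + p) = (w * (u + e) + p - (w * u + p)) * (- sin z)"
    using w e by (intro MVT2) (auto intro!: derivative_eq_intros simp: algebra_simps)
  then obtain z where z: "w * u + p < z" "z < w * (u + e) + p" and \<kappa>z: "\<kappa> = w * e * sin z"
    unfolding \<kappa>_def y1_def y2_def by (auto simp: algebra_simps)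
  \<comment> \<open>The condition \<open>2 * (\<bar>u\<bar> + e) \<le> R\<close> keeps the window in
    the middle half of the branch, where the cosine has slope at least 1 / 2 in modulus; this yields
    the lower bound \<open>w * e / 2\<close> for \<open>\<kappa>\<close>.\<close>
  have "1 / 2 \<le> cos (z - p)"
  proof -
    have "w * \<bar>u\<bar> \<le> w * (R / 2)" "w * (\<bar>u\<bar> + e) \<le> w * (R / 2)" using w R e by (auto intro!: mult_left_mono)
    moreover have "w * (R / 2) = pi / 4" using w(3) by (simp add: mult_ac)
    moreover have "- (w * \<bar>u\<bar>) \<le> w * u" "w * (u + e) \<le> w * (\<bar>u\<bar> + e)" using w by (auto simp: abs_if)
    ultimately have "z - p \<le> pi / 4" "- (z - p) \<le> pi / 4" using z by linarith+
    then have "\<bar>z - p\<bar> \<le> pi / 4" by linarith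
    then have "cos (pi / 3) \<le> cos \<bar>z - p\<bar>" by (intro cos_monotone_0_pi_le) (use pi_gt_zero in linarith)+
    then show ?thesis by (simp add: cos_60)
  qed
  then have sz: "1 / 2 \<le> sin z" by (simp add: p_def cos_diff)
  then have \<kappa>: "0 < \<kappa>" "w * e / 2 \<le> \<kappa>"
    unfolding \<kappa>z using w e mult_left_mono[OF sz, of "w * e"] by auto
  \<comment> \<open>The factor \<open>1 - \<eta> / 2\<close> leaves room for a polynomial error of
    \<open>\<eta> / 2\<close>, so that \<open>\<bar>g x\<bar> \<le> 1\<close> holds exactly, as
    \<open>gaussian_trig_comparison\<close> requires.\<close>
  define f where "f y = (1 - \<eta> / 2) * step_fun ((y1 - y) / \<kappa>)" for y
  define f' where "f' y = (1 - \<eta> / 2) * (- step_fun' ((y1 - y) / \<kappa>) / \<kappa>)" for y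
  have fd: "(f has_real_derivative f' y) (at y)" for y
  proof -
    have "((\<lambda>y. (y1 - y) / \<kappa>) has_real_derivative - (1 / \<kappa>)) (at y)"
      using \<kappa> by (auto intro!: derivative_eq_intros)
    from DERIV_cmult[OF DERIV_chain2[OF step_fun_deriv this], of "1 - \<eta> / 2"]
    show ?thesis unfolding f_def[abs_def] f'_def by simp
  qed
  have fc: "continuous_on UNIV f'"
    unfolding f'_def[abs_def]
    using \<kappa> unfolding step_fun'_def[abs_def] by (intro continuous_intros) auto
  have "0 < \<eta> / 2" using \<eta> by simp
  then obtain n a where
    a: "\<And>y. \<bar>y\<bar> \<le> 1 \<Longrightarrow> \<bar>(\<Sum>i\<le>n. a i * y ^ i) - f y\<bar> \<le> \<eta> / 2"
    and a': "\<And>y. \<bar>y\<bar> \<le> 1 \<Longrightarrow> \<bar>(\<Sum>i\<le>n. a i * (i * y ^ (i - 1))) - f' y\<bar> \<le> \<eta> / 2"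
    by (rule polynomial_C1_approximation[OF fd fc]) (rule that; assumption)
  define g where "g x = (\<Sum>k\<le>n. a k * cos (w * x + p) ^ k)" for x
  define g' where "g' x = - w * sin (w * x + p) * (\<Sum>k\<le>n. a k * (k * cos (w * x + p) ^ (k - 1)))" for x
  have fb: "0 \<le> f y" "f y \<le> 1 - \<eta> / 2" for y
    unfolding f_def using \<eta> step_fun_values(3,4)[of "(y1 - y) / \<kappa>"] by (auto intro!: mult_left_le)
  \<comment> \<open>The slope of the step is at most 2 divided by \<open>\<kappa>\<close>; the
    frequency \<open>w\<close> from the chain rule cancels the one in the lower bound for
    \<open>\<kappa>\<close>, so the result does not depend on \<open>R\<close>.\<close>
  have f'b: "w * \<bar>f' y\<bar> \<le> 4 / e" for y
  proof -
    have "\<bar>f' y\<bar> \<le> 1 * (2 / \<kappa>)" unfolding f'_def abs_mult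
      using \<eta> \<kappa> step_fun_values(7) by (intro mult_mono) (auto intro!: divide_right_mono)
    also have "\<dots> \<le> 1 * (2 / (w * e / 2))" using \<kappa> w e by (intro mult_left_mono divide_left_mono) auto
    finally have "w * \<bar>f' y\<bar> \<le> w * (1 * (2 / (w * e / 2)))" using w by (intro mult_left_mono) auto
    then show ?thesis using w e by simp
  qed
  have g'1: "\<bar>g' x\<bar> \<le> w * (\<bar>f' (cos (w * x + p))\<bar> + \<eta>)" for x
  proof -
    have "\<bar>\<Sum>k\<le>n. a k * (k * cos (w * x + p) ^ (k - 1))\<bar> \<le> \<bar>f' (cos (w * x + p))\<bar> + \<eta>"
      using a'[OF abs_cos_le_one[of "w * x + p"]] \<eta> by linarith
    moreover have "\<bar>g' x\<bar> = w * (\<bar>sin (w * x + p)\<bar> * \<bar>\<Sum>k\<le>n. a k * (k * cos (w * x + p) ^ (k - 1))\<bar>)"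
      unfolding g'_def using w by (simp add: abs_mult)
    moreover have "\<bar>sin (w * x + p)\<bar> * \<bar>\<Sum>k\<le>n. a k * (k * cos (w * x + p) ^ (k - 1))\<bar> \<le> 1 * \<bar>\<Sum>k\<le>n. a k * (k * cos (w * x + p) ^ (k - 1))\<bar>"
      by (intro mult_right_mono) auto
    ultimately show ?thesis using w by (auto intro!: mult_left_mono)
  qed
  have w\<eta>: "w * \<eta> \<le> \<eta>" using w \<eta> by simp
  have out: "(x \<le> u \<longrightarrow> y1 \<le> cos (w * x + p)) \<and> (u + e \<le> x \<longrightarrow> cos (w * x + p) \<le> y2)" if x: "\<bar>x\<bar> \<le> R" for x
  proof -
    have b: "0 \<le> w * x + p \<and> w * x + p \<le> pi" if "\<bar>x\<bar> \<le> R" for x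
    proof -
      have "w * \<bar>x\<bar> \<le> w * R" using w that by (intro mult_left_mono) auto
      then have "\<bar>w * x\<bar> \<le> pi / 2" using w by (simp add: abs_mult)
      then show ?thesis unfolding p_def by (auto simp: abs_le_iff)
    qed
    have "\<bar>u\<bar> \<le> R" "\<bar>u + e\<bar> \<le> R" using R e by auto
    then show ?thesis unfolding y1_def y2_def
      using w e by (auto intro!: cos_monotone_0_pi_le b[THEN conjunct1] b[THEN conjunct2] x simp: mult_left_mono)
  qed
  have flat: "f (cos (w * x + p)) = (1 - \<eta> / 2) * of_bool (x \<le> u) \<and> f' (cos (w * x + p)) = 0"
    if x: "\<bar>x\<bar> \<le> R" "x \<notin> {u<..<u + e}" for x
  proof -
    consider "x \<le> u" | "u + e \<le> x" using x(2) by force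
    then show ?thesis
    proof cases
      case 1
      then have "(y1 - cos (w * x + p)) / \<kappa> \<le> 0" using out[OF x(1)] \<kappa> by (simp add: divide_nonpos_pos)
      then show ?thesis using 1 by (simp add: f_def f'_def step_fun_values)
    next
      case 2
      then have "1 \<le> (y1 - cos (w * x + p)) / \<kappa>" using out[OF x(1)] \<kappa> by (simp add: \<kappa>_def)
      then show ?thesis using 2 e by (simp add: f_def f'_def step_fun_values)
    qed
  qed
  show ?thesis
  proof
    show "trig_pair g g' (SIGMA k:{..n}. {..k})
      (\<lambda>(k, j). complex_of_real (a k * ((k choose j) / 2 ^ k)) * iexp ((2 * real j - real k) * p))
      (\<lambda>(k, j). (2 * real j - real k) * w)"
      unfolding g_def[abs_def] g'_def[abs_def] by (rule trig_pair_polynomial_cos)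
    show "\<bar>g x\<bar> \<le> 1" for x
      using a[OF abs_cos_le_one[of "w * x + p"]] fb[of "cos (w * x + p)"] \<eta> unfolding g_def by linarith
    show "\<bar>g' x\<bar> \<le> 4 / e + \<eta>" for x
      using g'1[of x] f'b[of "cos (w * x + p)"] w\<eta> by (simp add: distrib_left)
    show "\<bar>g' x\<bar> \<le> \<eta>" if "\<bar>x\<bar> \<le> R" "x \<notin> {u<..<u + e}" for x
      using g'1[of x] flat[OF that] w\<eta> by simp
    show "\<bar>g x - of_bool (x \<le> u)\<bar> \<le> \<eta>" if "\<bar>x\<bar> \<le> R" "x \<notin> {u<..<u + e}" for x
    proof -
      have "\<bar>g x - f (cos (w * x + p))\<bar> \<le> \<eta> / 2"
        using a[OF abs_cos_le_one[of "w * x + p"]] unfolding g_def .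
      moreover have "\<bar>f (cos (w * x + p)) - of_bool (x \<le> u)\<bar> \<le> \<eta> / 2"
        using flat[OF that] \<eta> by (cases "x \<le> u") simp_all
      ultimately show ?thesis by linarith
    qed
  qed
qed

section \<open>From trigonometric polynomials to box probabilities\<close>

lemma (in prob_space) prob_abs_gt_tendsto_0:
  assumes [measurable]: "X \<in> borel_measurable M"
  shows "((\<lambda>R::real. prob {\<omega> \<in> space M. R < \<bar>X \<omega>\<bar>}) \<longlongrightarrow> 0) at_top"
proof (rule tendsto_at_topI_sequentially)
  fix r :: "nat \<Rightarrow> real" assume r: "filterlim r at_top sequentially"
  have "(\<lambda>n. \<integral>\<omega>. indicat_real {\<omega> \<in> space M. r n < \<bar>X \<omega>\<bar>} \<omega> \<partial>M) \<longlonglongrightarrow> (\<integral>\<omega>. 0 \<partial>M)"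
  proof (rule integral_dominated_convergence[where w="\<lambda>_. 1"])
    show "AE \<omega> in M. (\<lambda>n. indicat_real {\<omega> \<in> space M. r n < \<bar>X \<omega>\<bar>} \<omega>) \<longlonglongrightarrow> 0"
    proof (intro AE_I2 tendsto_eventually)
      fix \<omega>
      show "\<forall>\<^sub>F n in sequentially. indicat_real {\<omega> \<in> space M. r n < \<bar>X \<omega>\<bar>} \<omega> = 0"
        using filterlim_at_top_dense[THEN iffD1, OF r, rule_format, of "\<bar>X \<omega>\<bar>"] by eventually_elim auto
    qed
  qed (auto split: split_indicator)
  then show "(\<lambda>n. prob {\<omega> \<in> space M. r n < \<bar>X \<omega>\<bar>}) \<longlonglongrightarrow> 0"
    by simp
qed

text \<open>The window excludes its left end point, so it shrinks to the empty set and a possible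
  atom of \<open>X\<close> at \<open>u\<close> does no harm.\<close>

lemma (in prob_space) prob_right_window_tendsto_0:
  assumes [measurable]: "X \<in> borel_measurable M"
  shows "(\<lambda>m. prob {\<omega> \<in> space M. u < X \<omega> \<and> X \<omega> < u + 1 / real (Suc m)}) \<longlonglongrightarrow> 0"
proof -
  have "(\<lambda>m. \<integral>\<omega>. indicat_real {\<omega> \<in> space M. u < X \<omega> \<and> X \<omega> < u + 1 / real (Suc m)} \<omega> \<partial>M) \<longlonglongrightarrow> (\<integral>\<omega>. 0 \<partial>M)"
  proof (rule integral_dominated_convergence[where w="\<lambda>_. 1"])
    show "AE \<omega> in M. (\<lambda>m. indicat_real {\<omega> \<in> space M. u < X \<omega> \<and> X \<omega> < u + 1 / real (Suc m)} \<omega>) \<longlonglongrightarrow> 0"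
    proof (intro AE_I2)
      fix \<omega>
      show "(\<lambda>m. indicat_real {\<omega> \<in> space M. u < X \<omega> \<and> X \<omega> < u + 1 / real (Suc m)} \<omega>) \<longlonglongrightarrow> 0"
      proof (cases "u < X \<omega>")
        case True
        have "(\<lambda>m. u + 1 / real (Suc m)) \<longlonglongrightarrow> u + 0"
          by (intro tendsto_intros LIMSEQ_Suc lim_1_over_n)
        then have "\<forall>\<^sub>F m in sequentially. u + 1 / real (Suc m) < X \<omega>"
          using True by (intro order_tendstoD(2)[of _ u]) auto
        then have "\<forall>\<^sub>F m in sequentially. indicat_real {\<omega> \<in> space M. u < X \<omega> \<and> X \<omega> < u + 1 / real (Suc m)} \<omega> = 0"
          by eventually_elim auto
        then show ?thesis by (rule tendsto_eventually)
      qed simp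
    qed
  qed (auto split: split_indicator)
  then show ?thesis by simp
qed

lemma (in prob_space) expectation_three_indicators:
  assumes [measurable]: "A \<in> events" "B \<in> events" "C \<in> events"
  shows "expectation (\<lambda>x. c * (indicator A x + indicator B x + indicator C x) + d) =
    c * (prob A + prob B + prob C) + d"
proof -
  have "integrable M (indicat_real A)" "integrable M (indicat_real B)" "integrable M (indicat_real C)"
    by (auto intro!: integrable_real_indicator simp: emeasure_eq_measure)
  then show ?thesis by (simp add: prob_space)
qed

text \<open>The trigonometric comparison is applied to steps of width \<open>e m\<close> and
  tolerance \<open>(e m)\<^sup>2\<close>. Their derivatives are at most about 4 / e, and both
  coordinates lie in their windows with probability at most e^2 K, so the bound tends to 16 K; the
  one half of the trigonometric comparison turns 16 into 8. The index set stays fixed as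
  \<open>m\<close> grows, so all other errors vanish.\<close>

lemma gaussian_box_comparison:
  fixes M :: "'a measure" and N :: "'b measure" and C D K :: "'i \<Rightarrow> 'i \<Rightarrow> real"
  assumes X: "gaussian_family M I X C" and Y: "gaussian_family N I Y D"
    and diag: "\<And>i. i \<in> I \<Longrightarrow> C i i = D i i"
    and window: "\<And>h i j e. 0 < h \<Longrightarrow> h < 1 \<Longrightarrow> i \<in> I \<Longrightarrow> j \<in> I \<Longrightarrow> i \<noteq> j \<Longrightarrow> C i j \<noteq> D i j \<Longrightarrow> 0 < e \<Longrightarrow>
      measure (M \<Otimes>\<^sub>M N) {z \<in> space (M \<Otimes>\<^sub>M N).
        sqrt h * X i (fst z) + sqrt (1 - h) * Y i (snd z) \<in> {u i<..<u i + e} \<and>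
        sqrt h * X j (fst z) + sqrt (1 - h) * Y j (snd z) \<in> {u j<..<u j + e}} \<le> e\<^sup>2 * K i j"
  shows "\<bar>measure M {\<omega> \<in> space M. \<forall>i\<in>I. X i \<omega> \<le> u i} - measure N {\<omega> \<in> space N. \<forall>i\<in>I. Y i \<omega> \<le> u i}\<bar>
    \<le> 8 * (\<Sum>i\<in>I. \<Sum>j\<in>I - {i}. \<bar>C i j - D i j\<bar> * K i j)"
proof -
  have fin[simp]: "finite I" using gaussian_familyD(2)[OF X] .
  note [measurable] = gaussian_familyD(3)[OF X] gaussian_familyD(3)[OF Y]
  interpret M: prob_space M by (rule gaussian_familyD[OF X])
  interpret N: prob_space N by (rule gaussian_familyD[OF Y])
  interpret P: pair_prob_space M N ..
  define p where "p = measure M {\<omega> \<in> space M. \<forall>i\<in>I. X i \<omega> \<le> u i}"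
  define q where "q = measure N {\<omega> \<in> space N. \<forall>i\<in>I. Y i \<omega> \<le> u i}"
  define e where "e m = 1 / real (Suc m)" for m
  define H where "H m = 4 / e m + (e m)\<^sup>2" for m
  \<comment> \<open>The parts stand for both coordinates in their windows, for a coordinate beyond
    \<open>R\<close>, and for the rest, where one derivative is at most
    \<open>(e m)\<^sup>2\<close>. As \<open>H m\<close> is of order 1 / e, the tails have to be of
    order e^3 for the second part to vanish.\<close>
  define B where "B m i j = (H m)\<^sup>2 * ((e m)\<^sup>2 * K i j + 4 * e m ^ 3) + (e m)\<^sup>2 * H m" for m i j
  define errX where "errX m = (\<Sum>i\<in>I. (e m)\<^sup>2 + 2 * M.prob {\<omega> \<in> space M. u i < X i \<omega> \<and> X i \<omega> < u i + e m} + 2 * e m ^ 3)" for m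
  define errY where "errY m = (\<Sum>i\<in>I. (e m)\<^sup>2 + 2 * N.prob {\<omega> \<in> space N. u i < Y i \<omega> \<and> Y i \<omega> < u i + e m} + 2 * e m ^ 3)" for m
  have e0: "0 < e m" "e m \<le> 1" for m unfolding e_def by auto
  have H0: "0 < H m" for m unfolding H_def using e0[of m] by (auto intro: add_pos_pos)
  have ineq: "\<bar>p - q\<bar> \<le> (\<Sum>i\<in>I. \<Sum>j\<in>I - {i}. \<bar>C i j - D i j\<bar> * B m i j) / 2 + errX m + errY m" for m
  proof -
    have em: "0 < e m ^ 3" "0 < (e m)\<^sup>2" "(e m)\<^sup>2 \<le> 1" using e0[of m] by (auto simp: power_le_one)
    \<comment> \<open>Half of \<open>R\<close>, because an interpolated variable beyond
      \<open>R\<close> forces one of the two variables from which it is built beyond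
      \<open>R / 2\<close>; one \<open>R\<close> thus serves every \<open>h\<close>.\<close>
    have tails: "\<forall>\<^sub>F R in at_top. \<forall>i\<in>I. measure S {\<omega> \<in> space S. R / 2 < \<bar>V i \<omega>\<bar>} < e m ^ 3"
      if S: "prob_space S" and V: "\<And>i. i \<in> I \<Longrightarrow> V i \<in> borel_measurable S" for S :: "'z measure" and V :: "'i \<Rightarrow> 'z \<Rightarrow> real"
    proof (rule eventually_ball_finite[OF fin], rule ballI)
      fix i assume i: "i \<in> I"
      have "((\<lambda>R. measure S {\<omega> \<in> space S. R / 2 < \<bar>V i \<omega>\<bar>}) \<longlongrightarrow> 0) at_top"
        by (rule filterlim_compose[OF prob_space.prob_abs_gt_tendsto_0[OF S V[OF i]]]) real_asymp
      then show "\<forall>\<^sub>F R in at_top. measure S {\<omega> \<in> space S. R / 2 < \<bar>V i \<omega>\<bar>} < e m ^ 3"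
        using em by (intro order_tendstoD(2)) auto
    qed
    have "\<forall>\<^sub>F R in at_top. \<forall>i\<in>I. M.prob {\<omega> \<in> space M. R / 2 < \<bar>X i \<omega>\<bar>} < e m ^ 3"
      by (rule tails[OF M.prob_space_axioms]) simp
    moreover have "\<forall>\<^sub>F R in at_top. \<forall>i\<in>I. N.prob {\<omega> \<in> space N. R / 2 < \<bar>Y i \<omega>\<bar>} < e m ^ 3"
      by (rule tails[OF N.prob_space_axioms]) simp
    moreover have "\<forall>\<^sub>F R in at_top. (2::real) \<le> R" by (rule eventually_ge_at_top)
    moreover have "\<forall>\<^sub>F R in at_top. \<forall>i\<in>I. 2 * (\<bar>u i\<bar> + e m) \<le> R"
      by (intro eventually_ball_finite ballI eventually_ge_at_top) simp
    ultimately have "\<forall>\<^sub>F R in at_top. (\<forall>i\<in>I. M.prob {\<omega> \<in> space M. R / 2 < \<bar>X i \<omega>\<bar>} < e m ^ 3) \<and>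
        (\<forall>i\<in>I. N.prob {\<omega> \<in> space N. R / 2 < \<bar>Y i \<omega>\<bar>} < e m ^ 3) \<and> 2 \<le> R \<and> (\<forall>i\<in>I. 2 * (\<bar>u i\<bar> + e m) \<le> R)"
      by eventually_elim auto
    from eventually_happens'[OF _ this]
    obtain R where RX: "\<And>i. i \<in> I \<Longrightarrow> M.prob {\<omega> \<in> space M. R / 2 < \<bar>X i \<omega>\<bar>} < e m ^ 3"
      and RY: "\<And>i. i \<in> I \<Longrightarrow> N.prob {\<omega> \<in> space N. R / 2 < \<bar>Y i \<omega>\<bar>} < e m ^ 3"
      and R: "2 \<le> R" "\<And>i. i \<in> I \<Longrightarrow> 2 * (\<bar>u i\<bar> + e m) \<le> R"
      by auto
    define good where "good i = (\<lambda>(g, g', A :: (nat \<times> nat) set, c, s). trig_pair g g' A c s \<and>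
      (\<forall>x. \<bar>g x\<bar> \<le> 1) \<and> (\<forall>x. \<bar>g' x\<bar> \<le> H m) \<and>
      (\<forall>x. \<bar>x\<bar> \<le> R \<longrightarrow> x \<notin> {u i<..<u i + e m} \<longrightarrow> \<bar>g x - of_bool (x \<le> u i)\<bar> \<le> (e m)\<^sup>2 \<and> \<bar>g' x\<bar> \<le> (e m)\<^sup>2))" for i
    have "\<exists>t. good i t" if i: "i \<in> I" for i
    proof -
      obtain g g' and A :: "(nat \<times> nat) set" and c s where "trig_pair g g' A c s"
        "\<And>x. \<bar>g x\<bar> \<le> 1" "\<And>x. \<bar>g' x\<bar> \<le> 4 / e m + (e m)\<^sup>2"
        "\<And>x. \<bar>x\<bar> \<le> R \<Longrightarrow> x \<notin> {u i<..<u i + e m} \<Longrightarrow> \<bar>g x - of_bool (x \<le> u i)\<bar> \<le> (e m)\<^sup>2"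
        "\<And>x. \<bar>x\<bar> \<le> R \<Longrightarrow> x \<notin> {u i<..<u i + e m} \<Longrightarrow> \<bar>g' x\<bar> \<le> (e m)\<^sup>2"
        by (rule exists_trig_step[OF e0(1)[of m] em(2,3) R(1) R(2)[OF i]]) (rule that; assumption)
      then show ?thesis unfolding good_def H_def by (intro exI[of _ "(g, g', A, c, s)"]) auto
    qed
    then obtain t where t: "\<And>i. i \<in> I \<Longrightarrow> good i (t i)" by metis
    define g where "g i = fst (t i)" for i
    define g' where "g' i = fst (snd (t i))" for i
    define A where "A i = fst (snd (snd (t i)))" for i
    define c where "c i = fst (snd (snd (snd (t i))))" for i
    define s where "s i = snd (snd (snd (snd (t i))))" for i
    have tr: "trig_pair (g i) (g' i) (A i) (c i) (s i)" and g1: "\<bar>g i x\<bar> \<le> 1" and g'H: "\<bar>g' i x\<bar> \<le> H m"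
      and gs: "\<bar>x\<bar> \<le> R \<Longrightarrow> x \<notin> {u i<..<u i + e m} \<Longrightarrow> \<bar>g i x - of_bool (x \<le> u i)\<bar> \<le> (e m)\<^sup>2"
      and g's: "\<bar>x\<bar> \<le> R \<Longrightarrow> x \<notin> {u i<..<u i + e m} \<Longrightarrow> \<bar>g' i x\<bar> \<le> (e m)\<^sup>2"
      if "i \<in> I" for i x
      using t[OF that] unfolding good_def g_def g'_def A_def c_def s_def by (auto simp: case_prod_unfold)
    have [measurable]: "\<And>i. i \<in> I \<Longrightarrow> g i \<in> borel_measurable borel" "\<And>i. i \<in> I \<Longrightarrow> g' i \<in> borel_measurable borel"
      using trig_pair_continuous[OF tr] by (auto intro: borel_measurable_continuous_onI)
    have gH: "(e m)\<^sup>2 \<le> H m" unfolding H_def using e0[of m] by simp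
    have main: "\<bar>(\<integral>\<omega>. (\<Prod>i\<in>I. g i (X i \<omega>)) \<partial>M) - (\<integral>\<omega>. (\<Prod>i\<in>I. g i (Y i \<omega>)) \<partial>N)\<bar>
        \<le> (\<Sum>i\<in>I. \<Sum>j\<in>I - {i}. \<bar>C i j - D i j\<bar> * B m i j) / 2"
    proof (rule gaussian_trig_comparison[OF X Y diag tr g1])
      fix h :: real and i j
      assume h: "0 < h" "h < 1" and ij: "i \<in> I" "j \<in> I" "i \<noteq> j" and ne: "C i j \<noteq> D i j"
      let ?P = "M \<Otimes>\<^sub>M N"
      let ?V = "\<lambda>k z. sqrt h * X k (fst z) + sqrt (1 - h) * Y k (snd z)"
      let ?W = "{z \<in> space ?P. ?V i z \<in> {u i<..<u i + e m} \<and> ?V j z \<in> {u j<..<u j + e m}}"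
      let ?T = "\<lambda>k. {z \<in> space ?P. R < \<bar>?V k z\<bar>}"
      have tail: "P.prob (?T k) \<le> 2 * e m ^ 3" if [measurable, simp]: "k \<in> I" for k
      proof -
        have "P.prob (?T k) \<le> P.prob ({z \<in> space ?P. fst z \<in> {\<omega> \<in> space M. R / 2 < \<bar>X k \<omega>\<bar>}} \<union>
            {z \<in> space ?P. snd z \<in> {\<omega> \<in> space N. R / 2 < \<bar>Y k \<omega>\<bar>}})"
        proof (rule P.finite_measure_mono)
          show "?T k \<subseteq> {z \<in> space ?P. fst z \<in> {\<omega> \<in> space M. R / 2 < \<bar>X k \<omega>\<bar>}} \<union>
            {z \<in> space ?P. snd z \<in> {\<omega> \<in> space N. R / 2 < \<bar>Y k \<omega>\<bar>}}"
          proof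
            fix z assume z: "z \<in> ?T k"
            have "\<bar>?V k z\<bar> \<le> 1 * \<bar>X k (fst z)\<bar> + 1 * \<bar>Y k (snd z)\<bar>"
              using h by (intro order_trans[OF abs_triangle_ineq]) (auto simp: abs_mult intro!: add_mono mult_left_le_one_le)
            then show "z \<in> {z \<in> space ?P. fst z \<in> {\<omega> \<in> space M. R / 2 < \<bar>X k \<omega>\<bar>}} \<union>
              {z \<in> space ?P. snd z \<in> {\<omega> \<in> space N. R / 2 < \<bar>Y k \<omega>\<bar>}}"
              using z by (auto simp: space_pair_measure)
          qed
        qed measurable
        also have "\<dots> \<le> P.prob {z \<in> space ?P. fst z \<in> {\<omega> \<in> space M. R / 2 < \<bar>X k \<omega>\<bar>}} +
            P.prob {z \<in> space ?P. snd z \<in> {\<omega> \<in> space N. R / 2 < \<bar>Y k \<omega>\<bar>}}"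
          by (rule measure_Un_le) measurable
        also have "{z \<in> space ?P. fst z \<in> {\<omega> \<in> space M. R / 2 < \<bar>X k \<omega>\<bar>}} = {\<omega> \<in> space M. R / 2 < \<bar>X k \<omega>\<bar>} \<times> space N"
          by (auto simp: space_pair_measure)
        also have "{z \<in> space ?P. snd z \<in> {\<omega> \<in> space N. R / 2 < \<bar>Y k \<omega>\<bar>}} = space M \<times> {\<omega> \<in> space N. R / 2 < \<bar>Y k \<omega>\<bar>}"
          by (auto simp: space_pair_measure)
        also have "P.prob ({\<omega> \<in> space M. R / 2 < \<bar>X k \<omega>\<bar>} \<times> space N) = M.prob {\<omega> \<in> space M. R / 2 < \<bar>X k \<omega>\<bar>}"
          by (simp add: measure_def N.emeasure_pair_measure_Times N.emeasure_space_1)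
        also have "P.prob (space M \<times> {\<omega> \<in> space N. R / 2 < \<bar>Y k \<omega>\<bar>}) = N.prob {\<omega> \<in> space N. R / 2 < \<bar>Y k \<omega>\<bar>}"
          by (simp add: measure_def N.emeasure_pair_measure_Times M.emeasure_space_1)
        finally show ?thesis using RX[of k] RY[of k] by simp
      qed
      have pt: "\<bar>g' i (?V i z)\<bar> * \<bar>g' j (?V j z)\<bar> \<le>
          (H m)\<^sup>2 * (indicator ?W z + indicator (?T i) z + indicator (?T j) z) + (e m)\<^sup>2 * H m"
        if z: "z \<in> space ?P" for z
      proof (cases "z \<in> ?W \<union> ?T i \<union> ?T j")
        case True
        have "\<bar>g' i (?V i z)\<bar> * \<bar>g' j (?V j z)\<bar> \<le> H m * H m"
          using g'H ij H0[of m] by (intro mult_mono) (auto intro: less_imp_le)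
        also have "\<dots> \<le> (H m)\<^sup>2 * (indicator ?W z + indicator (?T i) z + indicator (?T j) z)"
          using True H0[of m] unfolding power2_eq_square
          by (subst mult_le_cancel_left1) (auto split: split_indicator)
        finally show ?thesis using H0[of m] by (simp add: add_increasing2)
      next
        case False
        then have le: "\<bar>?V i z\<bar> \<le> R" "\<bar>?V j z\<bar> \<le> R" using z by auto
        from False z consider "?V i z \<notin> {u i<..<u i + e m}" | "?V j z \<notin> {u j<..<u j + e m}" by blast
        then have "\<bar>g' i (?V i z)\<bar> * \<bar>g' j (?V j z)\<bar> \<le> (e m)\<^sup>2 * H m"
        proof cases
          case 1
          then show ?thesis using g's[OF ij(1) le(1) 1] g'H[OF ij(2)] em by (intro mult_mono) auto
        next
          case 2
          have "\<bar>g' i (?V i z)\<bar> * \<bar>g' j (?V j z)\<bar> \<le> H m * (e m)\<^sup>2"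
            using g's[OF ij(2) le(2) 2] g'H[OF ij(1)] H0[of m] by (intro mult_mono) auto
          then show ?thesis by (simp add: mult.commute)
        qed
        then show ?thesis using False by simp
      qed
      have "(\<integral>z. \<bar>g' i (?V i z)\<bar> * \<bar>g' j (?V j z)\<bar> \<partial>?P) \<le>
          (\<integral>z. (H m)\<^sup>2 * (indicator ?W z + indicator (?T i) z + indicator (?T j) z) + (e m)\<^sup>2 * H m \<partial>?P)"
      proof (rule integral_mono)
        show "integrable ?P (\<lambda>z. \<bar>g' i (?V i z)\<bar> * \<bar>g' j (?V j z)\<bar>)"
          using g'H ij less_imp_le[OF H0[of m]]
          by (intro P.integrable_const_bound[of _ "H m * H m"] AE_I2)
            (auto simp: abs_mult intro!: mult_mono)
        show "integrable ?P (\<lambda>z. (H m)\<^sup>2 * (indicator ?W z + indicator (?T i) z + indicator (?T j) z) + (e m)\<^sup>2 * H m)"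
          using ij by (intro Bochner_Integration.integrable_add integrable_mult_right integrable_real_indicator) (auto simp: P.emeasure_eq_measure)
      qed (rule pt)
      also have "\<dots> = (H m)\<^sup>2 * (P.prob ?W + P.prob (?T i) + P.prob (?T j)) + (e m)\<^sup>2 * H m"
        using ij by (intro P.expectation_three_indicators) measurable
      also have "\<dots> \<le> B m i j"
      proof -
        have "P.prob ?W + P.prob (?T i) + P.prob (?T j) \<le> (e m)\<^sup>2 * K i j + 4 * e m ^ 3"
          using window[OF h ij ne e0(1)[of m]] tail[OF ij(1)] tail[OF ij(2)] by linarith
        then show ?thesis unfolding B_def by (intro add_right_mono mult_left_mono) auto
      qed
      finally show "(\<integral>z. \<bar>g' i (?V i z)\<bar> * \<bar>g' j (?V j z)\<bar> \<partial>?P) \<le> B m i j" .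
    qed auto
    \<comment> \<open>Exchanging the factors of a product of numbers bounded by one costs the sum of
      the individual errors: \<open>(e m)\<^sup>2\<close> normally, and at most 2 in a window or a
      tail.\<close>
    have one: "\<bar>(\<integral>\<omega>. (\<Prod>i\<in>I. g i (Z i \<omega>)) \<partial>S) - measure S {\<omega> \<in> space S. \<forall>i\<in>I. Z i \<omega> \<le> u i}\<bar> \<le>
       (\<Sum>i\<in>I. (e m)\<^sup>2 + 2 * measure S {\<omega> \<in> space S. u i < Z i \<omega> \<and> Z i \<omega> < u i + e m} + 2 * e m ^ 3)"
      if S: "prob_space S" and [measurable]: "\<And>i. i \<in> I \<Longrightarrow> Z i \<in> borel_measurable S"
        and RZ: "\<And>i. i \<in> I \<Longrightarrow> measure S {\<omega> \<in> space S. R / 2 < \<bar>Z i \<omega>\<bar>} < e m ^ 3"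
      for S :: "'z measure" and Z
    proof -
      interpret S: prob_space S by fact
      have ind: "indicat_real {\<omega> \<in> space S. \<forall>i\<in>I. Z i \<omega> \<le> u i} \<omega> = (\<Prod>i\<in>I. of_bool (Z i \<omega> \<le> u i))"
        if "\<omega> \<in> space S" for \<omega>
        using that by (auto split: split_indicator simp: prod_zero_iff)
      have int1: "integrable S (\<lambda>\<omega>. \<Prod>i\<in>I. g i (Z i \<omega>))"
        using g1 by (intro S.integrable_const_bound[of _ 1] AE_I2) (auto simp: abs_prod intro!: prod_le_1)
      have int2: "integrable S (indicat_real {\<omega> \<in> space S. \<forall>i\<in>I. Z i \<omega> \<le> u i})"
        by (intro integrable_real_indicator) (auto simp: S.emeasure_eq_measure)
      let ?W = "\<lambda>i. {\<omega> \<in> space S. u i < Z i \<omega> \<and> Z i \<omega> < u i + e m}"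
      let ?T = "\<lambda>i. {\<omega> \<in> space S. R / 2 < \<bar>Z i \<omega>\<bar>}"
      have iWT: "integrable S (indicat_real (?W i))" "integrable S (indicat_real (?T i))" if "i \<in> I" for i
        using that by (auto intro!: integrable_real_indicator simp: S.emeasure_eq_measure)
      have pt: "\<bar>(\<Prod>i\<in>I. g i (Z i \<omega>)) - indicat_real {\<omega> \<in> space S. \<forall>i\<in>I. Z i \<omega> \<le> u i} \<omega>\<bar> \<le>
          (\<Sum>i\<in>I. (e m)\<^sup>2 + 2 * indicator (?W i) \<omega> + 2 * indicator (?T i) \<omega>)" if w: "\<omega> \<in> space S" for \<omega>
      proof -
        have "norm ((\<Prod>i\<in>I. g i (Z i \<omega>)) - (\<Prod>i\<in>I. of_bool (Z i \<omega> \<le> u i))) \<le>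
            (\<Sum>i\<in>I. norm (g i (Z i \<omega>) - of_bool (Z i \<omega> \<le> u i)))"
          using g1 by (intro norm_prod_diff) auto
        also have "\<dots> \<le> (\<Sum>i\<in>I. (e m)\<^sup>2 + 2 * indicator (?W i) \<omega> + 2 * indicator (?T i) \<omega>)"
        proof (rule sum_mono)
          fix i assume i: "i \<in> I"
          show "norm (g i (Z i \<omega>) - of_bool (Z i \<omega> \<le> u i)) \<le> (e m)\<^sup>2 + 2 * indicator (?W i) \<omega> + 2 * indicator (?T i) \<omega>"
          proof (cases "\<omega> \<in> ?W i \<union> ?T i")
            case True
            then have "2 \<le> 2 * indicat_real (?W i) \<omega> + 2 * indicator (?T i) \<omega>" by (auto split: split_indicator)
            moreover have "norm (g i (Z i \<omega>) - of_bool (Z i \<omega> \<le> u i)) \<le> 1 + 1"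
              using g1[OF i] by (intro order_trans[OF norm_triangle_ineq4] add_mono) auto
            ultimately show ?thesis using em by linarith
          next
            case False
            then have "\<bar>Z i \<omega>\<bar> \<le> R" "Z i \<omega> \<notin> {u i<..<u i + e m}" using w R(1) by auto
            from gs[OF i this] show ?thesis using False by simp
          qed
        qed
        finally show ?thesis using ind[OF w] by simp
      qed
      have "\<bar>(\<integral>\<omega>. (\<Prod>i\<in>I. g i (Z i \<omega>)) \<partial>S) - measure S {\<omega> \<in> space S. \<forall>i\<in>I. Z i \<omega> \<le> u i}\<bar> =
          \<bar>\<integral>\<omega>. (\<Prod>i\<in>I. g i (Z i \<omega>)) - indicat_real {\<omega> \<in> space S. \<forall>i\<in>I. Z i \<omega> \<le> u i} \<omega> \<partial>S\<bar>"
        using int1 int2 by simp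
      also have "\<dots> \<le> (\<integral>\<omega>. \<bar>(\<Prod>i\<in>I. g i (Z i \<omega>)) - indicat_real {\<omega> \<in> space S. \<forall>i\<in>I. Z i \<omega> \<le> u i} \<omega>\<bar> \<partial>S)"
        by (rule integral_abs_bound)
      also have "\<dots> \<le> (\<integral>\<omega>. (\<Sum>i\<in>I. (e m)\<^sup>2 + 2 * indicator (?W i) \<omega> + 2 * indicator (?T i) \<omega>) \<partial>S)"
        using int1 int2 by (intro integral_mono pt Bochner_Integration.integrable_sum Bochner_Integration.integrable_add
            integrable_mult_right iWT S.integrable_const integrable_abs Bochner_Integration.integrable_diff)
      also have "\<dots> = (\<Sum>i\<in>I. (e m)\<^sup>2 + 2 * S.prob (?W i) + 2 * S.prob (?T i))"
      proof (subst Bochner_Integration.integral_sum)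
        fix i assume i: "i \<in> I"
        note [simp] = iWT[OF i]
        show "integrable S (\<lambda>\<omega>. (e m)\<^sup>2 + 2 * indicator (?W i) \<omega> + 2 * indicator (?T i) \<omega>)"
          by (intro Bochner_Integration.integrable_add integrable_mult_right iWT[OF i] S.integrable_const)
      next
        show "(\<Sum>i\<in>I. \<integral>\<omega>. (e m)\<^sup>2 + 2 * indicator (?W i) \<omega> + 2 * indicator (?T i) \<omega> \<partial>S) =
            (\<Sum>i\<in>I. (e m)\<^sup>2 + 2 * S.prob (?W i) + 2 * S.prob (?T i))"
        proof (intro sum.cong refl)
          fix i assume i: "i \<in> I"
          show "(\<integral>\<omega>. (e m)\<^sup>2 + 2 * indicator (?W i) \<omega> + 2 * indicator (?T i) \<omega> \<partial>S) =
              (e m)\<^sup>2 + 2 * S.prob (?W i) + 2 * S.prob (?T i)"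
            by (subst Bochner_Integration.integral_add Bochner_Integration.integral_add;
                (intro Bochner_Integration.integrable_add integrable_mult_right iWT[OF i] S.integrable_const)?)+
              (simp add: S.prob_space Int_absorb2 Collect_restrict del: divide_less_eq_numeral1)
        qed
      qed
      also have "\<dots> \<le> (\<Sum>i\<in>I. (e m)\<^sup>2 + 2 * S.prob (?W i) + 2 * e m ^ 3)"
        using RZ by (intro sum_mono add_mono) (auto intro: less_imp_le)
      finally show ?thesis .
    qed
    show ?thesis
    proof -
      have "\<bar>(\<integral>\<omega>. (\<Prod>i\<in>I. g i (X i \<omega>)) \<partial>M) - p\<bar> \<le> errX m"
        unfolding p_def errX_def by (rule one[OF M.prob_space_axioms _ RX]) auto
      moreover have "\<bar>(\<integral>\<omega>. (\<Prod>i\<in>I. g i (Y i \<omega>)) \<partial>N) - q\<bar> \<le> errY m"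
        unfolding q_def errY_def by (rule one[OF N.prob_space_axioms _ RY]) auto
      ultimately show ?thesis using main by linarith
    qed
  qed
  have elim: "e \<longlonglongrightarrow> 0" unfolding e_def[abs_def] by (intro LIMSEQ_Suc lim_1_over_n)
  have Blim: "(\<lambda>m. B m i j) \<longlonglongrightarrow> 16 * K i j" for i j
  proof -
    \<comment> \<open>Clearing the denominators of \<open>H m\<close> leaves a polynomial in
      \<open>e m\<close> whose value at 0 is 16 K.\<close>
    have "B m i j = (4 + e m ^ 3)\<^sup>2 * (K i j + 4 * e m) + e m * (4 + e m ^ 3)" for m
    proof -
      have "H m = (4 + e m ^ 3) / e m" unfolding H_def using e0[of m]
        by (simp add: field_simps power3_eq_cube power2_eq_square)
      then have "B m i j = ((4 + e m ^ 3) / e m)\<^sup>2 * ((e m)\<^sup>2 * K i j + 4 * e m ^ 3) + (e m)\<^sup>2 * ((4 + e m ^ 3) / e m)"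
        unfolding B_def by simp
      then show ?thesis using e0[of m] by (simp add: power_divide) (simp add: field_simps power3_eq_cube power2_eq_square)
    qed
    then have "(\<lambda>m. B m i j) = (\<lambda>m. (4 + e m ^ 3)\<^sup>2 * (K i j + 4 * e m) + e m * (4 + e m ^ 3))" by auto
    also have "\<dots> \<longlonglongrightarrow> (4 + 0 ^ 3)\<^sup>2 * (K i j + 4 * 0) + 0 * (4 + 0 ^ 3)"
      by (intro tendsto_intros elim)
    finally show ?thesis by simp
  qed
  have errXlim: "errX \<longlonglongrightarrow> (\<Sum>i\<in>I. 0\<^sup>2 + 2 * 0 + 2 * 0 ^ 3)"
    unfolding errX_def[abs_def]
    by (intro tendsto_sum tendsto_add tendsto_mult tendsto_power elim tendsto_const)
      (unfold e_def, rule M.prob_right_window_tendsto_0, simp)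
  have errYlim: "errY \<longlonglongrightarrow> (\<Sum>i\<in>I. 0\<^sup>2 + 2 * 0 + 2 * 0 ^ 3)"
    unfolding errY_def[abs_def]
    by (intro tendsto_sum tendsto_add tendsto_mult tendsto_power elim tendsto_const)
      (unfold e_def, rule N.prob_right_window_tendsto_0, simp)
  have "(\<lambda>m. (\<Sum>i\<in>I. \<Sum>j\<in>I - {i}. \<bar>C i j - D i j\<bar> * B m i j) / 2 + errX m + errY m)
     \<longlonglongrightarrow> (\<Sum>i\<in>I. \<Sum>j\<in>I - {i}. \<bar>C i j - D i j\<bar> * (16 * K i j)) / 2
        + (\<Sum>i\<in>I. 0\<^sup>2 + 2 * 0 + 2 * 0 ^ 3) + (\<Sum>i\<in>I. 0\<^sup>2 + 2 * 0 + 2 * 0 ^ 3)"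
    by (intro tendsto_add tendsto_divide tendsto_sum tendsto_mult tendsto_const Blim errXlim errYlim) auto
  then have "\<bar>p - q\<bar> \<le> (\<Sum>i\<in>I. \<Sum>j\<in>I - {i}. \<bar>C i j - D i j\<bar> * (16 * K i j)) / 2
        + (\<Sum>i\<in>I. 0\<^sup>2 + 2 * 0 + 2 * 0 ^ 3) + (\<Sum>i\<in>I. 0\<^sup>2 + 2 * 0 + 2 * 0 ^ 3)"
    by (rule LIMSEQ_le_const) (use ineq in auto)
  also have "\<dots> = 8 * (\<Sum>i\<in>I. \<Sum>j\<in>I - {i}. \<bar>C i j - D i j\<bar> * K i j)"
    by (simp add: sum_distrib_left sum_divide_distrib mult_ac)
  finally show ?thesis unfolding p_def q_def .
qed

section \<open>Pair laws and the normal comparison inequality\<close>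

text \<open>With equal covariances every term of the comparison bound carries the factor 0 and the
  window condition is vacuous; the inequality doubles as the uniqueness theorem for Gaussian laws on
  boxes.\<close>

lemma gaussian_family_box_unique:
  assumes X: "gaussian_family M I X C" and Y: "gaussian_family N I Y D"
    and eq: "\<And>i j. i \<in> I \<Longrightarrow> j \<in> I \<Longrightarrow> C i j = D i j"
  shows "measure M {\<omega> \<in> space M. \<forall>i\<in>I. X i \<omega> \<le> u i} = measure N {\<omega> \<in> space N. \<forall>i\<in>I. Y i \<omega> \<le> u i}"
proof -
  have "\<bar>measure M {\<omega> \<in> space M. \<forall>i\<in>I. X i \<omega> \<le> u i} - measure N {\<omega> \<in> space N. \<forall>i\<in>I. Y i \<omega> \<le> u i}\<bar>
    \<le> 8 * (\<Sum>i\<in>I. \<Sum>j\<in>I - {i}. \<bar>C i j - D i j\<bar> * 0)"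
    by (rule gaussian_box_comparison[OF X Y]) (auto simp: eq)
  then show ?thesis by simp
qed

lemma prob_space_std_normal: "prob_space std_normal_distribution"
  by (rule prob_space_normal_density) simp

lemma integral_iexp_std_normal:
  "(\<integral>x. iexp (t * x) \<partial>std_normal_distribution) = complex_of_real (exp (- t\<^sup>2 / 2))"
  using fun_cong[OF char_std_normal_distribution, of t] unfolding char_def by simp

lemma gaussian_family_subset:
  assumes X: "gaussian_family M I X C" and J: "J \<subseteq> I"
  shows "gaussian_family M J X C"
proof -
  note fin = gaussian_familyD(2)[OF X]
  have 1: "(\<Sum>i\<in>I. (if i \<in> J then f i else 0)) = sum f J" for f :: "'b \<Rightarrow> real"
    using sum.inter_restrict[OF fin, of f J] J by (simp add: Int_absorb1)
  have "(\<integral>\<omega>. iexp (\<Sum>i\<in>J. t i * X i \<omega>) \<partial>M) =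
          complex_of_real (exp (- (\<Sum>i\<in>J. \<Sum>j\<in>J. t i * t j * C i j) / 2))" for t
  proof -
    have a: "(\<Sum>i\<in>I. (if i \<in> J then t i else 0) * X i \<omega>) = (\<Sum>i\<in>J. t i * X i \<omega>)" for \<omega>
      unfolding 1[symmetric] by (intro sum.cong) auto
    have b: "(\<Sum>i\<in>I. \<Sum>j\<in>I. (if i \<in> J then t i else 0) * (if j \<in> J then t j else 0) * C i j) =
        (\<Sum>i\<in>J. \<Sum>j\<in>J. t i * t j * C i j)"
      unfolding 1[symmetric] by (intro sum.cong) (auto intro!: sum.cong)
    show ?thesis
      using gaussian_familyD(4)[OF X, of "\<lambda>i. if i \<in> J then t i else 0"] unfolding a b .
  qed
  then show ?thesis
    using X J finite_subset[OF J fin] unfolding gaussian_family_def by auto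
qed

abbreviation std_normal_pair :: "(real \<times> real) measure" where
  "std_normal_pair \<equiv> std_normal_distribution \<Otimes>\<^sub>M std_normal_distribution"

lemma integral_iexp_std_normal_pair:
  "(\<integral>z. iexp (p * fst z + q * snd z) \<partial>std_normal_pair) =
    complex_of_real (exp (- (p\<^sup>2 + q\<^sup>2) / 2))"
proof -
  let ?G = std_normal_distribution
  interpret G: prob_space ?G by (rule prob_space_std_normal)
  interpret P: pair_prob_space ?G ?G ..
  have eq: "iexp (p * a + q * b) = iexp (p * a) * iexp (q * b)" for a b
    by (simp add: exp_add[symmetric] distrib_left)
  have "integrable (?G \<Otimes>\<^sub>M ?G) (\<lambda>(a, b). iexp (p * a) * iexp (q * b))"
    unfolding eq[symmetric] case_prod_unfold by (rule P.integrable_iexp_real) measurable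
  from P.integral_pair_mult[OF this] show ?thesis
    unfolding eq integral_iexp_std_normal by (simp add: exp_add[symmetric] add_divide_distrib del: of_real_mult flip: of_real_mult)
qed

section \<open>Bivariate normal laws and Berman's bound\<close>

text \<open>A pair with correlation \<open>r\<close> on a space that does not depend on
  \<open>r\<close>. It stays meaningful when \<open>r\<close> has modulus one, and its continuity in
  \<open>r\<close> later gives convergence at every point instead of mere convergence in
  law.\<close>

definition correlated_pair :: "real \<Rightarrow> real \<times> real \<Rightarrow> real \<times> real" where
  "correlated_pair r z = (fst z, r * fst z + sqrt (1 - r\<^sup>2) * snd z)"

lemma measurable_correlated_pair[measurable]:
  "correlated_pair r \<in> borel_measurable std_normal_pair"
  unfolding correlated_pair_def[abs_def] borel_prod[symmetric] by measurable

lemma gaussian_family_correlated_pair: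
  assumes r: "\<bar>r\<bar> \<le> 1" and ij: "i \<noteq> j"
  shows "gaussian_family std_normal_pair {i, j}
    (\<lambda>k z. if k = i then fst (correlated_pair r z) else snd (correlated_pair r z))
    (\<lambda>k l. if k = l then 1 else r)"
proof -
  let ?G = std_normal_distribution
  interpret G: prob_space ?G by (rule prob_space_std_normal)
  interpret P: pair_prob_space ?G ?G ..
  have r2: "r\<^sup>2 \<le> 1" using r by (simp add: abs_square_le_1)
  have "(\<integral>z. iexp (\<Sum>k\<in>{i, j}. t k * (if k = i then fst (correlated_pair r z) else snd (correlated_pair r z))) \<partial>(?G \<Otimes>\<^sub>M ?G)) =
     complex_of_real (exp (- (\<Sum>k\<in>{i, j}. \<Sum>l\<in>{i, j}. t k * t l * (if k = l then 1 else r)) / 2))" for t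
  proof -
    have 1: "(\<Sum>k\<in>{i, j}. t k * (if k = i then fst (correlated_pair r z) else snd (correlated_pair r z))) =
       (t i + t j * r) * fst z + (t j * sqrt (1 - r\<^sup>2)) * snd z" for z
      using ij by (simp add: correlated_pair_def algebra_simps)
    have 2: "(t i + t j * r)\<^sup>2 + (t j * sqrt (1 - r\<^sup>2))\<^sup>2 =
        (\<Sum>k\<in>{i, j}. \<Sum>l\<in>{i, j}. t k * t l * (if k = l then 1 else r))"
      using ij r2 by (simp add: power_mult_distrib) (simp add: power2_eq_square algebra_simps)
    show ?thesis unfolding 1 integral_iexp_std_normal_pair 2 ..
  qed
  moreover have "(\<lambda>z. if k = i then fst (correlated_pair r z) else snd (correlated_pair r z)) \<in> borel_measurable (?G \<Otimes>\<^sub>M ?G)" for k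
    unfolding correlated_pair_def by (cases "k = i") simp_all
  ultimately show ?thesis
    unfolding gaussian_family_def using P.prob_space_axioms by blast
qed

lemma real_pair_measure_eqI:
  fixes M N :: "(real \<times> real) measure"
  assumes M: "prob_space M" "sets M = sets borel" and N: "prob_space N" "sets N = sets borel"
    and eq: "\<And>a b. measure M ({..a} \<times> {..b}) = measure N ({..a} \<times> {..b})"
  shows "M = N"
proof (rule measure_eqI_generator_eq[where E="range (\<lambda>a::real \<times> real. {..a})" and \<Omega>=UNIV and A="\<lambda>n. {..(real n, real n)}"])
  interpret M: prob_space M by fact
  interpret N: prob_space N by fact
  have at: "{..(a, b)} = {..a} \<times> {..b}" for a b :: real by auto
  show "Int_stable (range (\<lambda>a::real \<times> real. {..a}))"
  proof (rule Int_stableI, clarsimp)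
    fix a b c d :: real
    have "{..(a, b)} \<inter> {..(c, d)} = {..(min a c, min b d)}" by auto
    then show "{..(a, b)} \<inter> {..(c, d)} \<in> range atMost" by (metis rangeI)
  qed
  show "emeasure M X = emeasure N X" if "X \<in> range (\<lambda>a::real \<times> real. {..a})" for X
    using that eq by (auto simp: at M.emeasure_eq_measure N.emeasure_eq_measure)
  have "sets (borel :: (real \<times> real) measure) = sigma_sets UNIV (range (\<lambda>a::real \<times> real. {..a}))"
    by (subst borel_eq_atMost) (simp add: sets_measure_of)
  then show "sets M = sigma_sets UNIV (range (\<lambda>a::real \<times> real. {..a}))"
    "sets N = sigma_sets UNIV (range (\<lambda>a::real \<times> real. {..a}))" using M N by auto
  show "(\<Union>n. {..(real n, real n)}) = UNIV"
  proof (intro equalityI subset_UNIV subsetI)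
    fix z :: "real \<times> real"
    obtain n where "max (fst z) (snd z) \<le> real n" using real_arch_simple by blast
    then show "z \<in> (\<Union>n. {..(real n, real n)})" by (cases z) auto
  qed
qed (auto simp: prob_space.emeasure_le_1 M N finite_measure.emeasure_finite prob_space.finite_measure)

lemma gaussian_pair_law:
  assumes X: "gaussian_family M I X C" and ij: "i \<in> I" "j \<in> I" "i \<noteq> j"
    and C: "C i i = 1" "C j j = 1" "C i j = r" "C j i = r" and r: "\<bar>r\<bar> \<le> 1"
  shows "distr M borel (\<lambda>\<omega>. (X i \<omega>, X j \<omega>)) =
    distr std_normal_pair borel (correlated_pair r)"
proof -
  let ?P = "std_normal_pair"
  interpret M: prob_space M by (rule gaussian_familyD[OF X])
  interpret G: prob_space std_normal_distribution by (rule prob_space_std_normal)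
  interpret P: pair_prob_space std_normal_distribution std_normal_distribution ..
  have [measurable]: "X i \<in> borel_measurable M" "X j \<in> borel_measurable M" using gaussian_familyD(3)[OF X] ij by auto
  have m[measurable]: "(\<lambda>\<omega>. (X i \<omega>, X j \<omega>)) \<in> borel_measurable M"
    unfolding borel_prod[symmetric] by measurable
  show ?thesis
  proof (rule real_pair_measure_eqI)
    fix a b :: real
    have [measurable]: "{..a} \<times> {..b} \<in> sets (borel :: (real \<times> real) measure)"
      unfolding borel_prod[symmetric] by measurable
    have "measure M {\<omega> \<in> space M. \<forall>k\<in>{i, j}. X k \<omega> \<le> (if k = i then a else b)} =
      measure ?P {z \<in> space ?P. \<forall>k\<in>{i, j}. (if k = i then fst (correlated_pair r z) else snd (correlated_pair r z)) \<le> (if k = i then a else b)}"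
      using ij C
      by (intro gaussian_family_box_unique[OF gaussian_family_subset[OF X] gaussian_family_correlated_pair[OF r ij(3)]]) auto
    then show "measure (distr M borel (\<lambda>\<omega>. (X i \<omega>, X j \<omega>))) ({..a} \<times> {..b}) =
        measure (distr ?P borel (correlated_pair r)) ({..a} \<times> {..b})"
      using ij
      by (simp add: measure_distr vimage_def Int_def conj_commute mem_Times_iff)
  qed (auto intro!: M.prob_space_distr P.prob_space_distr)
qed

lemma gaussian_marginal_law:
  assumes X: "gaussian_family M I X C" and i: "i \<in> I" and C: "C i i = 1"
  shows "distr M borel (X i) = std_normal_distribution"
proof (rule Levy_uniqueness)
  interpret M: prob_space M by (rule gaussian_familyD[OF X])
  have m[measurable]: "X i \<in> borel_measurable M" using gaussian_familyD(3)[OF X] i by auto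
  show "real_distribution (distr M borel (X i))" using m by (rule M.real_distribution_distr)
  show "real_distribution std_normal_distribution" by (rule real_dist_normal_dist)
  show "char (distr M borel (X i)) = char std_normal_distribution"
    unfolding char_std_normal_distribution
  proof
    fix t
    have "char (distr M borel (X i)) t = (\<integral>\<omega>. iexp (\<Sum>k\<in>{i}. t * X k \<omega>) \<partial>M)"
      unfolding char_def by (subst integral_distr) auto
    also have "\<dots> = complex_of_real (exp (- t\<^sup>2 / 2))"
      using gaussian_familyD(4)[OF gaussian_family_subset[OF X, of "{i}"], of "\<lambda>_. t"] i C
      by (simp add: power2_eq_square)
    finally show "char (distr M borel (X i)) t = complex_of_real (exp (- t\<^sup>2 / 2))" .
  qed
qed

text \<open>In the correlated coordinates \<open>a\<close> and \<open>y\<close> the exponent is (a^2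
  - 2 r a y + y^2) / (2 (1 - r^2)). Replacing \<open>r\<close> by its modulus and discarding a
  multiple of (a - y)^2 leaves a function increasing in both coordinates, so the corner
  \<open>a = y = w\<close> of the quadrant gives the bound.\<close>

lemma correlated_quadratic_form_ge:
  fixes a b r v :: real
  assumes r: "\<bar>r\<bar> < 1" "\<bar>r\<bar> \<le> o'" and w: "0 \<le> w" "w \<le> a" "w \<le> y" and y: "y = r * a + sqrt (1 - r\<^sup>2) * b"
  shows "w\<^sup>2 / (1 + o') \<le> (a\<^sup>2 + b\<^sup>2) / 2"
proof -
  have r2: "0 < 1 - r\<^sup>2" using r by (simp add: abs_square_less_1)
  have "(1 - r\<^sup>2) * b\<^sup>2 = (sqrt (1 - r\<^sup>2) * b)\<^sup>2" using r2 by (simp add: power_mult_distrib)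
  also have "\<dots> = (y - r * a)\<^sup>2" unfolding y by simp
  finally have "(1 - r\<^sup>2) * (a\<^sup>2 + b\<^sup>2) = a\<^sup>2 + y\<^sup>2 - 2 * r * (a * y)"
    by (simp add: power2_eq_square algebra_simps)
  also have "\<dots> \<ge> a\<^sup>2 + y\<^sup>2 - 2 * \<bar>r\<bar> * (a * y)"
    using w by (auto intro!: mult_right_mono)
  also have "a\<^sup>2 + y\<^sup>2 - 2 * \<bar>r\<bar> * (a * y) = (1 - \<bar>r\<bar>) * (a\<^sup>2 + y\<^sup>2) + \<bar>r\<bar> * (a - y)\<^sup>2"
    by (simp add: power2_eq_square algebra_simps)
  also have "\<dots> \<ge> (1 - \<bar>r\<bar>) * (w\<^sup>2 + w\<^sup>2) + 0"
    using r w by (intro add_mono mult_left_mono power_mono) auto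
  finally have "2 * (1 - \<bar>r\<bar>) * w\<^sup>2 \<le> (1 - \<bar>r\<bar>) * (1 + \<bar>r\<bar>) * (a\<^sup>2 + b\<^sup>2)"
    by (simp add: power2_eq_square algebra_simps)
  then have "(1 - \<bar>r\<bar>) * (2 * w\<^sup>2) \<le> (1 - \<bar>r\<bar>) * ((1 + \<bar>r\<bar>) * (a\<^sup>2 + b\<^sup>2))" by (simp add: algebra_simps)
  then have "2 * w\<^sup>2 \<le> (1 + \<bar>r\<bar>) * (a\<^sup>2 + b\<^sup>2)" using r by (simp add: mult_le_cancel_left_pos)
  also have "\<dots> \<le> (1 + o') * (a\<^sup>2 + b\<^sup>2)" using r by (intro mult_right_mono) auto
  finally show ?thesis using r by (simp add: field_simps)
qed

text \<open>For a fixed first coordinate the second condition confines \<open>b\<close> to an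
  interval of length \<open>e / \<sigma>\<close>, and on the whole region the density is at most
  \<open>exp (- w\<^sup>2 / (1 + o'))\<close>; the factor 1 / (2 pi) is simply dropped. The bound
  \<open>d\<close> makes the constant uniform over pairs.\<close>

lemma correlated_pair_window:
  assumes r: "\<bar>r\<bar> < 1" "\<bar>r\<bar> \<le> o'" "\<bar>r\<bar> \<le> d" "d < 1" and w: "0 \<le> w" "w \<le> u" "w \<le> v" and e: "0 < e"
  shows "measure std_normal_pair
    {z \<in> space std_normal_pair.
      fst (correlated_pair r z) \<in> {u<..<u + e} \<and> snd (correlated_pair r z) \<in> {v<..<v + e}}
    \<le> e\<^sup>2 * (exp (- w\<^sup>2 / (1 + o')) / sqrt (1 - d\<^sup>2))" (is "measure ?P ?S \<le> _")
proof -
  let ?G = std_normal_distribution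
  interpret G: prob_space ?G by (rule prob_space_std_normal)
  interpret P: pair_prob_space ?G ?G ..
  define \<sigma> where "\<sigma> = sqrt (1 - r\<^sup>2)"
  define c where "c = exp (- w\<^sup>2 / (1 + o'))"
  have \<sigma>: "0 < \<sigma>" unfolding \<sigma>_def using r(1) by (simp add: abs_square_less_1)
  have d: "0 < sqrt (1 - d\<^sup>2)" "sqrt (1 - d\<^sup>2) \<le> \<sigma>"
  proof -
    have d1: "\<bar>d\<bar> < 1" using r by auto
    then show "0 < sqrt (1 - d\<^sup>2)" by (simp add: abs_square_less_1)
    show "sqrt (1 - d\<^sup>2) \<le> \<sigma>" unfolding \<sigma>_def using r(3) by (simp add: abs_le_square_iff[symmetric])
  qed
  have S[measurable]: "?S \<in> sets ?P" unfolding correlated_pair_def by measurable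
  have pt: "ennreal (std_normal_density a) * ennreal (std_normal_density b) * indicator ?S (a, b) \<le>
     ennreal c * (indicator {u<..<u + e} a * indicator {(v - r * a) / \<sigma><..<(v - r * a) / \<sigma> + e / \<sigma>} b)" for a b
  proof (cases "(a, b) \<in> ?S")
    case True
    then have ab: "a \<in> {u<..<u + e}" "r * a + \<sigma> * b \<in> {v<..<v + e}"
      unfolding correlated_pair_def \<sigma>_def by auto
    then have b: "b \<in> {(v - r * a) / \<sigma><..<(v - r * a) / \<sigma> + e / \<sigma>}"
      using \<sigma> by (auto simp: field_simps add_divide_distrib[symmetric])
    have "w\<^sup>2 / (1 + o') \<le> (a\<^sup>2 + b\<^sup>2) / 2"
      using ab w by (intro correlated_quadratic_form_ge[OF r(1,2) w(1) _ _ refl]) (auto simp: \<sigma>_def)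
    moreover have "std_normal_density a * std_normal_density b = exp (- (a\<^sup>2 + b\<^sup>2) / 2) / (2 * pi)"
      by (simp add: std_normal_density_def exp_add[symmetric] add_divide_distrib diff_divide_distrib)
    moreover have "exp (- (a\<^sup>2 + b\<^sup>2) / 2) / (2 * pi) \<le> exp (- (a\<^sup>2 + b\<^sup>2) / 2) / 1"
      using pi_ge_two by (intro divide_left_mono) auto
    moreover have "exp (- (a\<^sup>2 + b\<^sup>2) / 2) \<le> c" unfolding c_def using calculation(1) by simp
    ultimately have "std_normal_density a * std_normal_density b \<le> c" by linarith
    then show ?thesis using True ab b by (simp add: ennreal_mult[symmetric] ennreal_leI)
  qed simp
  have "emeasure ?P ?S = (\<integral>\<^sup>+ a. emeasure ?G (Pair a -` ?S) \<partial>?G)"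
    by (rule G.emeasure_pair_measure_alt) measurable
  also have "\<dots> = (\<integral>\<^sup>+ a. ennreal (std_normal_density a) * (\<integral>\<^sup>+ b. ennreal (std_normal_density b) * indicator (Pair a -` ?S) b \<partial>lborel) \<partial>lborel)"
  proof (subst nn_integral_density)
    have "(\<lambda>a. emeasure ?G (Pair a -` ?S)) \<in> borel_measurable ?G"
      by (rule G.measurable_emeasure_Pair[OF S])
    then show "(\<lambda>a. emeasure ?G (Pair a -` ?S)) \<in> borel_measurable lborel" by simp
    have PS: "Pair a -` ?S \<in> sets lborel" for a using sets_Pair1[OF S, of a] by simp
    show "(\<integral>\<^sup>+ a. ennreal (std_normal_density a) * emeasure ?G (Pair a -` ?S) \<partial>lborel) =
       (\<integral>\<^sup>+ a. ennreal (std_normal_density a) * (\<integral>\<^sup>+ b. ennreal (std_normal_density b) * indicator (Pair a -` ?S) b \<partial>lborel) \<partial>lborel)"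
      by (intro nn_integral_cong arg_cong2[where f="(*)"] refl emeasure_density PS) simp
  qed simp
  also have "\<dots> = (\<integral>\<^sup>+ a. (\<integral>\<^sup>+ b. ennreal (std_normal_density a) * ennreal (std_normal_density b) * indicator ?S (a, b) \<partial>lborel) \<partial>lborel)"
  proof (intro nn_integral_cong)
    fix a :: real
    have PS: "Pair a -` ?S \<in> sets borel" using sets_Pair1[OF S, of a] by simp
    have eq: "indicator ?S (a, b) = (indicator (Pair a -` ?S) b :: ennreal)" for b
      by (simp only: indicator_def vimage_eq)
    have "(\<lambda>b. ennreal (std_normal_density b) * indicator (Pair a -` ?S) b) \<in> borel_measurable lborel"
      using PS by (intro borel_measurable_times_ennreal borel_measurable_indicator) simp_all
    from nn_integral_cmult[OF this, of "ennreal (std_normal_density a)"]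
    show "ennreal (std_normal_density a) * (\<integral>\<^sup>+ b. ennreal (std_normal_density b) * indicator (Pair a -` ?S) b \<partial>lborel) =
      (\<integral>\<^sup>+ b. ennreal (std_normal_density a) * ennreal (std_normal_density b) * indicator ?S (a, b) \<partial>lborel)"
      unfolding eq mult.assoc by (rule sym)
  qed
  also have "\<dots> \<le> (\<integral>\<^sup>+ a. (\<integral>\<^sup>+ b. ennreal c * (indicator {u<..<u + e} a * indicator {(v - r * a) / \<sigma><..<(v - r * a) / \<sigma> + e / \<sigma>} b) \<partial>lborel) \<partial>lborel)"
    by (intro nn_integral_mono pt)
  also have "\<dots> = (\<integral>\<^sup>+ a. ennreal c * ennreal (e / \<sigma>) * indicator {u<..<u + e} a \<partial>lborel)"
  proof (intro nn_integral_cong)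
    fix a :: real
    have "(\<integral>\<^sup>+ b. ennreal c * (indicator {u<..<u + e} a * indicator {(v - r * a) / \<sigma><..<(v - r * a) / \<sigma> + e / \<sigma>} b) \<partial>lborel) =
       (\<integral>\<^sup>+ b. ennreal c * indicator {u<..<u + e} a * indicator {(v - r * a) / \<sigma><..<(v - r * a) / \<sigma> + e / \<sigma>} b \<partial>lborel)"
      by (simp add: mult.assoc)
    also have "\<dots> = ennreal c * indicator {u<..<u + e} a * ennreal (e / \<sigma>)"
      using e \<sigma> by (subst nn_integral_cmult_indicator) auto
    finally show "(\<integral>\<^sup>+ b. ennreal c * (indicator {u<..<u + e} a * indicator {(v - r * a) / \<sigma><..<(v - r * a) / \<sigma> + e / \<sigma>} b) \<partial>lborel) =
       ennreal c * ennreal (e / \<sigma>) * indicator {u<..<u + e} a" by (simp add: mult_ac)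
  qed
  also have "\<dots> = ennreal c * ennreal (e / \<sigma>) * ennreal e"
    using e by (subst nn_integral_cmult_indicator) auto
  also have "\<dots> = ennreal (c * (e / \<sigma>) * e)"
  proof -
    have "0 \<le> c" "0 \<le> e / \<sigma>" "0 \<le> e" using e \<sigma> by (auto simp: c_def)
    then show ?thesis by (simp only: ennreal_mult mult_nonneg_nonneg)
  qed
  finally have "measure ?P ?S \<le> c * (e / \<sigma>) * e"
    using e \<sigma> by (simp add: P.emeasure_eq_measure c_def)
  also have "\<dots> = e\<^sup>2 * (c / \<sigma>)" by (simp add: power2_eq_square)
  also have "\<dots> \<le> e\<^sup>2 * (c / sqrt (1 - d\<^sup>2))"
    using d \<sigma> by (intro mult_left_mono divide_left_mono) (auto simp: c_def)
  finally show ?thesis unfolding c_def .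
qed

text \<open>Berman's form of the comparison. The exponent uses the individual bound
  \<open>o' i j\<close>, which is what separates short from long lags; the constant uses the uniform
  \<open>d\<close>. Both are requested only where the covariances differ, so pairs with correlation
  close to one are harmless as long as the two arrays agree on them.\<close>

theorem normal_comparison:
  fixes M :: "'a measure" and N :: "'b measure" and C D o' :: "'i \<Rightarrow> 'i \<Rightarrow> real"
  assumes X: "gaussian_family M I X C" and Y: "gaussian_family N I Y D"
    and diag: "\<And>i. i \<in> I \<Longrightarrow> C i i = 1" "\<And>i. i \<in> I \<Longrightarrow> D i i = 1"
    and sym: "\<And>i j. i \<in> I \<Longrightarrow> j \<in> I \<Longrightarrow> C i j = C j i" "\<And>i j. i \<in> I \<Longrightarrow> j \<in> I \<Longrightarrow> D i j = D j i"
    and w: "0 \<le> w" "\<And>i. i \<in> I \<Longrightarrow> w \<le> u i" and d: "d < 1"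
    and o: "\<And>i j. i \<in> I \<Longrightarrow> j \<in> I \<Longrightarrow> i \<noteq> j \<Longrightarrow> C i j \<noteq> D i j \<Longrightarrow>
      \<bar>C i j\<bar> \<le> o' i j \<and> \<bar>D i j\<bar> \<le> o' i j \<and> o' i j \<le> d"
  shows "\<bar>measure M {\<omega> \<in> space M. \<forall>i\<in>I. X i \<omega> \<le> u i} - measure N {\<omega> \<in> space N. \<forall>i\<in>I. Y i \<omega> \<le> u i}\<bar>
    \<le> 8 * (\<Sum>i\<in>I. \<Sum>j\<in>I - {i}. \<bar>C i j - D i j\<bar> * (exp (- w\<^sup>2 / (1 + o' i j)) / sqrt (1 - d\<^sup>2)))"
proof (rule gaussian_box_comparison[OF X Y])
  fix h e :: real and i j
  assume h: "0 < h" "h < 1" and ij: "i \<in> I" "j \<in> I" "i \<noteq> j" and ne: "C i j \<noteq> D i j" and e: "0 < e"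
  define V where "V k z = sqrt h * X k (fst z) + sqrt (1 - h) * Y k (snd z)" for k and z :: "'a \<times> 'b"
  define r where "r = h * C i j + (1 - h) * D i j"
  let ?P = "M \<Otimes>\<^sub>M N" and ?G = "std_normal_pair"
  have V: "gaussian_family ?P I V (\<lambda>i j. h * C i j + (1 - h) * D i j)"
    unfolding V_def using gaussian_family_interpolate[OF X Y, of h] h by simp
  \<comment> \<open>The interpolated correlation is a convex combination, so the bound valid at both
    ends holds along the whole path.\<close>
  have "\<bar>r\<bar> \<le> h * \<bar>C i j\<bar> + (1 - h) * \<bar>D i j\<bar>"
    unfolding r_def using h by (intro order_trans[OF abs_triangle_ineq]) (simp add: abs_mult)
  also have "\<dots> \<le> h * o' i j + (1 - h) * o' i j"
    using o[OF ij ne] h by (intro add_mono mult_left_mono) auto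
  finally have r: "\<bar>r\<bar> \<le> o' i j" by (simp add: algebra_simps)
  then have r1: "\<bar>r\<bar> < 1" "\<bar>r\<bar> \<le> d" using o[OF ij ne] d by auto
  have law: "distr ?P borel (\<lambda>\<omega>. (V i \<omega>, V j \<omega>)) = distr ?G borel (correlated_pair r)"
    using diag sym ij r1 by (intro gaussian_pair_law[OF V ij]) (auto simp: r_def)
  have [measurable]: "V i \<in> borel_measurable ?P" "V j \<in> borel_measurable ?P" using gaussian_familyD(3)[OF V] ij by auto
  have m[measurable]: "(\<lambda>\<omega>. (V i \<omega>, V j \<omega>)) \<in> borel_measurable ?P"
    unfolding borel_prod[symmetric] by measurable
  let ?B = "{u i<..<u i + e} \<times> {u j<..<u j + e}"
  have B[measurable]: "?B \<in> sets (borel :: (real \<times> real) measure)"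
    unfolding borel_prod[symmetric] by measurable
  have "measure ?P {z \<in> space ?P. V i z \<in> {u i<..<u i + e} \<and> V j z \<in> {u j<..<u j + e}} =
      measure (distr ?P borel (\<lambda>\<omega>. (V i \<omega>, V j \<omega>))) ?B"
    by (subst measure_distr) (auto intro!: arg_cong[where f="measure ?P"])
  also have "\<dots> = measure ?G {z \<in> space ?G. fst (correlated_pair r z) \<in> {u i<..<u i + e} \<and> snd (correlated_pair r z) \<in> {u j<..<u j + e}}"
    unfolding law by (subst measure_distr) (auto intro!: arg_cong[where f="measure ?G"] simp: mem_Times_iff)
  also have "\<dots> \<le> e\<^sup>2 * (exp (- w\<^sup>2 / (1 + o' i j)) / sqrt (1 - d\<^sup>2))"
    using w ij e by (intro correlated_pair_window r r1 d) auto
  finally show "measure ?P {z \<in> space ?P. sqrt h * X i (fst z) + sqrt (1 - h) * Y i (snd z) \<in> {u i<..<u i + e} \<and>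
      sqrt h * X j (fst z) + sqrt (1 - h) * Y j (snd z) \<in> {u j<..<u j + e}}
     \<le> e\<^sup>2 * (exp (- w\<^sup>2 / (1 + o' i j)) / sqrt (1 - d\<^sup>2))"
    unfolding V_def .
qed (simp add: diag)

section \<open>The normal tail at the normalising levels\<close>

lemma measure_std_normal_eq:
  assumes [measurable]: "A \<in> sets borel"
  shows "measure std_normal_distribution A = (\<integral>x. std_normal_density x * indicator A x \<partial>lborel)"
proof -
  interpret G: prob_space std_normal_distribution by (rule prob_space_std_normal)
  have "measure std_normal_distribution A = (\<integral>x. indicator A x \<partial>std_normal_distribution)" by simp
  also have "\<dots> = (\<integral>x. std_normal_density x *\<^sub>R indicator A x \<partial>lborel)"
    by (rule integral_density) auto
  finally show ?thesis by simp
qed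

lemma std_normal_cdf_diff:
  assumes "a \<le> b"
  shows "std_normal_cdf b - std_normal_cdf a = integral {a..b} std_normal_density"
proof (cases "a < b")
  case True
  interpret G: real_distribution std_normal_distribution by (rule real_dist_normal_dist)
  have "std_normal_cdf b - std_normal_cdf a = measure std_normal_distribution {a<..b}"
    unfolding std_normal_cdf_def by (rule G.cdf_diff_eq[OF True])
  also have "\<dots> = (\<integral>x. std_normal_density x * indicator {a<..b} x \<partial>lborel)"
    by (rule measure_std_normal_eq) simp
  also have "\<dots> = (\<integral>x. std_normal_density x * indicator {a..b} x \<partial>lborel)"
    by (rule integral_cong_AE) (use AE_lborel_singleton[of a] in \<open>auto split: split_indicator\<close>)
  also have "\<dots> = (LINT x:{a..b}|lborel. std_normal_density x)"
    by (simp add: set_lebesgue_integral_def mult.commute)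
  also have "\<dots> = integral {a..b} std_normal_density"
    by (intro set_borel_integral_eq_integral)
      (auto simp: set_integrable_def intro!: integrable_mult_indicator[where 'b=real, simplified])
  finally show ?thesis .
qed (use assms in simp)

lemma continuous_std_normal_density: "continuous_on A std_normal_density"
  unfolding std_normal_density_def by (intro continuous_intros) auto

lemma std_normal_cdf_deriv: "(std_normal_cdf has_real_derivative std_normal_density x) (at x)"
proof -
  have "((\<lambda>t. integral {x - 1..t} std_normal_density) has_real_derivative std_normal_density x) (at x within {x - 1..x + 1})"
    by (intro integral_has_real_derivative continuous_std_normal_density) auto
  then have "((\<lambda>t. integral {x - 1..t} std_normal_density) has_real_derivative std_normal_density x) (at x)"
    by (simp add: at_within_Icc_at)
  then have "((\<lambda>t. integral {x - 1..t} std_normal_density + std_normal_cdf (x - 1)) has_real_derivative std_normal_density x) (at x)"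
    by (auto intro!: derivative_eq_intros)
  then show ?thesis
  proof (rule has_field_derivative_transform_within_open[where S="{x - 1<..<x + 1}"])
    fix t assume "t \<in> {x - 1<..<x + 1}"
    then show "integral {x - 1..t} std_normal_density + std_normal_cdf (x - 1) = std_normal_cdf t"
      using std_normal_cdf_diff[of "x - 1" t] by simp
  qed auto
qed

lemma continuous_std_normal_cdf: "continuous_on UNIV std_normal_cdf"
  using DERIV_isCont[OF std_normal_cdf_deriv] by (simp add: continuous_on_eq_continuous_at)

lemma borel_measurable_std_normal_cdf[measurable]: "std_normal_cdf \<in> borel_measurable borel"
  by (rule borel_measurable_continuous_onI[OF continuous_std_normal_cdf])

lemma tendsto_std_normal_cdf[tendsto_intros]:
  "(f \<longlongrightarrow> a) F \<Longrightarrow> ((\<lambda>x. std_normal_cdf (f x)) \<longlongrightarrow> std_normal_cdf a) F"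
  using DERIV_isCont[OF std_normal_cdf_deriv, of a] by (rule isCont_tendsto_compose)

lemma std_normal_cdf_at_top: "(std_normal_cdf \<longlongrightarrow> 1) at_top"
  using real_distribution.cdf_lim_at_top_prob[OF real_dist_normal_dist]
  unfolding std_normal_cdf_def[abs_def] by simp

lemma std_normal_cdf_at_bot: "(std_normal_cdf \<longlongrightarrow> 0) at_bot"
  using finite_borel_measure.cdf_lim_at_bot[OF real_distribution.finite_borel_measure_M[OF real_dist_normal_dist]]
  unfolding std_normal_cdf_def[abs_def] by simp

lemma std_normal_cdf_bounds: "0 \<le> std_normal_cdf x" "std_normal_cdf x \<le> 1"
  unfolding std_normal_cdf_def cdf_def using prob_space.prob_le_1[OF prob_space_std_normal] by auto

lemma norm_u_eq:
  assumes "2 \<le> n"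
  shows "norm_u n s = sqrt (2 * ln n) + (s - ln (4 * pi * ln n) / 2) / sqrt (2 * ln n)"
  using assms unfolding norm_u_def norm_a_def norm_b_def by (simp add: field_simps)

text \<open>With c = ln (4 pi ln n) / 2 the squared level is 2 ln n + 2 (s - c) + (s - c)^2 / (2 ln
  n). The \<open>c\<close> contained in \<open>norm_b\<close> supplies the factor
  \<open>sqrt (4 * pi * ln n)\<close> that compensates the prefactor of the normal tail, and the
  last term is the whole error.\<close>

lemma exp_neg_norm_u_sq:
  assumes n: "2 \<le> n"
  shows "exp (- (norm_u n s)\<^sup>2 / 2) =
    sqrt (4 * pi * ln n) / n * (exp (- s) * exp (- (s - ln (4 * pi * ln n) / 2)\<^sup>2 / (4 * ln n)))"
proof -
  define l where "l = sqrt (2 * ln n)"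
  define c where "c = ln (4 * pi * ln n) / 2"
  have ln: "0 < ln (real n)" using n by simp
  have l: "0 < l" "l\<^sup>2 = 2 * ln n" unfolding l_def using ln by auto
  have "(norm_u n s)\<^sup>2 = l\<^sup>2 + 2 * (s - c) + (s - c)\<^sup>2 / l\<^sup>2"
    unfolding norm_u_eq[OF n] l_def[symmetric] c_def[symmetric]
    using l(1) by (simp add: power2_sum power_divide) 
  then have "- (norm_u n s)\<^sup>2 / 2 = c + - ln n + (- s + - (s - c)\<^sup>2 / (4 * ln n))"
    unfolding l(2) using ln by (simp add: field_simps)
  then have "exp (- (norm_u n s)\<^sup>2 / 2) = exp c * exp (- ln n) * (exp (- s) * exp (- (s - c)\<^sup>2 / (4 * ln n)))"
    by (simp only: exp_add)
  moreover have "exp c = sqrt (4 * pi * ln n)"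
  proof (rule real_sqrt_unique[symmetric])
    show "(exp c)\<^sup>2 = 4 * pi * ln n" unfolding c_def using ln by (simp add: exp_double[symmetric])
  qed simp
  moreover have "exp (- ln n) = 1 / real n" using n by (simp add: exp_minus field_simps)
  ultimately show ?thesis unfolding c_def by simp
qed

text \<open>With these normalising constants \<open>n a\<^sub>n \<phi>(u\<^sub>n s)\<close> is exactly \<open>exp (- s)\<close> times a factor at most one, which
  provides the dominating function for all tail integrals.\<close>

definition tail_density :: "nat \<Rightarrow> real \<Rightarrow> real" where
  "tail_density n s = exp (- s) * exp (- (s - ln (4 * pi * ln n) / 2)\<^sup>2 / (4 * ln n))"

lemma std_normal_density_norm_u:
  assumes n: "2 \<le> n"
  shows "n * norm_a n * std_normal_density (norm_u n s) = tail_density n s"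
proof -
  have ln: "0 < ln (real n)" using n by simp
  have "sqrt (4 * pi * ln n) = sqrt (2 * pi) * sqrt (2 * ln n)" by (simp add: real_sqrt_mult[symmetric])
  then show ?thesis
    unfolding std_normal_density_def exp_neg_norm_u_sq[OF n] tail_density_def norm_a_def
    using n ln by (simp add: field_simps)
qed

lemma tail_density_bounds: "0 \<le> tail_density n s" "2 \<le> n \<Longrightarrow> tail_density n s \<le> exp (- s)"
  unfolding tail_density_def by (auto intro!: mult_left_le)

lemma tail_density_tendsto: "(\<lambda>n. tail_density n s) \<longlonglongrightarrow> exp (- s)"
proof -
  have "(\<lambda>n. exp (- (s - ln (4 * pi * ln (real n)) / 2)\<^sup>2 / (4 * ln n))) \<longlonglongrightarrow> 1"
    by real_asymp
  from tendsto_mult[OF tendsto_const this, of "exp (- s)"] show ?thesis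
    unfolding tail_density_def by simp
qed

lemma borel_measurable_tail_density[measurable]: "tail_density n \<in> borel_measurable borel"
  unfolding tail_density_def[abs_def] by measurable

lemma integrable_exp_neg_Ioi:
  fixes x :: real
  shows "integrable lborel (\<lambda>s. exp (- s) * indicator {x<..} s)"
  "(\<integral>s. exp (- s) * indicator {x<..} s \<partial>lborel) = exp (- x)"
proof -
  have "(\<integral>\<^sup>+s. ennreal (exp (- s)) * indicator {x ..} s \<partial>lborel) = ennreal (0 - (- exp (- x)))"
    by (rule nn_integral_FTC_atLeast) (auto intro!: derivative_eq_intros, real_asymp)
  moreover have "(\<integral>\<^sup>+s. ennreal (exp (- s)) * indicator {x ..} s \<partial>lborel) =
      (\<integral>\<^sup>+s. ennreal (exp (- s) * indicator {x<..} s) \<partial>lborel)"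
    by (rule nn_integral_cong_AE) (use AE_lborel_singleton[of x] in \<open>auto split: split_indicator\<close>)
  ultimately have *: "(\<integral>\<^sup>+s. ennreal (exp (- s) * indicator {x<..} s) \<partial>lborel) = ennreal (exp (- x))" by simp
  then show "integrable lborel (\<lambda>s. exp (- s) * indicator {x<..} s)"
    by (intro integrableI_nn_integral_finite[OF _ _ *]) auto
  show "(\<integral>s. exp (- s) * indicator {x<..} s \<partial>lborel) = exp (- x)"
    using * by (subst integral_eq_nn_integral) auto
qed

text \<open>The integrand is dominated by \<open>exp (- s)\<close> on the half-line. Convergence may
  fail at one point \<open>y\<close>, because under complete dependence the limit of
  \<open>Q\<close> is an indicator that jumps there.\<close>

lemma tail_integral_tendsto:
  assumes [measurable]: "\<And>n. Q n \<in> borel_measurable borel" and Q: "\<And>n s. 0 \<le> Q n s" "\<And>n s. Q n s \<le> (1::real)"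
    and lim: "\<And>s. s \<noteq> y \<Longrightarrow> (\<lambda>n. Q n s) \<longlonglongrightarrow> R s" and [measurable]: "R \<in> borel_measurable borel"
  shows "(\<lambda>n. \<integral>s. tail_density n s * indicator {x<..} s * Q n s \<partial>lborel) \<longlonglongrightarrow>
    (\<integral>s. exp (- s) * indicator {x<..} s * R s \<partial>lborel)"
proof -
  \<comment> \<open>The shift by 2 is made because \<open>tail_density\<close> is dominated only for
    \<open>2 \<le> n\<close>.\<close>
  have "(\<lambda>n. \<integral>s. tail_density (n + 2) s * indicator {x<..} s * Q (n + 2) s \<partial>lborel) \<longlonglongrightarrow>
    (\<integral>s. exp (- s) * indicator {x<..} s * R s \<partial>lborel)"
  proof (rule integral_dominated_convergence[where w="\<lambda>s. exp (- s) * indicator {x<..} s"])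
    show "integrable lborel (\<lambda>s. exp (- s) * indicator {x<..} s)" by (rule integrable_exp_neg_Ioi)
    show "AE s in lborel. (\<lambda>n. tail_density (n + 2) s * indicator {x<..} s * Q (n + 2) s) \<longlonglongrightarrow> exp (- s) * indicator {x<..} s * R s"
      using AE_lborel_singleton[of y]
    proof eventually_elim
      case (elim s)
      show ?case
        by (intro tendsto_mult tendsto_const LIMSEQ_ignore_initial_segment[OF tail_density_tendsto]
            LIMSEQ_ignore_initial_segment[OF lim[OF elim]])
    qed
    show "AE s in lborel. norm (tail_density (n + 2) s * indicator {x<..} s * Q (n + 2) s) \<le> exp (- s) * indicator {x<..} s" for n
    proof (intro AE_I2)
      fix s
      have "tail_density (n + 2) s * Q (n + 2) s \<le> exp (- s) * 1"
        using tail_density_bounds[of "n + 2" s] Q by (intro mult_mono) auto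
      then show "norm (tail_density (n + 2) s * indicator {x<..} s * Q (n + 2) s) \<le> exp (- s) * indicator {x<..} s"
        using tail_density_bounds(1)[of "n + 2" s] Q(1)[of "n + 2" s] by (auto split: split_indicator)
    qed
  qed measurable
  then show ?thesis by (rule LIMSEQ_offset)
qed

section \<open>Exceedance probability of a bivariate normal pair\<close>

definition binormal_cdf :: "real \<Rightarrow> real \<Rightarrow> real \<Rightarrow> real" where
  "binormal_cdf r s t = measure std_normal_pair
     {z. fst (correlated_pair r z) \<le> s \<and> snd (correlated_pair r z) \<le> t}"

lemma space_std_normal_pair:
  "space std_normal_pair = UNIV"
  by (simp add: space_pair_measure)

lemma measurable_fst_snd_correlated_pair [measurable]:
  "(\<lambda>z. fst (correlated_pair r z)) \<in> borel_measurable std_normal_pair"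
  "(\<lambda>z. snd (correlated_pair r z)) \<in> borel_measurable std_normal_pair"
  unfolding correlated_pair_def by simp_all

lemma sets_correlated_pair_box [measurable]:
  "{z. fst (correlated_pair r z) \<le> s \<and> snd (correlated_pair r z) \<le> t} \<in>
    sets std_normal_pair"
proof -
  have "{z \<in> space std_normal_pair.
      fst (correlated_pair r z) \<le> s \<and> snd (correlated_pair r z) \<le> t} \<in>
    sets std_normal_pair"
    by measurable
  then show ?thesis by (simp add: space_std_normal_pair)
qed

text \<open>The affine substitution a = \<open>norm_u n s\<close>; the factor \<open>q\<close> will
  be a conditional probability given the first coordinate.\<close>

lemma scaled_std_normal_tail:
  assumes n: "2 \<le> n"
  shows "n * (\<integral>a. std_normal_density a * indicator {norm_u n x<..} a * q a \<partial>lborel) =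
    (\<integral>s. tail_density n s * indicator {x<..} s * q (norm_u n s) \<partial>lborel)"
proof -
  have a: "0 < norm_a n" using n unfolding norm_a_def by simp
  have u: "norm_u n s = norm_b n + norm_a n * s" for s unfolding norm_u_def by simp
  have "(\<integral>a. std_normal_density a * indicator {norm_u n x<..} a * q a \<partial>lborel) =
     \<bar>norm_a n\<bar> *\<^sub>R (\<integral>s. std_normal_density (norm_u n s) * indicator {norm_u n x<..} (norm_u n s) * q (norm_u n s) \<partial>lborel)"
    unfolding u using a by (intro lborel_integral_real_affine) simp
  also have "\<dots> = norm_a n * (\<integral>s. std_normal_density (norm_u n s) * indicator {x<..} s * q (norm_u n s) \<partial>lborel)"
    using a by (auto simp: u indicator_def)
  finally have "n * (\<integral>a. std_normal_density a * indicator {norm_u n x<..} a * q a \<partial>lborel) =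
     (\<integral>s. n * norm_a n * (std_normal_density (norm_u n s) * indicator {x<..} s * q (norm_u n s)) \<partial>lborel)"
    by simp
  then show ?thesis
    unfolding mult.assoc[symmetric] std_normal_density_norm_u[OF n] .
qed

lemma std_normal_tail_tendsto: "(\<lambda>n. n * (1 - std_normal_cdf (norm_u n x))) \<longlonglongrightarrow> exp (- x)"
proof -
  interpret G: prob_space std_normal_distribution by (rule prob_space_std_normal)
  have compl: "1 - std_normal_cdf t = (\<integral>a. std_normal_density a * indicator {t<..} a * 1 \<partial>lborel)" for t
  proof -
    have "1 - std_normal_cdf t = measure std_normal_distribution (UNIV - {..t})"
      unfolding std_normal_cdf_def cdf_def using G.prob_compl[of "{..t}"] by simp
    also have "UNIV - {..t} = {t<..}" by auto
    finally show ?thesis using measure_std_normal_eq[of "{t<..}"] by simp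
  qed
  have "(\<lambda>n. \<integral>s. tail_density n s * indicator {x<..} s * 1 \<partial>lborel) \<longlonglongrightarrow> (\<integral>s. exp (- s) * indicator {x<..} s * 1 \<partial>lborel)"
    by (rule tail_integral_tendsto) auto
  then have "(\<lambda>n. \<integral>s. tail_density n s * indicator {x<..} s * 1 \<partial>lborel) \<longlonglongrightarrow> exp (- x)"
    by (simp add: integrable_exp_neg_Ioi)
  moreover have "\<forall>\<^sub>F n in sequentially. (\<integral>s. tail_density n s * indicator {x<..} s * 1 \<partial>lborel) = n * (1 - std_normal_cdf (norm_u n x))"
    using eventually_ge_at_top[of 2] by eventually_elim (simp only: compl scaled_std_normal_tail)
  ultimately show ?thesis by (rule Lim_transform_eventually)
qed

text \<open>The complement is split into the second coordinate exceeding \<open>t\<close> and,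
  disjointly, the first exceeding \<open>s\<close> while the second does not exceed
  \<open>t\<close>; the latter event is integrated over the first coordinate. The conditional event
  is left undivided by the square root, so that \<open>r\<close> of modulus one is covered.\<close>

lemma binormal_cdf_complement:
  "1 - binormal_cdf r s t = (1 - std_normal_cdf t) +
    (\<integral>a. std_normal_density a * indicator {s<..} a * measure std_normal_distribution {b. sqrt (1 - r\<^sup>2) * b \<le> t - r * a} \<partial>lborel)"
  if r: "\<bar>r\<bar> \<le> 1"
proof -
  let ?G = std_normal_distribution
  let ?P = "?G \<Otimes>\<^sub>M ?G"
  interpret G: prob_space ?G by (rule prob_space_std_normal)
  interpret P: pair_prob_space ?G ?G ..
  let ?A = "{z. fst (correlated_pair r z) \<le> s \<and> snd (correlated_pair r z) \<le> t}"
  let ?B = "{z \<in> space ?P. t < snd (correlated_pair r z)}"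
  let ?C = "{z \<in> space ?P. s < fst (correlated_pair r z) \<and> snd (correlated_pair r z) \<le> t}"
  have B[measurable]: "?B \<in> sets ?P" by measurable
  have C[measurable]: "?C \<in> sets ?P" by measurable
  have "1 - binormal_cdf r s t = P.prob (space ?P - ?A)"
    unfolding binormal_cdf_def by (rule P.prob_compl[symmetric]) measurable
  also have "space ?P - ?A = ?B \<union> ?C" by (auto simp: space_std_normal_pair)
  also have "P.prob (?B \<union> ?C) = P.prob ?B + P.prob ?C"
    by (rule P.finite_measure_Union[OF B C]) auto
  also have "P.prob ?B = 1 - std_normal_cdf t"
  proof -
    have m: "gaussian_family ?P {0::nat, 1}
      (\<lambda>k z. if k = 0 then fst (correlated_pair r z) else snd (correlated_pair r z)) (\<lambda>k l. if k = l then 1 else r)"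
      by (rule gaussian_family_correlated_pair[OF r]) simp
    have "distr ?P borel (\<lambda>z. snd (correlated_pair r z)) = ?G"
      using gaussian_marginal_law[OF m, of 1] by simp
    then have "measure ?G {t<..} = measure (distr ?P borel (\<lambda>z. snd (correlated_pair r z))) {t<..}" by simp
    also have "\<dots> = P.prob ((\<lambda>z. snd (correlated_pair r z)) -` {t<..} \<inter> space ?P)"
      by (rule measure_distr) measurable
    also have "(\<lambda>z. snd (correlated_pair r z)) -` {t<..} \<inter> space ?P = ?B" by auto
    finally have "measure ?G {t<..} = P.prob ?B" .
    moreover have "{t<..} = UNIV - {..t}" by auto
    ultimately show ?thesis unfolding std_normal_cdf_def cdf_def using G.prob_compl[of "{..t}"] by simp
  qed
  also have "P.prob ?C = (\<integral>z. indicator ?C z \<partial>?P)"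
    using sets.Int_space_eq2[OF C] by simp
  also have "\<dots> = (\<integral>a. (\<integral>b. indicator ?C (a, b) \<partial>?G) \<partial>?G)"
    by (rule P.integral_fst'[symmetric], rule integrable_real_indicator[OF C]) (simp add: P.emeasure_eq_measure)
  also have "\<dots> = (\<integral>a. indicator {s<..} a * measure ?G {b. sqrt (1 - r\<^sup>2) * b \<le> t - r * a} \<partial>?G)"
  proof (intro Bochner_Integration.integral_cong refl)
    fix a :: real
    have "(\<integral>b. indicat_real ?C (a, b) \<partial>?G) = (\<integral>b. indicator {s<..} a * indicator {b. sqrt (1 - r\<^sup>2) * b \<le> t - r * a} b \<partial>?G)"
      by (intro Bochner_Integration.integral_cong refl) (auto simp: correlated_pair_def indicator_def algebra_simps space_std_normal_pair)
    also have "\<dots> = indicator {s<..} a * measure ?G {b. sqrt (1 - r\<^sup>2) * b \<le> t - r * a}" by simp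
    finally show "(\<integral>b. indicat_real ?C (a, b) \<partial>?G) = \<dots>" .
  qed
  also have "\<dots> = (\<integral>a. std_normal_density a *\<^sub>R (indicator {s<..} a * measure ?G {b. sqrt (1 - r\<^sup>2) * b \<le> t - r * a}) \<partial>lborel)"
  proof (rule integral_density)
    have "(\<lambda>a. measure ?G {b \<in> space ?G. sqrt (1 - r\<^sup>2) * b \<le> t - r * a}) \<in> borel_measurable lborel"
      by measurable
    then show "(\<lambda>a. indicator {s<..} a * measure ?G {b. sqrt (1 - r\<^sup>2) * b \<le> t - r * a}) \<in> borel_measurable lborel"
      by simp
  qed auto
  finally show ?thesis by (simp add: mult.assoc)
qed

section \<open>Huesler--Reiss limits\<close>

text \<open>Minus the logarithm of the distribution function; it will appear as the limit of
  \<open>n\<close> times the probability that a single pair exceeds one of its levels.\<close>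

definition huesler_reiss_exponent :: "ereal \<Rightarrow> real \<Rightarrow> real \<Rightarrow> real" where
  "huesler_reiss_exponent L x y =
     (if L = 0 then max (exp (- x)) (exp (- y))
      else if L = \<infinity> then exp (- x) + exp (- y)
      else let l = real_of_ereal L in
        std_normal_cdf (l + (x - y) / (2 * l)) * exp (- y) + std_normal_cdf (l + (y - x) / (2 * l)) * exp (- x))"

lemma huesler_reiss_eq: "huesler_reiss L x y = exp (- huesler_reiss_exponent L x y)"
proof -
  have "min (exp (- exp (- x))) (exp (- exp (- y))) = exp (- max (exp (- x)) (exp (- y)))"
    by (auto simp: min_def max_def)
  then show ?thesis
    unfolding huesler_reiss_def huesler_reiss_exponent_def gumbel_cdf_def
    by (simp add: Let_def exp_add[symmetric])
qed

lemma std_normal_cdf_eq_measure: "measure std_normal_distribution {b. b \<le> t} = std_normal_cdf t"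
  unfolding std_normal_cdf_def cdf_def by (simp add: atMost_def)

section \<open>Exceedances at the normalising levels in the three dependence regimes\<close>

text \<open>The event keeps the form \<open>A n * b \<le> E n\<close> since \<open>A n\<close> may
  vanish. It suffices that \<open>E n\<close> eventually dominates \<open>A n * T\<close> for each
  \<open>T\<close>, which covers both a vanishing \<open>A\<close> and an \<open>E\<close> that
  outgrows \<open>A\<close>.\<close>

lemma measure_scaled_le_tendsto_1:
  assumes A: "\<And>n. 0 \<le> A n" and lim: "\<And>T. 0 < T \<Longrightarrow> \<forall>\<^sub>F n in sequentially. A n * T \<le> E n"
  shows "(\<lambda>n. measure std_normal_distribution {b. A n * b \<le> (E n :: real)}) \<longlonglongrightarrow> 1"
proof (rule tendstoI)
  fix e :: real assume e: "0 < e"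
  interpret G: prob_space std_normal_distribution by (rule prob_space_std_normal)
  from order_tendstoD(1)[OF std_normal_cdf_at_top, of "1 - e"] e
  have "\<forall>\<^sub>F T in at_top. 1 - e < std_normal_cdf T \<and> 0 < T"
    using eventually_gt_at_top[of 0] by (auto intro: eventually_conj)
  from eventually_happens'[OF _ this] obtain T where T: "1 - e < std_normal_cdf T" "0 < T" by auto
  from lim[OF T(2)] show "\<forall>\<^sub>F n in sequentially. dist (measure std_normal_distribution {b. A n * b \<le> E n}) 1 < e"
  proof eventually_elim
    case (elim n)
    have "std_normal_cdf T \<le> measure std_normal_distribution {b. A n * b \<le> E n}"
      unfolding std_normal_cdf_eq_measure[symmetric]
      using elim A[of n] by (intro G.finite_measure_mono) (auto intro: order_trans[OF mult_left_mono])
    then show ?case using T G.prob_le_1[of "{b. A n * b \<le> E n}"] by (auto simp: dist_real_def)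
  qed
qed

lemma measure_scaled_le_tendsto_0:
  assumes A: "\<And>n. 0 \<le> A n" and lim: "\<And>T. 0 < T \<Longrightarrow> \<forall>\<^sub>F n in sequentially. E n < - (A n * T)"
  shows "(\<lambda>n. measure std_normal_distribution {b. A n * b \<le> (E n :: real)}) \<longlonglongrightarrow> 0"
proof (rule tendstoI)
  fix e :: real assume e: "0 < e"
  interpret G: prob_space std_normal_distribution by (rule prob_space_std_normal)
  from order_tendstoD(2)[OF std_normal_cdf_at_bot, of e] e
  have "\<forall>\<^sub>F T in at_bot. std_normal_cdf T < e \<and> T < 0"
    using eventually_gt_at_bot[of 0] by (auto intro: eventually_conj)
  from eventually_happens'[OF _ this] obtain T where T: "std_normal_cdf T < e" "T < 0" by auto
  from T(2) have "0 < - T" by simp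
  from lim[OF this] show "\<forall>\<^sub>F n in sequentially. dist (measure std_normal_distribution {b. A n * b \<le> E n}) 0 < e"
  proof eventually_elim
    case (elim n)
    have "b \<le> T" if "A n * b \<le> E n" for b
    proof (rule ccontr)
      assume "\<not> b \<le> T"
      then have "A n * T \<le> A n * b" using A[of n] by (intro mult_left_mono) auto
      then show False using that elim by simp
    qed
    then have "measure std_normal_distribution {b. A n * b \<le> E n} \<le> std_normal_cdf T"
      unfolding std_normal_cdf_eq_measure[symmetric]
      by (intro G.finite_measure_mono) auto
    then show ?case using T by (auto simp: dist_real_def)
  qed
qed

lemma measure_scaled_le_tendsto_cdf:
  assumes A: "A \<longlonglongrightarrow> \<alpha>" "0 < \<alpha>" and E: "E \<longlonglongrightarrow> (\<beta> :: real)"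
  shows "(\<lambda>n. measure std_normal_distribution {b. A n * b \<le> E n}) \<longlonglongrightarrow> std_normal_cdf (\<beta> / \<alpha>)"
proof -
  have "(\<lambda>n. std_normal_cdf (E n / A n)) \<longlonglongrightarrow> std_normal_cdf (\<beta> / \<alpha>)"
    using A E by (intro tendsto_intros) auto
  moreover have "\<forall>\<^sub>F n in sequentially. std_normal_cdf (E n / A n) = measure std_normal_distribution {b. A n * b \<le> E n}"
    using order_tendstoD(1)[OF A]
  proof eventually_elim
    case (elim n)
    then have "{b. A n * b \<le> E n} = {b. b \<le> E n / A n}" by (auto simp: field_simps)
    then show ?case by (simp add: std_normal_cdf_eq_measure)
  qed
  ultimately show ?thesis by (rule Lim_transform_eventually)
qed

text \<open>The antiderivative \<open>F\<close> comes from integration by parts. Differentiating its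
  normal factors produces two density terms that cancel: expanding the squares shows that exp (- s)
  phi (l + (y - s) / (2 l)) equals exp (- y) phi (l + (s - y) / (2 l)).\<close>

lemma huesler_reiss_integral:
  assumes l: "0 < l"
  shows "(\<integral>s. exp (- s) * indicator {x<..} s * std_normal_cdf (l + (y - s) / (2 * l)) \<partial>lborel) =
    std_normal_cdf (l + (x - y) / (2 * l)) * exp (- y) + std_normal_cdf (l + (y - x) / (2 * l)) * exp (- x) - exp (- y)"
proof -
  define F where "F s = - exp (- s) * std_normal_cdf (l + (y - s) / (2 * l)) - exp (- y) * std_normal_cdf (l + (s - y) / (2 * l))" for s
  have cancel: "exp (- s) * std_normal_density (l + (y - s) / (2 * l)) = exp (- y) * std_normal_density (l + (s - y) / (2 * l))" for s
  proof -
    have "- s + - (l + (y - s) / (2 * l))\<^sup>2 / 2 = - y + - (l + (s - y) / (2 * l))\<^sup>2 / 2"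
      using l by (simp add: field_simps power2_eq_square)
    then show ?thesis unfolding std_normal_density_def by (simp add: exp_add[symmetric])
  qed
  have "(F has_real_derivative exp (- s) * std_normal_cdf (l + (y - s) / (2 * l)) +
      (exp (- s) * std_normal_density (l + (y - s) / (2 * l)) - exp (- y) * std_normal_density (l + (s - y) / (2 * l))) / (2 * l)) (at s)" for s
    unfolding F_def[abs_def] using l
    by (auto intro!: derivative_eq_intros DERIV_chain2[OF std_normal_cdf_deriv] simp: field_simps)
  then have dF: "(F has_real_derivative exp (- s) * std_normal_cdf (l + (y - s) / (2 * l))) (at s)" for s
    unfolding cancel by simp
  have lim: "(F \<longlongrightarrow> - exp (- y)) at_top"
  proof -
    have "filterlim (\<lambda>s. l + (s - y) / (2 * l)) at_top at_top" using l by real_asymp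
    from filterlim_compose[OF std_normal_cdf_at_top this]
    have a: "((\<lambda>s. std_normal_cdf (l + (s - y) / (2 * l))) \<longlongrightarrow> 1) at_top" .
    have b: "((\<lambda>s. exp (- s) * std_normal_cdf (l + (y - s) / (2 * l))) \<longlongrightarrow> 0) at_top"
    proof (rule Lim_null_comparison)
      show "\<forall>\<^sub>F s in at_top. norm (exp (- s) * std_normal_cdf (l + (y - s) / (2 * l))) \<le> exp (- s)"
        by (intro always_eventually allI) (simp add: std_normal_cdf_bounds abs_mult mult_left_le)
      show "((\<lambda>s::real. exp (- s)) \<longlongrightarrow> 0) at_top" by real_asymp
    qed
    have "((\<lambda>s. - (exp (- s) * std_normal_cdf (l + (y - s) / (2 * l))) - exp (- y) * std_normal_cdf (l + (s - y) / (2 * l))) \<longlongrightarrow> - 0 - exp (- y) * 1) at_top"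
      by (intro tendsto_intros a b)
    then show ?thesis unfolding F_def[abs_def] by simp
  qed
  have nn: "0 \<le> exp (- s) * std_normal_cdf (l + (y - s) / (2 * l))" for s
    by (simp add: std_normal_cdf_bounds)
  have "(\<integral>\<^sup>+s. ennreal (exp (- s) * std_normal_cdf (l + (y - s) / (2 * l))) * indicator {x ..} s \<partial>lborel) = ennreal (- exp (- y) - F x)"
    by (rule nn_integral_FTC_atLeast[OF _ dF nn lim]) measurable
  moreover have "(\<integral>\<^sup>+s. ennreal (exp (- s) * std_normal_cdf (l + (y - s) / (2 * l))) * indicator {x ..} s \<partial>lborel) =
      (\<integral>\<^sup>+s. ennreal (exp (- s) * indicator {x<..} s * std_normal_cdf (l + (y - s) / (2 * l))) \<partial>lborel)"
    by (rule nn_integral_cong_AE) (use AE_lborel_singleton[of x] in \<open>auto split: split_indicator\<close>)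
  moreover have "F x \<le> - exp (- y)"
  proof (rule tendsto_lowerbound[OF lim])
    show "\<forall>\<^sub>F s in at_top. F x \<le> F s"
      using eventually_ge_at_top[of x]
    proof eventually_elim
      case (elim s)
      show ?case using dF nn by (intro DERIV_nonneg_imp_nondecreasing[OF elim]) blast
    qed
  qed simp
  ultimately have "(\<integral>s. exp (- s) * indicator {x<..} s * std_normal_cdf (l + (y - s) / (2 * l)) \<partial>lborel) = - exp (- y) - F x"
    by (subst integral_eq_nn_integral) (auto simp: std_normal_cdf_bounds)
  then show ?thesis unfolding F_def by (simp add: mult_ac)
qed

lemma borel_measurable_measure_scaled_le:
  fixes f :: "real \<Rightarrow> real"
  assumes [measurable]: "f \<in> borel_measurable borel"
  shows "(\<lambda>s. measure std_normal_distribution {b. c * b \<le> f s}) \<in> borel_measurable borel"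
proof -
  interpret G: prob_space std_normal_distribution by (rule prob_space_std_normal)
  have "(\<lambda>s. measure std_normal_distribution {b \<in> space std_normal_distribution. c * b \<le> f s}) \<in> borel_measurable borel"
    by measurable
  then show ?thesis by simp
qed

text \<open>Given a first coordinate at level \<open>s\<close>, and after multiplication by
  \<open>sqrt (2 * ln n)\<close>, the second stays below its level when
  \<open>A n * b \<le> E n s\<close>. With \<open>\<kappa> n = (1 - r n) * ln n\<close>, the noise
  coefficient \<open>A n\<close> is at most 2 sqrt (\<kappa> n), while the drift in
  \<open>E n s\<close> is about 2 \<kappa> n. The three kinds of limit of \<kappa> produce the three
  branches of the exponent.\<close>

lemma binormal_tail_tendsto:
  assumes r: "\<And>n. \<bar>r n\<bar> \<le> 1" and L: "0 \<le> L"
    and lim: "(\<lambda>n. ereal ((1 - r n) * ln (real n))) \<longlonglongrightarrow> L\<^sup>2"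
    and xy: "L = 0 \<Longrightarrow> x \<noteq> y"
  shows "(\<lambda>n. n * (1 - binormal_cdf (r n) (norm_u n x) (norm_u n y))) \<longlonglongrightarrow> huesler_reiss_exponent L x y"
proof -
  define \<kappa> where "\<kappa> n = (1 - r n) * ln (real n)" for n
  define A where "A n = sqrt (2 * \<kappa> n * (1 + r n))" for n
  define B where "B n s = 2 + (s - ln (4 * pi * ln (real n)) / 2) / ln n" for n :: nat and s
  define E where "E n s = (y - s) + \<kappa> n * B n s" for n s
  define Q where "Q n s = measure std_normal_distribution {b. A n * b \<le> E n s}" for n s
  have lnpos: "0 \<le> ln (real n)" for n :: nat by (cases "n = 0") auto
  have \<kappa>0: "0 \<le> \<kappa> n" for n unfolding \<kappa>_def using r[of n] lnpos[of n] by (intro mult_nonneg_nonneg) auto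
  have A0: "0 \<le> A n" for n
    unfolding A_def using \<kappa>0[of n] r[of n] by (auto simp: abs_le_iff)
  have B: "(\<lambda>n. B n s) \<longlonglongrightarrow> 2" for s unfolding B_def by real_asymp
  have "E n \<in> borel_measurable borel" for n
    unfolding E_def[abs_def] B_def
    by (intro borel_measurable_add borel_measurable_diff borel_measurable_times borel_measurable_divide) simp_all
  then have meas: "Q n \<in> borel_measurable borel" for n
    unfolding Q_def[abs_def] by (rule borel_measurable_measure_scaled_le)
  have Q01: "0 \<le> Q n s" "Q n s \<le> 1" for n s
    unfolding Q_def using prob_space.prob_le_1[OF prob_space_std_normal] by auto
  have set: "{b. sqrt (1 - (r n)\<^sup>2) * b \<le> norm_u n y - r n * norm_u n s} = {b. A n * b \<le> E n s}" if n: "2 \<le> n" for n s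
  proof -
    define l where "l = sqrt (2 * ln n)"
    have ln: "0 < ln (real n)" using n by simp
    have l: "0 < l" "l * l = 2 * ln n" unfolding l_def using ln by auto
    have "A n = l * sqrt (1 - (r n)\<^sup>2)"
      unfolding A_def l_def real_sqrt_mult[symmetric] \<kappa>_def by (simp add: power2_eq_square algebra_simps)
    moreover have "E n s = l * (norm_u n y - r n * norm_u n s)"
    proof -
      define c where "c = ln (4 * pi * ln n) / 2"
      have u: "l * norm_u n t = 2 * ln n + (t - c)" for t
        unfolding norm_u_eq[OF n] l_def[symmetric] c_def[symmetric] using l by (simp add: distrib_left)
      have "l * (norm_u n y - r n * norm_u n s) = l * norm_u n y - r n * (l * norm_u n s)" by (simp add: algebra_simps)
      moreover have "ln n * B n s = 2 * ln n + (s - c)"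
        unfolding B_def c_def[symmetric] using ln by (simp add: distrib_left)
      then have "\<kappa> n * B n s = (1 - r n) * (2 * ln n + (s - c))"
        unfolding \<kappa>_def mult.assoc by simp
      ultimately show ?thesis unfolding E_def u by (simp add: algebra_simps)
    qed
    ultimately show ?thesis using l by (auto simp: mult.assoc)
  qed
  have eq: "\<forall>\<^sub>F n in sequentially. n * (1 - std_normal_cdf (norm_u n y)) + (\<integral>s. tail_density n s * indicator {x<..} s * Q n s \<partial>lborel) =
      n * (1 - binormal_cdf (r n) (norm_u n x) (norm_u n y))"
    using eventually_ge_at_top[of 2]
  proof eventually_elim
    case (elim n)
    show ?case
      unfolding binormal_cdf_complement[OF r] distrib_left scaled_std_normal_tail[OF elim] set[OF elim] Q_def ..
  qed
  have main: "(\<lambda>n. n * (1 - binormal_cdf (r n) (norm_u n x) (norm_u n y))) \<longlonglongrightarrow>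
      exp (- y) + (\<integral>s. exp (- s) * indicator {x<..} s * R s \<partial>lborel)"
    if "\<And>s. s \<noteq> y \<Longrightarrow> (\<lambda>n. Q n s) \<longlonglongrightarrow> R s" "R \<in> borel_measurable borel" for R
    by (rule Lim_transform_eventually[OF tendsto_add[OF std_normal_tail_tendsto tail_integral_tendsto[OF meas Q01 that]] eq])
  consider "L = 0" | "L = \<infinity>" | l where "L = ereal l" "0 < l"
    using L by (cases L) (auto simp: zero_ereal_def le_less)
  then show ?thesis
  proof cases
    \<comment> \<open>Noise and drift vanish: the conditional probability tends to the indicator of
      \<open>s < y\<close>, and the mass between \<open>x\<close> and \<open>y\<close> completes
      \<open>exp (- y)\<close> to the maximum.\<close>
    case 1
    then have k: "\<kappa> \<longlonglongrightarrow> 0" using lim unfolding \<kappa>_def by (simp add: zero_ereal_def)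
    have Alim: "A \<longlonglongrightarrow> 0"
    proof (rule tendsto_sandwich[OF _ _ tendsto_const])
      show "\<forall>\<^sub>F n in sequentially. 0 \<le> A n" using A0 by simp
      show "\<forall>\<^sub>F n in sequentially. A n \<le> sqrt (2 * \<kappa> n * 2)"
        unfolding A_def using \<kappa>0 r by (intro always_eventually allI real_sqrt_le_mono mult_left_mono) (auto simp: abs_le_iff)
      have "(\<lambda>n. sqrt (2 * \<kappa> n * 2)) \<longlonglongrightarrow> sqrt (2 * 0 * 2)" by (intro tendsto_intros k)
      then show "(\<lambda>n. sqrt (2 * \<kappa> n * 2)) \<longlonglongrightarrow> 0" by simp
    qed
    have Elim: "(\<lambda>n. E n s) \<longlonglongrightarrow> (y - s) + 0 * 2" for s
      unfolding E_def by (intro tendsto_intros k B)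
    have "(\<lambda>n. Q n s) \<longlonglongrightarrow> indicat_real {..<y} s" if "s \<noteq> y" for s
    proof (cases "s < y")
      case True
      have "(\<lambda>n. Q n s) \<longlonglongrightarrow> 1" unfolding Q_def
      proof (rule measure_scaled_le_tendsto_1[OF A0])
        fix T :: real
        have "(\<lambda>n. E n s - A n * T) \<longlonglongrightarrow> (y - s + 0 * 2) - 0 * T" by (intro tendsto_intros Elim Alim)
        then have "\<forall>\<^sub>F n in sequentially. 0 < E n s - A n * T" using True by (intro order_tendstoD(1)) auto
        then show "\<forall>\<^sub>F n in sequentially. A n * T \<le> E n s" by eventually_elim simp
      qed
      then show ?thesis using True by simp
    next
      case False
      have "(\<lambda>n. Q n s) \<longlonglongrightarrow> 0" unfolding Q_def
      proof (rule measure_scaled_le_tendsto_0[OF A0])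
        fix T :: real
        have "(\<lambda>n. E n s + A n * T) \<longlonglongrightarrow> (y - s + 0 * 2) + 0 * T" by (intro tendsto_intros Elim Alim)
        then have "\<forall>\<^sub>F n in sequentially. E n s + A n * T < 0" using False that by (intro order_tendstoD(2)) auto
        then show "\<forall>\<^sub>F n in sequentially. E n s < - (A n * T)" by eventually_elim simp
      qed
      then show ?thesis using False by simp
    qed
    from main[OF this] have "(\<lambda>n. n * (1 - binormal_cdf (r n) (norm_u n x) (norm_u n y))) \<longlonglongrightarrow>
      exp (- y) + (\<integral>s. exp (- s) * indicator {x<..} s * indicator {..<y} s \<partial>lborel)" by simp
    also have "exp (- y) + (\<integral>s. exp (- s) * indicator {x<..} s * indicator {..<y} s \<partial>lborel) = max (exp (- x)) (exp (- y))"
    proof (cases "x < y")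
      case True
      have "(\<integral>s. exp (- s) * indicator {x<..} s * indicator {..<y} s \<partial>lborel) =
          (\<integral>s. exp (- s) * indicator {x<..} s - exp (- s) * indicator {y<..} s \<partial>lborel)"
        by (rule integral_cong_AE) (use True AE_lborel_singleton[of y] in \<open>auto split: split_indicator\<close>)
      also have "\<dots> = exp (- x) - exp (- y)"
        by (simp add: integrable_exp_neg_Ioi)
      finally show ?thesis using True by simp
    next
      case False
      then have "exp (- s) * indicator {x<..} s * indicator {..<y} s = (0::real)" for s
        by (auto split: split_indicator)
      then have "(\<integral>s. exp (- s) * indicator {x<..} s * indicator {..<y} s \<partial>lborel) = 0"
        by (simp only: Bochner_Integration.integral_zero)
      then show ?thesis using False by simp
    qed
    finally show ?thesis using 1 by (simp add: huesler_reiss_exponent_def)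
  next
    \<comment> \<open>The drift is eventually at least \<open>\<kappa> n\<close> and the noise at
      most 2 q with q = sqrt (\<kappa> n). Once q exceeds
      \<open>2 * T + \<bar>y - s\<bar> + 1\<close>, its square outweighs both 2 q T and the fixed
      gap \<open>y - s\<close>.\<close>
    case 2
    then have k: "filterlim \<kappa> at_top sequentially"
      using lim unfolding \<kappa>_def by (simp add: tendsto_PInfty_eq_at_top power2_eq_square)
    have "(\<lambda>n. Q n s) \<longlonglongrightarrow> 1" for s unfolding Q_def
    proof (rule measure_scaled_le_tendsto_1[OF A0])
      fix T :: real assume T: "0 < T"
      have "\<forall>\<^sub>F n in sequentially. 1 < B n s" by (rule order_tendstoD(1)[OF B]) simp
      moreover have "\<forall>\<^sub>F n in sequentially. (2 * T + \<bar>y - s\<bar> + 1)\<^sup>2 \<le> \<kappa> n"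
        using k by (auto simp: filterlim_at_top)
      ultimately show "\<forall>\<^sub>F n in sequentially. A n * T \<le> E n s"
      proof eventually_elim
        case (elim n)
        define q where "q = sqrt (\<kappa> n)"
        have q: "q * q = \<kappa> n" "0 \<le> q" unfolding q_def using \<kappa>0[of n] by auto
        have Tq: "2 * T + \<bar>y - s\<bar> + 1 \<le> q" unfolding q_def using elim(2) by (intro real_le_rsqrt)
        have "A n \<le> sqrt (4 * \<kappa> n)"
          unfolding A_def using \<kappa>0[of n] r[of n] mult_left_mono[of "1 + r n" 2 "2 * \<kappa> n"] by (auto simp: abs_le_iff)
        also have "\<dots> = 2 * q" unfolding q_def by (simp add: real_sqrt_mult)
        finally have "A n * T \<le> 2 * q * T" using T by (intro mult_right_mono) auto
        also have "\<dots> = q * (2 * T)" by simp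
        also have "\<dots> \<le> q * (q - \<bar>y - s\<bar> - 1)" using q Tq by (intro mult_left_mono) auto
        also have "\<dots> = \<kappa> n - q * (\<bar>y - s\<bar> + 1)" using q by (simp add: algebra_simps)
        also have "\<dots> \<le> \<kappa> n - 1 * (\<bar>y - s\<bar> + 1)" using q T Tq by (intro diff_mono mult_right_mono) auto
        also have "\<dots> \<le> \<kappa> n * 1 + (y - s)" by auto
        also have "\<dots> \<le> \<kappa> n * B n s + (y - s)" using elim \<kappa>0[of n] by (intro add_right_mono mult_left_mono) auto
        finally show ?case unfolding E_def by simp
      qed
    qed
    from main[OF this] have "(\<lambda>n. n * (1 - binormal_cdf (r n) (norm_u n x) (norm_u n y))) \<longlonglongrightarrow> exp (- y) + exp (- x)"
      by (simp add: integrable_exp_neg_Ioi)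
    then show ?thesis using 2 by (simp add: huesler_reiss_exponent_def add.commute)
  next
    \<comment> \<open>A finite positive limit of \<kappa> forces \<open>r\<close> to 1, hence
      \<open>A\<close> to 2 l and the threshold to y - s + 2 l^2; their quotient is the argument of
      the normal distribution function.\<close>
    case (3 l)
    then have k: "\<kappa> \<longlonglongrightarrow> l\<^sup>2" using lim unfolding \<kappa>_def by simp
    have "(\<lambda>n. 1 - r n) \<longlonglongrightarrow> 0"
    proof -
      have "(\<lambda>n. \<kappa> n * (1 / ln n)) \<longlonglongrightarrow> l\<^sup>2 * 0"
        by (intro tendsto_mult k) real_asymp
      moreover have "\<forall>\<^sub>F n in sequentially. \<kappa> n * (1 / ln n) = 1 - r n"
        using eventually_ge_at_top[of 2] by eventually_elim (simp add: \<kappa>_def)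
      ultimately have "(\<lambda>n. 1 - r n) \<longlonglongrightarrow> l\<^sup>2 * 0" by (rule Lim_transform_eventually)
      then show ?thesis by simp
    qed
    from tendsto_diff[OF tendsto_const this, of 1] have r1: "r \<longlonglongrightarrow> 1" by simp
    have "A \<longlonglongrightarrow> sqrt (2 * l\<^sup>2 * (1 + 1))" unfolding A_def by (intro tendsto_intros k r1)
    also have "sqrt (2 * l\<^sup>2 * (1 + 1)) = 2 * l" using 3 by (simp add: real_sqrt_mult)
    finally have A: "A \<longlonglongrightarrow> 2 * l" .
    have "(\<lambda>n. Q n s) \<longlonglongrightarrow> std_normal_cdf (l + (y - s) / (2 * l))" for s
    proof -
      have "(\<lambda>n. E n s) \<longlonglongrightarrow> (y - s) + l\<^sup>2 * 2" unfolding E_def by (intro tendsto_intros k B)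
      from measure_scaled_le_tendsto_cdf[OF A _ this]
      have "(\<lambda>n. Q n s) \<longlonglongrightarrow> std_normal_cdf (((y - s) + l\<^sup>2 * 2) / (2 * l))" unfolding Q_def using 3 by simp
      also have "((y - s) + l\<^sup>2 * 2) / (2 * l) = l + (y - s) / (2 * l)" using 3 by (simp add: field_simps power2_eq_square)
      finally show ?thesis .
    qed
    from main[OF this] have "(\<lambda>n. n * (1 - binormal_cdf (r n) (norm_u n x) (norm_u n y))) \<longlonglongrightarrow>
        exp (- y) + (\<integral>s. exp (- s) * indicator {x<..} s * std_normal_cdf (l + (y - s) / (2 * l)) \<partial>lborel)" by simp
    then show ?thesis using 3
      by (simp add: huesler_reiss_integral huesler_reiss_exponent_def Let_def zero_ereal_def)
  qed
qed

section \<open>Maxima of n independent pairs\<close>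

text \<open>Compare with (1 - \<psi> / n)^n: for bases of modulus at most one the n-th powers differ
  by at most n times the difference of the bases, which here is the deviation of
  \<open>n * (1 - p n)\<close> from \<psi>.\<close>

lemma power_tendsto_exp:
  fixes p :: "nat \<Rightarrow> real"
  assumes p: "\<And>n. 0 \<le> p n" "\<And>n. p n \<le> 1" and lim: "(\<lambda>n. n * (1 - p n)) \<longlonglongrightarrow> \<psi>"
  shows "(\<lambda>n. p n ^ n) \<longlonglongrightarrow> exp (- \<psi>)"
proof -
  have \<psi>: "0 \<le> \<psi>" using p by (intro LIMSEQ_le_const[OF lim]) auto
  have "(\<lambda>n. p n ^ n - (1 + (- \<psi>) / n) ^ n) \<longlonglongrightarrow> 0"
  proof (rule Lim_null_comparison)
    obtain N :: nat where N: "\<psi> < real N" using reals_Archimedean2 by blast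
    show "\<forall>\<^sub>F n in sequentially. norm (p n ^ n - (1 + (- \<psi>) / n) ^ n) \<le> \<bar>\<psi> - n * (1 - p n)\<bar>"
      using eventually_gt_at_top[of N]
    proof eventually_elim
      case (elim n)
      then have n: "0 < n" "\<psi> \<le> real n" using N by auto
      have "norm (p n ^ n - (1 + (- \<psi>) / n) ^ n) \<le> n * norm (p n - (1 + (- \<psi>) / n))"
        using p[of n] n \<psi> by (intro norm_power_diff) (auto simp: abs_le_iff field_simps)
      also have "\<dots> = \<bar>n * (p n - (1 + (- \<psi>) / n))\<bar>" by (simp add: abs_mult)
      also have "n * (p n - (1 + (- \<psi>) / n)) = \<psi> - n * (1 - p n)" using n by (simp add: field_simps)
      finally show ?case .
    qed
    have "(\<lambda>n. \<bar>\<psi> - n * (1 - p n)\<bar>) \<longlonglongrightarrow> \<bar>\<psi> - \<psi>\<bar>" by (intro tendsto_intros lim)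
    then show "(\<lambda>n. \<bar>\<psi> - n * (1 - p n)\<bar>) \<longlonglongrightarrow> 0" by simp
  qed
  from tendsto_add[OF this tendsto_exp_limit_sequentially[of "- \<psi>"]] show ?thesis by simp
qed

lemma tendsto_huesler_reiss:
  assumes L: "0 \<le> L" and f: "(f \<longlongrightarrow> x) F" and g: "(g \<longlongrightarrow> y) F"
  shows "((\<lambda>z. huesler_reiss L (f z) (g z)) \<longlongrightarrow> huesler_reiss L x y) F"
proof -
  have "((\<lambda>z. huesler_reiss_exponent L (f z) (g z)) \<longlongrightarrow> huesler_reiss_exponent L x y) F"
  proof (cases "L = 0 \<or> L = \<infinity>")
    case True
    then show ?thesis unfolding huesler_reiss_exponent_def by (auto intro!: tendsto_intros f g)
  next
    case False
    then have "real_of_ereal L \<noteq> 0" using L by (cases L) (auto simp: zero_ereal_def)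
    then show ?thesis using False unfolding huesler_reiss_exponent_def Let_def
      by (auto intro!: tendsto_intros f g)
  qed
  then show ?thesis unfolding huesler_reiss_eq by (intro tendsto_intros)
qed

lemma huesler_reiss_bounds:
  assumes "0 \<le> L"
  shows "0 \<le> huesler_reiss L x y" "huesler_reiss L x y \<le> 1"
proof -
  have "0 \<le> huesler_reiss_exponent L x y"
    unfolding huesler_reiss_exponent_def Let_def
    by (auto intro!: add_nonneg_nonneg mult_nonneg_nonneg std_normal_cdf_bounds simp: le_max_iff_disj)
  then show "0 \<le> huesler_reiss L x y" "huesler_reiss L x y \<le> 1" unfolding huesler_reiss_eq by auto
qed

lemma borel_measurable_huesler_reiss:
  "(\<lambda>(x, y). huesler_reiss L x y) \<in> borel_measurable (borel \<Otimes>\<^sub>M borel)"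
proof (cases "L = 0 \<or> L = \<infinity>")
  case True
  then show ?thesis unfolding huesler_reiss_eq huesler_reiss_exponent_def case_prod_unfold by auto
next
  case False
  then have "huesler_reiss_exponent L = (\<lambda>x y. let l = real_of_ereal L in
        std_normal_cdf (l + (x - y) / (2 * l)) * exp (- y) + std_normal_cdf (l + (y - x) / (2 * l)) * exp (- x))"
    by (intro ext) (simp add: huesler_reiss_exponent_def)
  then show ?thesis unfolding huesler_reiss_eq Let_def case_prod_unfold by simp
qed

lemma norm_u_mono: "2 \<le> n \<Longrightarrow> s \<le> t \<Longrightarrow> norm_u n s \<le> norm_u n t"
  unfolding norm_u_def norm_a_def by (intro add_right_mono mult_left_mono) auto

lemma binormal_cdf_mono: "s \<le> s' \<Longrightarrow> t \<le> t' \<Longrightarrow> binormal_cdf r s t \<le> binormal_cdf r s' t'"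
proof -
  assume le: "s \<le> s'" "t \<le> t'"
  interpret G: prob_space std_normal_distribution by (rule prob_space_std_normal)
  interpret P: pair_prob_space std_normal_distribution std_normal_distribution ..
  show ?thesis unfolding binormal_cdf_def using le
    by (intro P.finite_measure_mono sets_correlated_pair_box) auto
qed

lemma binormal_cdf_bounds: "0 \<le> binormal_cdf r s t" "binormal_cdf r s t \<le> 1"
proof -
  interpret G: prob_space std_normal_distribution by (rule prob_space_std_normal)
  interpret P: pair_prob_space std_normal_distribution std_normal_distribution ..
  show "0 \<le> binormal_cdf r s t" "binormal_cdf r s t \<le> 1" unfolding binormal_cdf_def by auto
qed

text \<open>Levels moving with \<open>n\<close> arise because the common part will be subtracted
  from them. Monotonicity squeezes them between fixed levels slightly to either side, and continuity
  of the limit closes the gap.\<close>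

lemma binormal_power_tendsto:
  assumes r: "\<And>n. \<bar>r n\<bar> \<le> 1" and L: "0 \<le> L"
    and lim: "(\<lambda>n. ereal ((1 - r n) * ln (real n))) \<longlonglongrightarrow> L\<^sup>2"
    and xs: "xs \<longlonglongrightarrow> x" and ys: "ys \<longlonglongrightarrow> y"
  shows "(\<lambda>n. binormal_cdf (r n) (norm_u n (xs n)) (norm_u n (ys n)) ^ n) \<longlonglongrightarrow> huesler_reiss L x y"
proof -
  define P where "P n s t = binormal_cdf (r n) (norm_u n s) (norm_u n t) ^ n" for n s t
  have lim_ne: "(\<lambda>n. P n s t) \<longlonglongrightarrow> huesler_reiss L s t" if "s \<noteq> t" for s t
    unfolding P_def huesler_reiss_eq
    by (intro power_tendsto_exp binormal_cdf_bounds binormal_tail_tendsto r L lim that)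
  have mono: "P n s t \<le> P n s' t'" if "2 \<le> n" "s \<le> s'" "t \<le> t'" for n s t s' t'
    unfolding P_def using that by (intro power_mono binormal_cdf_mono norm_u_mono binormal_cdf_bounds)
  have ne: "\<forall>\<^sub>F \<eta> in at_right (0::real). \<eta> \<noteq> c" for c
  proof (cases "0 < c")
    case True
    then have "\<forall>\<^sub>F \<eta> in at_right (0::real). \<eta> < c"
      using order_tendstoD(2)[OF tendsto_ident_at, of 0 c] by simp
    then show ?thesis by eventually_elim auto
  next
    case False
    have "\<forall>\<^sub>F \<eta> in at_right (0::real). 0 < \<eta>" by (rule eventually_at_right_less)
    then show ?thesis by eventually_elim (use False in auto)
  qed
  have id: "((\<lambda>\<eta>. \<eta>) \<longlongrightarrow> 0) (at_right (0::real))" by (rule tendsto_ident_at)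
  have "(\<lambda>n. P n (xs n) (ys n)) \<longlonglongrightarrow> huesler_reiss L x y"
  proof (rule order_tendstoI)
    fix a assume a: "a < huesler_reiss L x y"
    \<comment> \<open>The unequal shifts \<open>\<eta>\<close> and \<open>2 * \<eta>\<close> let the
      perturbed levels coincide for at most one \<open>\<eta>\<close>, so they can be chosen
      distinct as \<open>lim_ne\<close> demands.\<close>
    have "((\<lambda>\<eta>. huesler_reiss L (x - \<eta>) (y - 2 * \<eta>)) \<longlongrightarrow> huesler_reiss L (x - 0) (y - 2 * 0)) (at_right 0)"
      by (intro tendsto_huesler_reiss L tendsto_intros)
    then have "\<forall>\<^sub>F \<eta> in at_right 0. a < huesler_reiss L (x - \<eta>) (y - 2 * \<eta>)"
      using a by (intro order_tendstoD(1)) auto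
    then have "\<forall>\<^sub>F \<eta> in at_right 0. a < huesler_reiss L (x - \<eta>) (y - 2 * \<eta>) \<and> x - \<eta> \<noteq> y - 2 * \<eta> \<and> 0 < \<eta>"
      using ne[of "y - x"] eventually_at_right_less[of "0::real"] by eventually_elim auto
    from eventually_happens'[OF _ this] obtain \<eta> where
      \<eta>: "a < huesler_reiss L (x - \<eta>) (y - 2 * \<eta>)" "x - \<eta> \<noteq> y - 2 * \<eta>" "0 < \<eta>" by (auto simp: trivial_limit_at_right_real)
    have "\<forall>\<^sub>F n in sequentially. a < P n (x - \<eta>) (y - 2 * \<eta>)"
      by (rule order_tendstoD(1)[OF lim_ne[OF \<eta>(2)] \<eta>(1)])
    moreover have "\<forall>\<^sub>F n in sequentially. x - \<eta> < xs n" "\<forall>\<^sub>F n in sequentially. y - 2 * \<eta> < ys n"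
      using \<eta>(3) by (auto intro: order_tendstoD(1)[OF xs] order_tendstoD(1)[OF ys])
    ultimately show "\<forall>\<^sub>F n in sequentially. a < P n (xs n) (ys n)"
      using eventually_ge_at_top[of 2]
    proof eventually_elim
      case (elim n)
      then show ?case using mono[of n "x - \<eta>" "xs n" "y - 2 * \<eta>" "ys n"] by auto
    qed
  next
    fix a assume a: "huesler_reiss L x y < a"
    have "((\<lambda>\<eta>. huesler_reiss L (x + \<eta>) (y + 2 * \<eta>)) \<longlongrightarrow> huesler_reiss L (x + 0) (y + 2 * 0)) (at_right 0)"
      by (intro tendsto_huesler_reiss L tendsto_intros)
    then have "\<forall>\<^sub>F \<eta> in at_right 0. huesler_reiss L (x + \<eta>) (y + 2 * \<eta>) < a"
      using a by (intro order_tendstoD(2)) auto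
    then have "\<forall>\<^sub>F \<eta> in at_right 0. huesler_reiss L (x + \<eta>) (y + 2 * \<eta>) < a \<and> x + \<eta> \<noteq> y + 2 * \<eta> \<and> 0 < \<eta>"
      using ne[of "x - y"] eventually_at_right_less[of "0::real"] by eventually_elim auto
    from eventually_happens'[OF _ this] obtain \<eta> where
      \<eta>: "huesler_reiss L (x + \<eta>) (y + 2 * \<eta>) < a" "x + \<eta> \<noteq> y + 2 * \<eta>" "0 < \<eta>" by (auto simp: trivial_limit_at_right_real)
    have "\<forall>\<^sub>F n in sequentially. P n (x + \<eta>) (y + 2 * \<eta>) < a"
      by (rule order_tendstoD(2)[OF lim_ne[OF \<eta>(2)] \<eta>(1)])
    moreover have "\<forall>\<^sub>F n in sequentially. xs n < x + \<eta>" "\<forall>\<^sub>F n in sequentially. ys n < y + 2 * \<eta>"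
      using \<eta>(3) by (auto intro: order_tendstoD(2)[OF xs] order_tendstoD(2)[OF ys])
    ultimately show "\<forall>\<^sub>F n in sequentially. P n (xs n) (ys n) < a"
      using eventually_ge_at_top[of 2]
    proof eventually_elim
      case (elim n)
      then show ?case using mono[of n "xs n" "x + \<eta>" "ys n" "y + 2 * \<eta>"] by auto
    qed
  qed
  then show ?thesis unfolding P_def .
qed

section \<open>From pointwise to uniform convergence\<close>

text \<open>A Polya argument. A compact square is covered by finitely many boxes on which the limit
  is nearly constant and monotone functions lie between their values at two corners. Outside the
  square, \<open>upper\<close> caps large coordinates at \<open>B\<close> uniformly in
  \<open>n\<close>, and \<open>lower\<close> makes the functions small once a coordinate is very
  negative.\<close>

lemma bivariate_cdf_uniform_convergence:
  fixes F :: "nat \<Rightarrow> real \<Rightarrow> real \<Rightarrow> real" and G :: "real \<Rightarrow> real \<Rightarrow> real"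
  assumes mono: "\<And>n x x' y y'. 2 \<le> n \<Longrightarrow> x \<le> x' \<Longrightarrow> y \<le> y' \<Longrightarrow> F n x y \<le> F n x' y'"
    and nonneg: "\<And>n x y. 0 \<le> F n x y"
    and conv: "\<And>x y. (\<lambda>n. F n x y) \<longlonglongrightarrow> G x y"
    and cont: "continuous_on UNIV (\<lambda>z. G (fst z) (snd z))"
    and upper: "\<And>e. 0 < e \<Longrightarrow> \<exists>B. \<forall>\<^sub>F n in sequentially. \<forall>x y. F n x y \<le> F n (min x B) (min y B) + e"
    and lower: "\<And>e B. 0 < e \<Longrightarrow> \<exists>a. G a B \<le> e \<and> G B a \<le> e"
  shows "(\<lambda>n. SUP (x, y)\<in>UNIV. \<bar>F n x y - G x y\<bar>) \<longlonglongrightarrow> 0"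
proof -
  have Gmono: "G x y \<le> G x' y'" if "x \<le> x'" "y \<le> y'" for x y x' y'
    by (rule LIMSEQ_le[OF conv conv]) (use that mono in \<open>auto intro!: exI[of _ 2]\<close>)
  have Gnonneg: "0 \<le> G x y" for x y
    using nonneg by (intro LIMSEQ_le_const[OF conv]) auto
  have unif: "\<forall>\<^sub>F n in sequentially. \<forall>z\<in>K. \<bar>F n (fst z) (snd z) - G (fst z) (snd z)\<bar> \<le> e"
    if K: "compact K" and e: "0 < e" for K e
  proof -
    have "\<exists>d>0. \<forall>z'. dist z' z < d \<longrightarrow> dist (G (fst z') (snd z')) (G (fst z) (snd z)) < e / 4" for z
      using cont e unfolding continuous_on_iff by (metis UNIV_I divide_pos_pos zero_less_numeral)
    then obtain d where d: "\<And>z. 0 < d z"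
      "\<And>z z'. dist z' z < d z \<Longrightarrow> dist (G (fst z') (snd z')) (G (fst z) (snd z)) < e / 4" by metis
    \<comment> \<open>A quarter of the radius: the points of the box and its corners differ from the
      centre by at most \<open>h z\<close> in each coordinate, hence by at most half of
      \<open>d z\<close> in distance.\<close>
    define h where "h z = d z / 4" for z
    define U where "U z = {fst z - h z<..<fst z + h z} \<times> {snd z - h z<..<snd z + h z}" for z
    have h: "0 < h z" for z unfolding h_def using d(1)[of z] by simp
    have close: "\<bar>G x y - G (fst z) (snd z)\<bar> < e / 4" if "\<bar>x - fst z\<bar> \<le> h z" "\<bar>y - snd z\<bar> \<le> h z" for x y z
    proof -
      have "dist (x, y) z \<le> \<bar>x - fst z\<bar> + \<bar>y - snd z\<bar>"
        using sqrt_sum_squares_le_sum_abs[of "x - fst z" "y - snd z"]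
        by (cases z) (simp add: dist_Pair_Pair dist_real_def)
      also have "\<dots> < d z" using that d(1)[of z] unfolding h_def by simp
      finally show ?thesis using d(2)[of "(x, y)" z] by (simp add: dist_real_def)
    qed
    have "open (U z)" for z unfolding U_def by (intro open_Times open_greaterThanLessThan)
    moreover have "K \<subseteq> (\<Union>z\<in>K. U z)" using h unfolding U_def by (force simp: mem_Times_iff)
    ultimately obtain C where C: "C \<subseteq> K" "finite C" "K \<subseteq> (\<Union>z\<in>C. U z)"
      using compactE_image[OF K, of K U] by metis
    have "\<forall>\<^sub>F n in sequentially. \<forall>z'\<in>U z. \<bar>F n (fst z') (snd z') - G (fst z') (snd z')\<bar> \<le> e" for z
    proof -
      have "\<forall>\<^sub>F n in sequentially. dist (F n (fst z - h z) (snd z - h z)) (G (fst z - h z) (snd z - h z)) < e / 4"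
        "\<forall>\<^sub>F n in sequentially. dist (F n (fst z + h z) (snd z + h z)) (G (fst z + h z) (snd z + h z)) < e / 4"
        using e by (intro tendstoD conv, simp)+
      then show ?thesis using eventually_ge_at_top[of 2]
      proof eventually_elim
        case (elim n)
        show ?case
        proof
          fix z' assume z': "z' \<in> U z"
          have "F n (fst z - h z) (snd z - h z) \<le> F n (fst z') (snd z')"
            "F n (fst z') (snd z') \<le> F n (fst z + h z) (snd z + h z)"
            using z' elim unfolding U_def by (auto intro!: mono)
          moreover have "\<bar>G (fst z - h z) (snd z - h z) - G (fst z) (snd z)\<bar> < e / 4"
            "\<bar>G (fst z + h z) (snd z + h z) - G (fst z) (snd z)\<bar> < e / 4"
            using h[of z] by (intro close; simp)+
          moreover have "\<bar>G (fst z') (snd z') - G (fst z) (snd z)\<bar> < e / 4"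
            using z' unfolding U_def by (intro close) auto
          ultimately show "\<bar>F n (fst z') (snd z') - G (fst z') (snd z')\<bar> \<le> e"
            using elim e unfolding dist_real_def by linarith
        qed
      qed
    qed
    then have "\<forall>\<^sub>F n in sequentially. \<forall>z\<in>C. \<forall>z'\<in>U z. \<bar>F n (fst z') (snd z') - G (fst z') (snd z')\<bar> \<le> e"
      using C(2) by (intro eventually_ball_finite) auto
    then show ?thesis by eventually_elim (use C in blast)
  qed
  show ?thesis
  proof (rule tendstoI)
    fix e' :: real assume e': "0 < e'"
    \<comment> \<open>One \<open>e\<close> each for capping \<open>F\<close> and \<open>G\<close>
      and two for comparing the capped values make \<open>4 * e\<close>, strictly below
      \<open>e'\<close>.\<close>
    define e where "e = e' / 5"
    have e: "0 < e" using e' by (simp add: e_def)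
    from upper[OF e] obtain B where B: "\<forall>\<^sub>F n in sequentially. \<forall>x y. F n x y \<le> F n (min x B) (min y B) + e" by blast
    from lower[OF e, of B] obtain a0 where a0: "G a0 B \<le> e" "G B a0 \<le> e" by blast
    define a where "a = min a0 B"
    have a: "a \<le> B" "G a B \<le> e" "G B a \<le> e"
      using a0 Gmono[of a a0 B B] Gmono[of B B a a0] by (auto simp: a_def)
    have GB: "G x y \<le> G (min x B) (min y B) + e" for x y
    proof (rule LIMSEQ_le[OF conv tendsto_add[OF conv tendsto_const]])
      show "\<exists>N. \<forall>n\<ge>N. F n x y \<le> F n (min x B) (min y B) + e"
        using B unfolding eventually_sequentially by blast
    qed
    have "compact ({a..B} \<times> {a..B})" by (intro compact_Times) auto
    from unif[OF this e] B show "\<forall>\<^sub>F n in sequentially. dist (SUP (x, y)\<in>UNIV. \<bar>F n x y - G x y\<bar>) 0 < e'"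
      using eventually_ge_at_top[of 2]
    proof eventually_elim
      case (elim n)
      have bound: "\<bar>F n x y - G x y\<bar> \<le> 4 * e" for x y
      proof -
        define x' where "x' = min x B"
        define y' where "y' = min y B"
        have le: "x' \<le> x" "y' \<le> y" "x' \<le> B" "y' \<le> B" unfolding x'_def y'_def by auto
        have 1: "F n x y \<le> F n x' y' + e" "F n x' y' \<le> F n x y" "G x y \<le> G x' y' + e" "G x' y' \<le> G x y"
          using elim GB[of x y] Gmono[OF le(1,2)] mono[OF elim(3) le(1,2)] unfolding x'_def y'_def by auto
        have K: "\<bar>F n s t - G s t\<bar> \<le> e" if "s \<in> {a..B}" "t \<in> {a..B}" for s t
          using elim(1) that by (auto dest!: bspec[of _ _ "(s, t)"])
        have "\<bar>F n x' y' - G x' y'\<bar> \<le> 2 * e"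
        proof -
          consider "x' \<in> {a..B}" "y' \<in> {a..B}" | "x' < a" | "y' < a" using le by force
          then show ?thesis
          proof cases
            case 1
            from K[OF this] show ?thesis using e by simp
          next
            case 2
            have "F n x' y' \<le> F n a B" using 2 le elim(3) by (intro mono) auto
            moreover have "G x' y' \<le> G a B" using 2 le by (intro Gmono) auto
            moreover have "\<bar>F n a B - G a B\<bar> \<le> e" using a by (intro K) auto
            ultimately show ?thesis using a(2) nonneg[of n x' y'] Gnonneg[of x' y'] by linarith
          next
            case 3
            have "F n x' y' \<le> F n B a" using 3 le elim(3) by (intro mono) auto
            moreover have "G x' y' \<le> G B a" using 3 le by (intro Gmono) auto
            moreover have "\<bar>F n B a - G B a\<bar> \<le> e" using a by (intro K) auto
            ultimately show ?thesis using a(3) nonneg[of n x' y'] Gnonneg[of x' y'] by linarith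
          qed
        qed
        then show ?thesis using 1 e by linarith
      qed
      have "(SUP (x, y)\<in>UNIV. \<bar>F n x y - G x y\<bar>) \<le> 4 * e"
        using bound by (intro cSUP_least) auto
      moreover have "0 \<le> (SUP (x, y)\<in>UNIV. \<bar>F n x y - G x y\<bar>)"
      proof (rule cSUP_upper2)
        show "bdd_above (range (\<lambda>(x, y). \<bar>F n x y - G x y\<bar>))"
          using bound by (intro bdd_aboveI2[of _ _ "4 * e"]) auto
        show "0 \<le> (case (0, 0) of (x, y) \<Rightarrow> \<bar>F n x y - G x y\<bar>)" by simp
      qed simp
      ultimately show ?case using e unfolding e_def by (simp add: dist_real_def)
    qed
  qed
qed

section \<open>Slowly decaying correlations\<close>

text \<open>The sum is ln (n^n / n!). Passing from n to n + 1 adds n ln (1 + 1 / n), which is at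
  most 1.\<close>

lemma sum_ln_ratio_le: "(\<Sum>k=1..n. ln (real n) - ln (real k)) \<le> real n"
proof (induction n)
  case (Suc n)
  show ?case
  proof (cases "n = 0")
    case False
    have "(\<Sum>k=1..Suc n. ln (real (Suc n)) - ln (real k)) = (\<Sum>k=1..n. ln (real (Suc n)) - ln (real k))"
      by simp
    also have "\<dots> = (\<Sum>k=1..n. (ln (real n) - ln (real k)) + (ln (real (Suc n)) - ln (real n)))"
      by (intro sum.cong) auto
    also have "\<dots> = (\<Sum>k=1..n. ln (real n) - ln (real k)) + n * (ln (real (Suc n)) - ln (real n))"
      unfolding sum.distrib by simp
    also have "ln (real (Suc n)) - ln (real n) \<le> 1 / n"
    proof -
      have "ln (real (Suc n)) - ln (real n) = ln (real (Suc n) / real n)"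
        using False by (subst ln_div) auto
      also have "real (Suc n) / real n = 1 + 1 / n" using False by (simp add: field_simps)
      also have "ln (1 + 1 / real n) \<le> 1 / n" by (rule ln_add_one_self_le_self) simp
      finally show ?thesis .
    qed
    then have "(\<Sum>k=1..n. ln (real n) - ln (real k)) + n * (ln (real (Suc n)) - ln (real n)) \<le> real n + n * (1 / n)"
      using Suc by (intro add_mono mult_left_mono) auto
    finally show ?thesis using False by simp
  qed simp
qed simp

lemma tendsto_0_if_mult_ln:
  assumes "(\<lambda>n. v n * ln (real n)) \<longlonglongrightarrow> t"
  shows "v \<longlonglongrightarrow> (0::real)"
proof -
  have "(\<lambda>n. (v n * ln (real n)) * (1 / ln n)) \<longlonglongrightarrow> t * 0"
    by (intro tendsto_mult assms) real_asymp
  moreover have "\<forall>\<^sub>F n in sequentially. (v n * ln (real n)) * (1 / ln n) = v n"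
    using eventually_ge_at_top[of 2] by eventually_elim simp
  ultimately have "v \<longlonglongrightarrow> t * 0" by (rule Lim_transform_eventually)
  then show ?thesis by simp
qed

section \<open>A single correlation function with logarithmic decay\<close>

text \<open>One pair of components in isolation, so that the four correlation functions are treated
  alike. \<open>\<delta>\<close> enters as a bound instead of a supremum, and
  \<open>\<theta>\<close> is the exponent that separates short from long lags.\<close>

locale slowly_decaying_correlation =
  fixes \<rho> :: "nat \<Rightarrow> nat \<Rightarrow> real" and \<tau> \<delta> \<theta> :: real and K :: "nat \<Rightarrow> nat"
  assumes tau: "0 < \<tau>"
    and rho_le: "\<And>n k. 2 \<le> n \<Longrightarrow> 1 \<le> k \<Longrightarrow> k < n \<Longrightarrow> \<bar>\<rho> k n\<bar> \<le> \<delta>"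
    and delta: "\<delta> < 1"
    and theta: "\<theta> \<in> {0 <..< (1 - \<delta>) / (1 + \<delta>)}"
    and K: "\<And>n. K n = nat \<lfloor>real n powr \<theta>\<rfloor>"
    and lim: "(\<lambda>n. Max ((\<lambda>k. \<bar>\<rho> k n * ln (real k) - \<tau>\<bar>) ` {K n ..< n})) \<longlonglongrightarrow> 0"
begin

lemma delta_nonneg: "0 \<le> \<delta>"
  using rho_le[of 2 1] abs_ge_zero[of "\<rho> 1 2"] by linarith

text \<open>The last inequality is the purpose of the upper limit on \<open>\<theta>\<close>: about
  n^(1 + \<theta>) pairs at short lags contribute at most about n^(- 2 / (1 + \<delta>)) each, up to
  powers of ln n.\<close>

lemma theta_less: "0 < \<theta>" "\<theta> < 1" "1 + \<theta> < 2 / (1 + \<delta>)"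
proof -
  show "0 < \<theta>" using theta by simp
  have "\<theta> * (1 + \<delta>) < 1 - \<delta>" using theta delta_nonneg by (simp add: field_simps)
  then show "1 + \<theta> < 2 / (1 + \<delta>)" using delta_nonneg by (simp add: field_simps)
  also have "2 / (1 + \<delta>) \<le> 2" using delta_nonneg by (simp add: field_simps)
  finally show "\<theta> < 1" by simp
qed

lemma K_le: "real (K n) \<le> real n powr \<theta>"
  unfolding K by simp

text \<open>Beyond \<open>K n\<close> the logarithm of the lag is comparable with
  \<open>ln n\<close>, so correlations there are of order 1 / ln n. Halving the exponent absorbs the
  integer part.\<close>

lemma ln_K_ge: "\<forall>\<^sub>F n in sequentially. \<theta> / 2 * ln n \<le> ln (K n) \<and> 2 \<le> K n \<and> K n < n"
proof -
  have "\<forall>\<^sub>F n in sequentially. real n powr (\<theta> / 2) \<le> real n powr \<theta> - 1"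
    using theta_less by real_asymp
  moreover have "\<forall>\<^sub>F n in sequentially. 3 \<le> real n powr \<theta>" using theta_less by real_asymp
  moreover have "\<forall>\<^sub>F n in sequentially. real n powr \<theta> < real n" using theta_less by real_asymp
  ultimately show ?thesis using eventually_gt_at_top[of 0]
  proof eventually_elim
    case (elim n)
    have "real n powr \<theta> - 1 \<le> real (K n)" unfolding K by linarith
    then have "real n powr (\<theta> / 2) \<le> real (K n)" "2 \<le> K n" using elim by auto
    moreover have "\<theta> / 2 * ln n = ln (real n powr (\<theta> / 2))" using elim by (simp add: ln_powr)
    moreover have "ln (real n powr (\<theta> / 2)) \<le> ln (real (K n))"
      using calculation elim by (subst ln_le_cancel_iff) auto
    ultimately show ?case using elim K_le[of n] by auto
  qed
qed

definition dev :: "nat \<Rightarrow> real" where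
  "dev n = Max ((\<lambda>k. \<bar>\<rho> k n * ln (real k) - \<tau>\<bar>) ` {K n ..< n})"

lemma dev_lim: "dev \<longlonglongrightarrow> 0"
  using lim unfolding dev_def[abs_def] .

lemma dev_bound: "k \<in> {K n..<n} \<Longrightarrow> \<bar>\<rho> k n * ln (real k) - \<tau>\<bar> \<le> dev n"
  unfolding dev_def by (intro Max_ge) auto

text \<open>The first \<open>n powr \<theta>\<close> lags are negligible; for the others \<open>\<tau> / ln k\<close> may be replaced by
  \<open>\<tau> / ln n\<close> because \<open>ln (n / k)\<close> is bounded on average.\<close>

lemma mean_deviation_tendsto:
  "(\<lambda>n. ln n / n * (\<Sum>k\<in>{1..<n}. \<bar>\<rho> k n - \<tau> / ln n\<bar>)) \<longlonglongrightarrow> 0"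
proof (rule Lim_null_comparison)
  have t: "\<forall>\<^sub>F n in sequentially. \<tau> / ln (real n) \<le> 1" using tau by real_asymp
  show "\<forall>\<^sub>F n in sequentially. norm (ln n / n * (\<Sum>k\<in>{1..<n}. \<bar>\<rho> k n - \<tau> / ln n\<bar>)) \<le>
      2 * (ln n * real n powr \<theta> / n) + (2 / \<theta> * dev n + 2 * \<tau> / \<theta> / ln n)"
    using t ln_K_ge eventually_ge_at_top[of 2]
  proof eventually_elim
    case (elim n)
    then have lnK: "\<theta> / 2 * ln n \<le> ln (K n)" and K2: "2 \<le> K n" "K n < n" and n: "2 \<le> n" by auto
    have lnn: "0 < ln (real n)" using n by simp
    have lnK0: "0 < ln (real (K n))" using K2 by simp
    have dev0: "0 \<le> dev n" using dev_bound[of "K n" n] K2 by (auto intro: order_trans[OF abs_ge_zero])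
    have split: "{1..<n} = {1..<K n} \<union> {K n..<n}" using K2 by auto
    have "(\<Sum>k\<in>{1..<n}. \<bar>\<rho> k n - \<tau> / ln n\<bar>) = (\<Sum>k\<in>{1..<K n}. \<bar>\<rho> k n - \<tau> / ln n\<bar>) + (\<Sum>k\<in>{K n..<n}. \<bar>\<rho> k n - \<tau> / ln n\<bar>)"
      unfolding split by (rule sum.union_disjoint) auto
    also have "(\<Sum>k\<in>{1..<K n}. \<bar>\<rho> k n - \<tau> / ln n\<bar>) \<le> (\<Sum>k\<in>{1..<K n}. 2)"
    proof (rule sum_mono)
      fix k assume k: "k \<in> {1..<K n}"
      then have "\<bar>\<rho> k n\<bar> \<le> 1" using rho_le[of n k] delta n K2 by auto
      moreover have "0 \<le> \<tau> / ln n" using tau lnn by simp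
      ultimately show "\<bar>\<rho> k n - \<tau> / ln n\<bar> \<le> 2" using elim(1) by linarith
    qed
    also have "\<dots> \<le> 2 * real n powr \<theta>" using K_le[of n] K2 by simp
    also have "(\<Sum>k\<in>{K n..<n}. \<bar>\<rho> k n - \<tau> / ln n\<bar>) \<le>
       (\<Sum>k\<in>{K n..<n}. dev n / ln (K n) + \<tau> / (ln (K n) * ln n) * (ln n - ln k))"
    proof (rule sum_mono)
      fix k assume k: "k \<in> {K n..<n}"
      then have kk: "0 < ln (real k)" "ln (real (K n)) \<le> ln (real k)" "ln (real k) \<le> ln n" using K2 by auto
      \<comment> \<open>The first term is the assumed deviation at lag \<open>k\<close>, the second
        the price of replacing \<open>ln k\<close> by \<open>ln n\<close>; the latter is summed with
        \<open>sum_ln_ratio_le\<close>.\<close>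
      have "\<rho> k n - \<tau> / ln n = (\<rho> k n * ln k - \<tau>) / ln k + \<tau> * (ln n - ln k) / (ln k * ln n)"
        using kk lnn by (simp add: field_simps)
      then have "\<bar>\<rho> k n - \<tau> / ln n\<bar> \<le> \<bar>(\<rho> k n * ln k - \<tau>) / ln k\<bar> + \<bar>\<tau> * (ln n - ln k) / (ln k * ln n)\<bar>"
        by (metis abs_triangle_ineq)
      also have "\<bar>(\<rho> k n * ln k - \<tau>) / ln k\<bar> \<le> dev n / ln (K n)"
        unfolding abs_divide using kk lnK0 dev_bound[OF k] by (intro frac_le) auto
      also have "\<bar>\<tau> * (ln n - ln k) / (ln k * ln n)\<bar> = \<tau> * (ln n - ln k) / (ln k * ln n)"
        using kk tau lnn by (intro abs_of_nonneg divide_nonneg_pos mult_nonneg_nonneg mult_pos_pos) auto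
      also have "\<dots> \<le> \<tau> * (ln n - ln k) / (ln (K n) * ln n)"
        using kk tau lnn lnK0 by (intro divide_left_mono mult_right_mono mult_nonneg_nonneg mult_pos_pos) auto
      finally show "\<bar>\<rho> k n - \<tau> / ln n\<bar> \<le> dev n / ln (K n) + \<tau> / (ln (K n) * ln n) * (ln n - ln k)"
        by simp
    qed
    also have "\<dots> \<le> n * (dev n / ln (K n)) + \<tau> / (ln (K n) * ln n) * n"
    proof -
      have "(\<Sum>k\<in>{K n..<n}. ln n - ln (real k)) \<le> (\<Sum>k=1..n. ln n - ln (real k))"
        using K2 by (intro sum_mono2) auto
      also have "\<dots> \<le> n" by (rule sum_ln_ratio_le)
      finally have "(\<Sum>k\<in>{K n..<n}. ln n - ln (real k)) \<le> n" .
      then have "\<tau> / (ln (K n) * ln n) * (\<Sum>k\<in>{K n..<n}. ln n - ln (real k)) \<le> \<tau> / (ln (K n) * ln n) * n"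
        using tau lnK0 lnn by (intro mult_left_mono) auto
      moreover have "(\<Sum>k\<in>{K n..<n}. dev n / ln (K n)) \<le> n * (dev n / ln (K n))"
        using dev0 lnK0 by (auto intro!: mult_right_mono divide_right_mono)
      ultimately show ?thesis unfolding sum.distrib sum_distrib_left[symmetric] by (rule add_mono[rotated])
    qed
    finally have S: "(\<Sum>k\<in>{1..<n}. \<bar>\<rho> k n - \<tau> / ln n\<bar>) \<le>
       2 * real n powr \<theta> + (n * (dev n / ln (K n)) + \<tau> / (ln (K n) * ln n) * n)" by simp
    have "norm (ln n / n * (\<Sum>k\<in>{1..<n}. \<bar>\<rho> k n - \<tau> / ln n\<bar>)) = ln n / n * (\<Sum>k\<in>{1..<n}. \<bar>\<rho> k n - \<tau> / ln n\<bar>)"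
      using lnn by (simp add: sum_nonneg)
    also have "\<dots> \<le> ln n / n * (2 * real n powr \<theta> + (n * (dev n / ln (K n)) + \<tau> / (ln (K n) * ln n) * n))"
      using S lnn by (intro mult_left_mono) auto
    also have "\<dots> = 2 * (ln n * real n powr \<theta> / n) + (ln n / ln (K n)) * dev n + \<tau> / ln (K n)"
      using n lnn lnK0 by (simp add: field_simps)
    also have "(ln n / ln (K n)) * dev n \<le> 2 / \<theta> * dev n"
    proof (rule mult_right_mono[OF _ dev0])
      show "ln n / ln (K n) \<le> 2 / \<theta>" using lnK lnK0 theta_less by (simp add: field_simps)
    qed
    also have "\<tau> / ln (K n) \<le> \<tau> / (\<theta> / 2 * ln n)"
      using lnK lnK0 lnn tau theta_less by (intro divide_left_mono) auto
    also have "\<tau> / (\<theta> / 2 * ln n) = 2 * \<tau> / \<theta> / ln n" by simp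
    finally show ?case by simp
  qed
  have "(\<lambda>n. ln (real n) * real n powr \<theta> / real n) \<longlonglongrightarrow> 0" using theta_less by real_asymp
  moreover have "(\<lambda>n. 2 * \<tau> / \<theta> / ln (real n)) \<longlonglongrightarrow> 0" by real_asymp
  ultimately have "(\<lambda>n. 2 * (ln n * real n powr \<theta> / n) + (2 / \<theta> * dev n + 2 * \<tau> / \<theta> / ln n)) \<longlonglongrightarrow> 2 * 0 + (2 / \<theta> * 0 + 0)"
    by (intro tendsto_add tendsto_mult tendsto_const dev_lim)
  then show "(\<lambda>n. 2 * (ln n * real n powr \<theta> / n) + (2 / \<theta> * dev n + 2 * \<tau> / \<theta> / ln n)) \<longlonglongrightarrow> 0" by simp
qed

text \<open>The weights 2 (n - k) / n^2 tell how often lag \<open>k\<close> occurs in the average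
  over all ordered pairs. They add up to (n - 1) / n, so constant correlations
  \<open>\<tau> / ln n\<close> would give the limit; each weight is at most 2 / n, so the error is
  at most twice the mean deviation.\<close>

lemma mean_tendsto: "(\<lambda>n. ln n * (2 / n\<^sup>2 * (\<Sum>k\<in>{1..<n}. (real n - real k) * \<rho> k n))) \<longlonglongrightarrow> \<tau>"
proof -
  have "(\<lambda>n. ln n * (2 / n\<^sup>2 * (\<Sum>k\<in>{1..<n}. (real n - real k) * \<rho> k n)) - \<tau> * ((real n - 1) / n)) \<longlonglongrightarrow> 0"
  proof (rule Lim_null_comparison)
    show "\<forall>\<^sub>F n in sequentially. norm (ln n * (2 / n\<^sup>2 * (\<Sum>k\<in>{1..<n}. (real n - real k) * \<rho> k n)) - \<tau> * ((real n - 1) / n))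
       \<le> 2 * (ln n / n * (\<Sum>k\<in>{1..<n}. \<bar>\<rho> k n - \<tau> / ln n\<bar>))"
      using eventually_ge_at_top[of 2]
    proof eventually_elim
      case (elim n)
      have lnn: "0 < ln (real n)" using elim by simp
      have gauss: "(\<Sum>k\<in>{1..<n}. real n - real k) = real n * (real n - 1) / 2"
      proof -
        have "(\<Sum>k\<in>{1..<n}. real n - real k) = (\<Sum>k\<in>{1..<n}. real k)"
          by (rule sum.reindex_bij_witness[of _ "\<lambda>k. n - k" "\<lambda>k. n - k"]) auto
        also have "\<dots> = real n * (real n - 1) / 2"
          by (induction n) (auto simp: field_simps not_less_eq_eq)
        finally show ?thesis .
      qed
      have "ln n * (2 / n\<^sup>2 * (\<Sum>k\<in>{1..<n}. (real n - real k) * \<rho> k n)) - \<tau> * ((real n - 1) / n) =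
         ln n * 2 / n\<^sup>2 * (\<Sum>k\<in>{1..<n}. (real n - real k) * (\<rho> k n - \<tau> / ln n))"
      proof -
        have "(\<Sum>k\<in>{1..<n}. (real n - real k) * (\<rho> k n - \<tau> / ln n)) =
          (\<Sum>k\<in>{1..<n}. (real n - real k) * \<rho> k n) - (real n * (real n - 1) / 2) * (\<tau> / ln n)"
          unfolding gauss[symmetric] sum_distrib_right sum_subtractf[symmetric] by (simp add: right_diff_distrib)
        then show ?thesis using elim lnn by (simp add: field_simps power2_eq_square)
      qed
      then have "norm (ln n * (2 / n\<^sup>2 * (\<Sum>k\<in>{1..<n}. (real n - real k) * \<rho> k n)) - \<tau> * ((real n - 1) / n)) =
         ln n * 2 / n\<^sup>2 * \<bar>\<Sum>k\<in>{1..<n}. (real n - real k) * (\<rho> k n - \<tau> / ln n)\<bar>"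
        using lnn by (simp add: abs_mult)
      also have "\<dots> \<le> ln n * 2 / n\<^sup>2 * (\<Sum>k\<in>{1..<n}. n * \<bar>\<rho> k n - \<tau> / ln n\<bar>)"
        using lnn
        by (intro mult_left_mono order_trans[OF sum_abs]) (auto simp: abs_mult intro!: sum_mono mult_right_mono)
      also have "\<dots> = 2 * (ln n / n * (\<Sum>k\<in>{1..<n}. \<bar>\<rho> k n - \<tau> / ln n\<bar>))"
        unfolding sum_distrib_left[symmetric] using elim by (simp add: power2_eq_square)
      finally show ?case .
    qed
    have "(\<lambda>n. 2 * (ln n / n * (\<Sum>k\<in>{1..<n}. \<bar>\<rho> k n - \<tau> / ln n\<bar>))) \<longlonglongrightarrow> 2 * 0"
      by (intro tendsto_mult tendsto_const mean_deviation_tendsto)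
    then show "(\<lambda>n. 2 * (ln n / n * (\<Sum>k\<in>{1..<n}. \<bar>\<rho> k n - \<tau> / ln n\<bar>))) \<longlonglongrightarrow> 0" by simp
  qed
  moreover have "(\<lambda>n. \<tau> * ((real n - 1) / n)) \<longlonglongrightarrow> \<tau>" by real_asymp
  ultimately have "(\<lambda>n. (ln n * (2 / n\<^sup>2 * (\<Sum>k\<in>{1..<n}. (real n - real k) * \<rho> k n)) - \<tau> * ((real n - 1) / n)) + \<tau> * ((real n - 1) / n)) \<longlonglongrightarrow> 0 + \<tau>"
    by (rule tendsto_add)
  then show ?thesis by simp
qed

text \<open>Here \<open>b n\<close> is the correlation of the comparison array at every positive
  lag. For short lags the exponent 2 / (1 + d) beats their number. For long lags both correlations
  are O(1 / ln n), so the exponential loses only a constant factor against the uncorrelated case and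
  is O(ln n / n^2); what remains is the mean deviation.\<close>

lemma comparison_sum_tendsto:
  assumes b: "(\<lambda>n. b n * ln (real n)) \<longlonglongrightarrow> \<tau>"
  shows "(\<lambda>n. n * (\<Sum>k\<in>{1..<n}. \<bar>\<rho> k n - b n\<bar> * exp (- (norm_u n m)\<^sup>2 / (1 + max \<bar>\<rho> k n\<bar> \<bar>b n\<bar>)))) \<longlonglongrightarrow> 0"
proof -
  define C where "C = sqrt (4 * pi) * exp (- m)"
  \<comment> \<open>Bounds the larger of the two correlations at a long lag, multiplied by
    \<open>ln n\<close>: times \<open>ln k\<close> it is below \<open>\<tau> + 1\<close>, and
    \<open>ln k\<close> is at least \<open>\<theta> / 2 * ln n\<close>.\<close>
  define c where "c = 2 * (\<tau> + 1) / \<theta>"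
  have C0: "0 < C" unfolding C_def by simp
  have "\<theta> * (\<tau> + 1) \<le> 2 * (\<tau> + 1)" using tau theta_less by (intro mult_right_mono) auto
  then have c0: "0 < c" "\<tau> + 1 \<le> c" unfolding c_def using tau theta_less by (auto simp: pos_le_divide_eq mult_ac)
  note blim = tendsto_0_if_mult_ln[OF b]
  \<comment> \<open>Slightly above \<open>\<delta>\<close>, with the strict inequality of
    \<open>theta_less\<close> preserved, so that the positive number \<open>d\<close> eventually
    dominates \<open>\<bar>b n\<bar>\<close> as well.\<close>
  obtain d where d: "\<delta> < d" "d < 1" "1 + \<theta> < 2 / (1 + d)"
  proof -
    have "((\<lambda>d. 2 / (1 + d)) \<longlongrightarrow> 2 / (1 + \<delta>)) (at_right \<delta>)"
      using delta_nonneg by (intro tendsto_intros) auto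
    then have "\<forall>\<^sub>F d in at_right \<delta>. 1 + \<theta> < 2 / (1 + d)"
      using theta_less(3) by (rule order_tendstoD(1))
    moreover have "\<forall>\<^sub>F d in at_right \<delta>. \<delta> < d" by (rule eventually_at_right_less)
    moreover have "\<forall>\<^sub>F d in at_right \<delta>. d < 1"
      using order_tendstoD(2)[OF tendsto_ident_at delta] .
    ultimately have "\<forall>\<^sub>F d in at_right \<delta>. \<delta> < d \<and> d < 1 \<and> 1 + \<theta> < 2 / (1 + d)" by eventually_elim auto
    from eventually_happens'[OF _ this] show ?thesis using that by (auto simp: trivial_limit_at_right_real)
  qed
  define p where "p = 2 / (1 + d)"
  have d0: "0 < d" using d delta_nonneg by simp
  have p: "1 + \<theta> < p" "0 < p" "1 \<le> p" unfolding p_def using d d0 theta_less by auto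
  define w where "w n = norm_u n m" for n
  have ulim: "(\<lambda>n. (w n)\<^sup>2 / ln n) \<longlonglongrightarrow> 2"
  proof -
    have "(\<lambda>n::nat. (sqrt (2 * ln n) + (m - ln (4 * pi * ln n) / 2) / sqrt (2 * ln n))\<^sup>2 / ln n) \<longlonglongrightarrow> 2"
      by real_asymp (simp add: powr_half_sqrt)
    moreover have "\<forall>\<^sub>F n in sequentially. (sqrt (2 * ln n) + (m - ln (4 * pi * ln n) / 2) / sqrt (2 * ln n))\<^sup>2 / ln n = (w n)\<^sup>2 / ln n"
      using eventually_ge_at_top[of 2] by eventually_elim (simp add: norm_u_eq w_def)
    ultimately show ?thesis by (rule Lim_transform_eventually)
  qed
  define bound where "bound n = 2 * (n * real n powr \<theta> * (C * sqrt (ln n) / n) powr p) +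
     exp (3 * c) * C\<^sup>2 * (ln n / n * (\<Sum>k\<in>{1..<n}. \<bar>\<rho> k n - \<tau> / ln n\<bar>) + \<bar>\<tau> - b n * ln n\<bar>)" for n
  have "\<forall>\<^sub>F n in sequentially. norm (n * (\<Sum>k\<in>{1..<n}. \<bar>\<rho> k n - b n\<bar> * exp (- (w n)\<^sup>2 / (1 + max \<bar>\<rho> k n\<bar> \<bar>b n\<bar>)))) \<le> bound n"
  proof -
    have e1: "\<forall>\<^sub>F n in sequentially. \<bar>b n\<bar> < d"
      using order_tendstoD(2)[OF tendsto_rabs[OF blim], of d] d0 by simp
    have e2: "\<forall>\<^sub>F n in sequentially. \<bar>b n * ln n\<bar> < \<tau> + 1"
      using order_tendstoD(2)[OF tendsto_rabs[OF b], of "\<tau> + 1"] tau by simp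
    have e3: "\<forall>\<^sub>F n in sequentially. dev n < 1" by (rule order_tendstoD(2)[OF dev_lim]) simp
    have e4: "\<forall>\<^sub>F n in sequentially. (w n)\<^sup>2 / ln n < 3" by (rule order_tendstoD(2)[OF ulim]) simp
    show ?thesis
      using e1 e2 e3 e4 ln_K_ge eventually_ge_at_top[of 2]
    proof eventually_elim
      case (elim n)
      then have lnK: "\<theta> / 2 * ln n \<le> ln (K n)" and K2: "2 \<le> K n" "K n < n" and n: "2 \<le> n" by auto
      have lnn: "0 < ln (real n)" using n by simp
      have lnK0: "0 < ln (real (K n))" using K2 by simp
      let ?o = "\<lambda>k. max \<bar>\<rho> k n\<bar> \<bar>b n\<bar>"
      define q where "q = exp (- (w n)\<^sup>2 / 2)"
      have q0: "0 < q" unfolding q_def by simp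
      have q: "q \<le> C * sqrt (ln n) / n"
      proof -
        have "q \<le> sqrt (4 * pi * ln n) / n * (exp (- m) * 1)"
          unfolding q_def w_def exp_neg_norm_u_sq[OF n] using lnn by (intro mult_left_mono) auto
        then show ?thesis unfolding C_def by (simp add: real_sqrt_mult mult_ac)
      qed
      have split: "{1..<n} = {1..<K n} \<union> {K n..<n}" using K2 by auto
      have "(\<Sum>k\<in>{1..<n}. \<bar>\<rho> k n - b n\<bar> * exp (- (w n)\<^sup>2 / (1 + ?o k))) =
        (\<Sum>k\<in>{1..<K n}. \<bar>\<rho> k n - b n\<bar> * exp (- (w n)\<^sup>2 / (1 + ?o k))) + (\<Sum>k\<in>{K n..<n}. \<bar>\<rho> k n - b n\<bar> * exp (- (w n)\<^sup>2 / (1 + ?o k)))"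
        unfolding split by (rule sum.union_disjoint) auto
      also have "(\<Sum>k\<in>{1..<K n}. \<bar>\<rho> k n - b n\<bar> * exp (- (w n)\<^sup>2 / (1 + ?o k))) \<le> (\<Sum>k\<in>{1..<K n}. 2 * (C * sqrt (ln n) / n) powr p)"
      proof (rule sum_mono)
        fix k assume k: "k \<in> {1..<K n}"
        then have r: "\<bar>\<rho> k n\<bar> \<le> \<delta>" using rho_le[of n k] n K2 by auto
        have "\<bar>\<rho> k n - b n\<bar> \<le> 2" using r elim(1) d by linarith
        moreover have "exp (- (w n)\<^sup>2 / (1 + ?o k)) \<le> (C * sqrt (ln n) / n) powr p"
        proof -
          have "(w n)\<^sup>2 / (1 + d) \<le> (w n)\<^sup>2 / (1 + ?o k)"
            using r d elim(1) by (intro divide_left_mono) (auto intro!: mult_pos_pos add_pos_nonneg)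
          then have "exp (- (w n)\<^sup>2 / (1 + ?o k)) \<le> exp (- (w n)\<^sup>2 / (1 + d))" by simp
          also have "\<dots> = q powr p" unfolding q_def p_def powr_def using d0 by (simp add: field_simps)
          also have "\<dots> \<le> (C * sqrt (ln n) / n) powr p" using q q0 p by (intro powr_mono2) auto
          finally show ?thesis .
        qed
        ultimately show "\<bar>\<rho> k n - b n\<bar> * exp (- (w n)\<^sup>2 / (1 + ?o k)) \<le> 2 * (C * sqrt (ln n) / n) powr p"
          by (intro mult_mono) auto
      qed
      also have "\<dots> \<le> real n powr \<theta> * (2 * (C * sqrt (ln n) / n) powr p)"
      proof -
        have "real (K n - 1) \<le> real n powr \<theta>" using K_le[of n] by linarith
        then show ?thesis by (auto intro!: mult_right_mono)
      qed
      also have "(\<Sum>k\<in>{K n..<n}. \<bar>\<rho> k n - b n\<bar> * exp (- (w n)\<^sup>2 / (1 + ?o k))) \<le>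
         (\<Sum>k\<in>{K n..<n}. (\<bar>\<rho> k n - \<tau> / ln n\<bar> + \<bar>\<tau> / ln n - b n\<bar>) * (exp (3 * c) * C\<^sup>2 * ln n / n\<^sup>2))"
      proof (rule sum_mono)
        fix k assume k: "k \<in> {K n..<n}"
        then have kk: "0 < ln (real k)" "ln (real (K n)) \<le> ln (real k)" using K2 by auto
        have "\<bar>\<rho> k n * ln k\<bar> \<le> \<tau> + 1" using dev_bound[OF k] elim(3) tau by linarith
        then have "\<bar>\<rho> k n\<bar> * ln k \<le> \<tau> + 1" using kk by (simp add: abs_mult)
        moreover have "\<bar>\<rho> k n\<bar> * (\<theta> / 2 * ln n) \<le> \<bar>\<rho> k n\<bar> * ln k" using lnK kk by (intro mult_left_mono) auto
        ultimately have "\<bar>\<rho> k n\<bar> * ln n \<le> c" unfolding c_def using theta_less by (simp add: field_simps)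
        moreover have "\<bar>b n\<bar> * ln n \<le> c" using elim(2) c0 lnn by (simp add: abs_mult)
        ultimately have o: "?o k * ln n \<le> c" by (auto simp: max_def)
        have o0: "0 \<le> ?o k" by simp
        \<comment> \<open>Linearises the exponent. The square of \<open>w n\<close> times the
          correlation is at most 3 ln n times it, hence at most 3 c, which explains
          \<open>exp (3 * c)\<close>; the 3 is just a number above the limit 2 of (w n)^2 / ln
          n.\<close>
        have o1: "1 - ?o k \<le> 1 / (1 + ?o k)"
        proof -
          have "(1 - ?o k) * (1 + ?o k) \<le> 1" by (simp add: algebra_simps)
          then show ?thesis using o0 by (subst pos_le_divide_eq) auto
        qed
        have "(w n)\<^sup>2 - 3 * c \<le> (w n)\<^sup>2 * (1 - ?o k)"
        proof -
          have "(w n)\<^sup>2 \<le> 3 * ln n" using elim(4) lnn by (simp add: field_simps)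
          then have "(w n)\<^sup>2 * ?o k \<le> 3 * ln n * ?o k" using o0 by (rule mult_right_mono)
          also have "\<dots> \<le> 3 * c" using o by (simp add: mult_ac)
          finally show ?thesis by (simp add: algebra_simps)
        qed
        also have "\<dots> \<le> (w n)\<^sup>2 * (1 / (1 + ?o k))" using o1 by (rule mult_left_mono) simp
        finally have "exp (- (w n)\<^sup>2 / (1 + ?o k)) \<le> exp (3 * c - (w n)\<^sup>2)" by simp
        also have "\<dots> = exp (3 * c) * q\<^sup>2" unfolding q_def by (simp add: exp_diff exp_double[symmetric] exp_minus field_simps)
        also have "\<dots> \<le> exp (3 * c) * (C * sqrt (ln n) / n)\<^sup>2"
          using q q0 by (intro mult_left_mono power_mono) auto
        also have "\<dots> = exp (3 * c) * C\<^sup>2 * ln n / n\<^sup>2" using lnn by (simp add: power_mult_distrib power_divide)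
        finally show "\<bar>\<rho> k n - b n\<bar> * exp (- (w n)\<^sup>2 / (1 + ?o k)) \<le>
           (\<bar>\<rho> k n - \<tau> / ln n\<bar> + \<bar>\<tau> / ln n - b n\<bar>) * (exp (3 * c) * C\<^sup>2 * ln n / n\<^sup>2)"
          by (intro mult_mono) auto
      qed
      also have "\<dots> = (\<Sum>k\<in>{K n..<n}. \<bar>\<rho> k n - \<tau> / ln n\<bar> + \<bar>\<tau> / ln n - b n\<bar>) * (exp (3 * c) * C\<^sup>2 * ln n / n\<^sup>2)"
        by (rule sum_distrib_right[symmetric])
      also have "\<dots> \<le> ((\<Sum>k\<in>{1..<n}. \<bar>\<rho> k n - \<tau> / ln n\<bar>) + n * \<bar>\<tau> / ln n - b n\<bar>) * (exp (3 * c) * C\<^sup>2 * ln n / n\<^sup>2)"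
      proof (rule mult_right_mono)
        have "(\<Sum>k\<in>{K n..<n}. \<bar>\<rho> k n - \<tau> / ln n\<bar>) \<le> (\<Sum>k\<in>{1..<n}. \<bar>\<rho> k n - \<tau> / ln n\<bar>)"
          using K2 by (intro sum_mono2) auto
        moreover have "(\<Sum>k\<in>{K n..<n}. \<bar>\<tau> / ln n - b n\<bar>) \<le> n * \<bar>\<tau> / ln n - b n\<bar>"
          by (auto intro!: mult_right_mono)
        ultimately show "(\<Sum>k\<in>{K n..<n}. \<bar>\<rho> k n - \<tau> / ln n\<bar> + \<bar>\<tau> / ln n - b n\<bar>) \<le>
            (\<Sum>k\<in>{1..<n}. \<bar>\<rho> k n - \<tau> / ln n\<bar>) + n * \<bar>\<tau> / ln n - b n\<bar>"
          unfolding sum.distrib by (rule add_mono)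
      qed (use lnn in simp)
      finally have "n * (\<Sum>k\<in>{1..<n}. \<bar>\<rho> k n - b n\<bar> * exp (- (w n)\<^sup>2 / (1 + ?o k))) \<le>
        n * (real n powr \<theta> * (2 * (C * sqrt (ln n) / n) powr p) +
          ((\<Sum>k\<in>{1..<n}. \<bar>\<rho> k n - \<tau> / ln n\<bar>) + n * \<bar>\<tau> / ln n - b n\<bar>) * (exp (3 * c) * C\<^sup>2 * ln n / n\<^sup>2))"
        by (intro mult_left_mono) auto
      also have "\<dots> = bound n"
      proof -
        have 1: "ln n / n * (n * \<bar>\<tau> / ln n - b n\<bar>) = \<bar>\<tau> - b n * ln n\<bar>"
        proof -
          have "ln n / n * (n * \<bar>\<tau> / ln n - b n\<bar>) = \<bar>ln n * (\<tau> / ln n - b n)\<bar>"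
            using n lnn by (simp add: abs_mult)
          also have "ln n * (\<tau> / ln n - b n) = \<tau> - b n * ln n" using lnn by (simp add: field_simps)
          finally show ?thesis .
        qed
        have 2: "n * (S * (e * C\<^sup>2 * ln n / n\<^sup>2)) = e * C\<^sup>2 * (ln n / n * S)" for S e :: real
          using n by (simp add: power2_eq_square)
        show ?thesis unfolding bound_def 1[symmetric] distrib_left 2 by (simp add: distrib_left mult_ac)
      qed
      finally show ?case by (simp add: sum_nonneg)
    qed
  qed
  moreover have "bound \<longlonglongrightarrow> 0"
  proof -
    have "(\<lambda>n. real n * real n powr \<theta> * (C * sqrt (ln n) / n) powr p) \<longlonglongrightarrow> 0"
    proof -
      \<comment> \<open>The surplus of the exponent over 1 + \<theta>: a power of \<open>n\<close>
        that beats the power of \<open>ln n\<close>.\<close>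
      define h where "h = p - (1 + \<theta>)"
      have h: "0 < h" using p by (simp add: h_def)
      have "(\<lambda>n. C powr p * (ln (real n) powr (p / 2) * real n powr (- h))) \<longlonglongrightarrow> C powr p * 0"
        by (intro tendsto_mult tendsto_const) (use h p in real_asymp)
      moreover have "\<forall>\<^sub>F n in sequentially. C powr p * (ln (real n) powr (p / 2) * real n powr (- h)) =
          real n * real n powr \<theta> * (C * sqrt (ln n) / n) powr p"
        using eventually_ge_at_top[of 2]
      proof eventually_elim
        case (elim n)
        have lnn: "0 < ln (real n)" using elim by simp
        have "real n powr (- h) = real n powr 1 * real n powr \<theta> * real n powr (- p)"
          unfolding h_def powr_add[symmetric] by simp
        moreover have "(C * sqrt (ln n) / n) powr p = C powr p * ln (real n) powr (p / 2) * real n powr (- p)"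
          using C0 lnn elim by (simp add: powr_mult powr_divide powr_minus_divide powr_half_sqrt[symmetric] powr_powr)
        ultimately show ?case using elim by simp
      qed
      ultimately have "(\<lambda>n. real n * real n powr \<theta> * (C * sqrt (ln n) / n) powr p) \<longlonglongrightarrow> C powr p * 0"
        by (rule Lim_transform_eventually)
      then show ?thesis by simp
    qed
    moreover have "(\<lambda>n. \<bar>\<tau> - b n * ln n\<bar>) \<longlonglongrightarrow> \<bar>\<tau> - \<tau>\<bar>" by (intro tendsto_intros b)
    ultimately have "bound \<longlonglongrightarrow> 2 * 0 + exp (3 * c) * C\<^sup>2 * (0 + \<bar>\<tau> - \<tau>\<bar>)"
      unfolding bound_def[abs_def] by (intro tendsto_add tendsto_mult tendsto_const mean_deviation_tendsto)
    then show ?thesis by simp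
  qed
  ultimately show ?thesis unfolding w_def by (rule Lim_null_comparison)
qed

end

section \<open>The comparison array\<close>

text \<open>A linear combination is only known to have some \<open>gaussian_law\<close>; its first
  two moments identify the parameters, with the point mass treated separately.\<close>

lemma gaussian_law_eq_normal:
  assumes "prob_space M" and [measurable]: "S \<in> borel_measurable M"
    and law: "distr M borel S = gaussian_law \<mu> \<sigma>" and \<sigma>: "0 \<le> \<sigma>"
    and mean: "(\<integral>\<omega>. S \<omega> \<partial>M) = 0" and var: "(\<integral>\<omega>. (S \<omega>)\<^sup>2 \<partial>M) = v"
  shows "(\<integral>\<omega>. iexp (S \<omega>) \<partial>M) = complex_of_real (exp (- v / 2))"
proof -
  interpret prob_space M by fact
  have E: "(\<integral>\<omega>. f (S \<omega>) \<partial>M) = (\<integral>x. f x \<partial>gaussian_law \<mu> \<sigma>)" if [measurable]: "f \<in> borel_measurable borel"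
    for f :: "real \<Rightarrow> 'b::{banach, second_countable_topology}"
    unfolding law[symmetric] by (rule integral_distr[symmetric]) auto
  show ?thesis
  proof (cases "\<sigma> = 0")
    case True
    then have law0: "gaussian_law \<mu> \<sigma> = return borel \<mu>" by (simp add: gaussian_law_def)
    have "\<mu> = 0" using E[of "\<lambda>x. x"] mean unfolding law0 by (simp add: integral_return)
    moreover have "v = \<mu>\<^sup>2" using E[of "\<lambda>x. x\<^sup>2"] var unfolding law0 by (simp add: integral_return)
    ultimately show ?thesis using E[of "\<lambda>x. iexp x"] unfolding law0 by (simp add: integral_return)
  next
    case False
    then have \<sigma>0: "0 < \<sigma>" and lawd: "gaussian_law \<mu> \<sigma> = density lborel (normal_density \<mu> \<sigma>)"
      using \<sigma> by (auto simp: gaussian_law_def)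
    have D: "distributed M lborel S (normal_density \<mu> \<sigma>)"
      unfolding distributed_def using law lawd
      by (auto simp: distr_cong[of M M lborel borel S S])
    have "\<mu> = 0" using normal_distributed_expectation[OF \<sigma>0 D] mean by simp
    then have v: "v = \<sigma>\<^sup>2" using normal_distributed_variance[OF \<sigma>0 D] mean var by simp
    have D1: "distributed M lborel (\<lambda>\<omega>. (S \<omega> - \<mu>) / \<sigma>) std_normal_density"
      using D normal_standard_normal_convert[OF \<sigma>0, of S \<mu>] by simp
    then have d: "distr M lborel (\<lambda>\<omega>. (S \<omega> - \<mu>) / \<sigma>) = std_normal_distribution"
      by (simp add: distributed_def)
    have "(\<integral>\<omega>. iexp (S \<omega>) \<partial>M) = (\<integral>\<omega>. iexp (\<sigma> * ((S \<omega> - \<mu>) / \<sigma>)) \<partial>M)"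
      using \<open>\<mu> = 0\<close> \<sigma>0 by simp
    also have "\<dots> = (\<integral>x. iexp (\<sigma> * x) \<partial>distr M lborel (\<lambda>\<omega>. (S \<omega> - \<mu>) / \<sigma>))"
      by (rule integral_distr[symmetric]) auto
    also have "\<dots> = complex_of_real (exp (- \<sigma>\<^sup>2 / 2))" unfolding d by (rule integral_iexp_std_normal)
    finally show ?thesis unfolding v .
  qed
qed

lemma integrable_mult_of_square_integrable:
  fixes X Y :: "'a \<Rightarrow> real"
  assumes [measurable]: "X \<in> borel_measurable M" "Y \<in> borel_measurable M"
    and "integrable M (\<lambda>\<omega>. (X \<omega>)\<^sup>2)" "integrable M (\<lambda>\<omega>. (Y \<omega>)\<^sup>2)"
  shows "integrable M (\<lambda>\<omega>. X \<omega> * Y \<omega>)"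
proof (rule Bochner_Integration.integrable_bound[of _ "\<lambda>\<omega>. (X \<omega>)\<^sup>2 + (Y \<omega>)\<^sup>2"])
  show "AE \<omega> in M. norm (X \<omega> * Y \<omega>) \<le> norm ((X \<omega>)\<^sup>2 + (Y \<omega>)\<^sup>2)"
  proof (intro AE_I2)
    fix \<omega>
    have "2 * (\<bar>X \<omega>\<bar> * \<bar>Y \<omega>\<bar>) \<le> (X \<omega>)\<^sup>2 + (Y \<omega>)\<^sup>2"
      using sum_squares_bound[of "\<bar>X \<omega>\<bar>" "\<bar>Y \<omega>\<bar>"] by (simp add: mult.assoc)
    moreover have "0 \<le> \<bar>X \<omega>\<bar> * \<bar>Y \<omega>\<bar>" by simp
    ultimately have "\<bar>X \<omega>\<bar> * \<bar>Y \<omega>\<bar> \<le> (X \<omega>)\<^sup>2 + (Y \<omega>)\<^sup>2" by linarith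
    then show "norm (X \<omega> * Y \<omega>) \<le> norm ((X \<omega>)\<^sup>2 + (Y \<omega>)\<^sup>2)" by (simp add: abs_mult)
  qed
qed (use assms in auto)

text \<open>A variance of one rules out the junk value that the integral has on non-integrable functions.\<close>

lemma jointly_gaussian_imp_gaussian_family:
  assumes M: "prob_space M" and X: "jointly_gaussian M I X"
    and mean: "\<And>i. i \<in> I \<Longrightarrow> prob_space.expectation M (X i) = 0"
    and var: "\<And>i. i \<in> I \<Longrightarrow> prob_space.variance M (X i) = 1"
  shows "gaussian_family M I X (\<lambda>i j. \<integral>\<omega>. X i \<omega> * X j \<omega> \<partial>M)"
    "\<And>i j. i \<in> I \<Longrightarrow> j \<in> I \<Longrightarrow> integrable M (\<lambda>\<omega>. X i \<omega> * X j \<omega>)"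
    "\<And>i. i \<in> I \<Longrightarrow> (\<integral>\<omega>. X i \<omega> * X i \<omega> \<partial>M) = 1"
    "\<And>i j. i \<in> I \<Longrightarrow> j \<in> I \<Longrightarrow> correlation M (X i) (X j) = (\<integral>\<omega>. X i \<omega> * X j \<omega> \<partial>M)"
proof -
  interpret prob_space M by fact
  have fin: "finite I" and [measurable]: "\<And>i. i \<in> I \<Longrightarrow> X i \<in> borel_measurable M"
    using X unfolding jointly_gaussian_def by auto
  have sq: "integrable M (\<lambda>\<omega>. (X i \<omega>)\<^sup>2)" if "i \<in> I" for i
    using var[OF that] mean[OF that] not_integrable_integral_eq[of M "\<lambda>\<omega>. (X i \<omega>)\<^sup>2"] by fastforce
  show int: "integrable M (\<lambda>\<omega>. X i \<omega> * X j \<omega>)" if "i \<in> I" "j \<in> I" for i j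
    using that sq by (intro integrable_mult_of_square_integrable) auto
  show "(\<integral>\<omega>. X i \<omega> * X i \<omega> \<partial>M) = 1" if "i \<in> I" for i
    using var[OF that] mean[OF that] by (simp add: power2_eq_square)
  show "correlation M (X i) (X j) = (\<integral>\<omega>. X i \<omega> * X j \<omega> \<partial>M)" if "i \<in> I" "j \<in> I" for i j
    unfolding correlation_def covariance_def using var mean that by simp
  have int1: "integrable M (X i)" if "i \<in> I" for i
    using square_integrable_imp_integrable[of "X i"] sq[OF that] that by simp
  have "(\<integral>\<omega>. iexp (\<Sum>i\<in>I. t i * X i \<omega>) \<partial>M) =
          complex_of_real (exp (- (\<Sum>i\<in>I. \<Sum>j\<in>I. t i * t j * (\<integral>\<omega>. X i \<omega> * X j \<omega> \<partial>M)) / 2))" for t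
  proof -
    obtain \<mu> \<sigma> where law: "0 \<le> \<sigma>" "distr M borel (\<lambda>\<omega>. \<Sum>i\<in>I. t i * X i \<omega>) = gaussian_law \<mu> \<sigma>"
      using X unfolding jointly_gaussian_def by blast
    show ?thesis
    proof (rule gaussian_law_eq_normal[OF M _ law(2,1)])
      show "(\<integral>\<omega>. (\<Sum>i\<in>I. t i * X i \<omega>) \<partial>M) = 0"
        using int1 mean by (subst Bochner_Integration.integral_sum) auto
      have "(\<integral>\<omega>. (\<Sum>i\<in>I. t i * X i \<omega>)\<^sup>2 \<partial>M) = (\<integral>\<omega>. (\<Sum>i\<in>I. \<Sum>j\<in>I. t i * t j * (X i \<omega> * X j \<omega>)) \<partial>M)"
        by (simp add: power2_eq_square sum_product mult_ac)
      also have "\<dots> = (\<Sum>i\<in>I. \<Sum>j\<in>I. t i * t j * (\<integral>\<omega>. X i \<omega> * X j \<omega> \<partial>M))"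
        using int by (simp add: Bochner_Integration.integral_sum)
      finally show "(\<integral>\<omega>. (\<Sum>i\<in>I. t i * X i \<omega>)\<^sup>2 \<partial>M) = \<dots>" .
    qed auto
  qed
  then show "gaussian_family M I X (\<lambda>i j. \<integral>\<omega>. X i \<omega> * X j \<omega> \<partial>M)"
    unfolding gaussian_family_def using M fin by auto
qed

text \<open>Induction on the size: the new last row and the new last column each contain every lag
  from 1 to n once.\<close>

lemma sum_over_lags:
  fixes f :: "nat \<Rightarrow> real"
  shows "(\<Sum>k=1..n. \<Sum>l\<in>{1..n} - {k}. f (nat \<bar>int k - int l\<bar>)) = 2 * (\<Sum>m\<in>{1..<n}. (real n - real m) * f m)"
proof (induction n)
  case (Suc n)
  have a: "(\<Sum>l\<in>{1..Suc n} - {k}. f (nat \<bar>int k - int l\<bar>)) =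
      (\<Sum>l\<in>{1..n} - {k}. f (nat \<bar>int k - int l\<bar>)) + f (Suc n - k)" if "k \<in> {1..n}" for k
  proof -
    have "{1..Suc n} - {k} = insert (Suc n) ({1..n} - {k})" using that by auto
    moreover have "nat \<bar>int k - int (Suc n)\<bar> = Suc n - k" using that by auto
    moreover have "nat (1 + int n - int k) = Suc n - k" using that by auto
    ultimately show ?thesis by (simp add: add.commute)
  qed
  have b: "(\<Sum>k=1..n. f (Suc n - k)) = (\<Sum>m=1..n. f m)"
    by (rule sum.reindex_bij_witness[of _ "\<lambda>k. Suc n - k" "\<lambda>k. Suc n - k"]) auto
  have c: "(\<Sum>l\<in>{1..Suc n} - {Suc n}. f (nat \<bar>int (Suc n) - int l\<bar>)) = (\<Sum>k=1..n. f (Suc n - k))"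
    by (rule sum.cong) (auto intro!: arg_cong[where f=f])
  have "(\<Sum>k=1..Suc n. \<Sum>l\<in>{1..Suc n} - {k}. f (nat \<bar>int k - int l\<bar>)) =
      (\<Sum>k=1..n. \<Sum>l\<in>{1..Suc n} - {k}. f (nat \<bar>int k - int l\<bar>)) + (\<Sum>m=1..n. f m)"
    using b c by simp
  also have "(\<Sum>k=1..n. \<Sum>l\<in>{1..Suc n} - {k}. f (nat \<bar>int k - int l\<bar>)) =
      (\<Sum>k=1..n. (\<Sum>l\<in>{1..n} - {k}. f (nat \<bar>int k - int l\<bar>)) + f (Suc n - k))"
    by (intro sum.cong refl a)
  also have "\<dots> = 2 * (\<Sum>m\<in>{1..<n}. (real n - real m) * f m) + (\<Sum>m=1..n. f m)"
    unfolding sum.distrib Suc.IH b ..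
  finally have "(\<Sum>k=1..Suc n. \<Sum>l\<in>{1..Suc n} - {k}. f (nat \<bar>int k - int l\<bar>)) =
      2 * (\<Sum>m\<in>{1..<n}. (real n - real m) * f m) + 2 * (\<Sum>m=1..n. f m)" by simp
  moreover have "(\<Sum>m\<in>{1..<n}. (real n - real m) * f m) = (\<Sum>m\<in>{1..n}. (real n - real m) * f m)"
    by (rule sum.mono_neutral_left) auto
  moreover have "(\<Sum>m\<in>{1..<Suc n}. (real (Suc n) - real m) * f m) = (\<Sum>m\<in>{1..n}. (real n - real m) * f m) + (\<Sum>m=1..n. f m)"
    unfolding sum.distrib[symmetric] atLeastLessThanSuc_atLeastAtMost by (intro sum.cong) (auto simp: algebra_simps)
  ultimately show ?case by simp
qed simp

section \<open>The array with a common pair\<close>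

definition coord :: "nat \<Rightarrow> real \<times> real \<Rightarrow> real" where
  "coord i z = (if i = 1 then fst z else snd z)"

text \<open>The first factor carries the pair shared by the whole row, the product over
  \<open>k\<close> the independent residual pairs.\<close>

definition comparison_space :: "nat \<Rightarrow> ((real \<times> real) \<times> (nat \<Rightarrow> real \<times> real)) measure" where
  "comparison_space n = std_normal_pair \<Otimes>\<^sub>M
     (\<Pi>\<^sub>M k\<in>{1..n}. std_normal_pair)"

text \<open>\<open>s\<close> and \<open>r\<close> are the correlations within the common and within
  a residual pair, \<open>p\<close> and \<open>q\<close> the standard deviations of the two parts of
  a component. They will be chosen with p^2 + q^2 = 1.\<close>

definition comparison_array ::
    "real \<Rightarrow> real \<Rightarrow> (nat \<Rightarrow> real) \<Rightarrow> (nat \<Rightarrow> real) \<Rightarrow> nat \<times> nat \<Rightarrow> (real \<times> real) \<times> (nat \<Rightarrow> real \<times> real) \<Rightarrow> real" where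
  "comparison_array s r p q = (\<lambda>(i, k) \<omega>.
     p i * coord i (correlated_pair s (fst \<omega>)) + q i * coord i (correlated_pair r (snd \<omega> k)))"

lemma integral_iexp_correlated_pair:
  assumes "\<bar>r\<bar> \<le> 1"
  shows "(\<integral>z. iexp (a * fst (correlated_pair r z) + b * snd (correlated_pair r z))
      \<partial>std_normal_pair) = complex_of_real (exp (- (a\<^sup>2 + 2 * r * a * b + b\<^sup>2) / 2))"
proof -
  have r2: "r\<^sup>2 \<le> 1" using assms by (simp add: abs_square_le_1)
  have 1: "a * fst (correlated_pair r z) + b * snd (correlated_pair r z) = (a + b * r) * fst z + (b * sqrt (1 - r\<^sup>2)) * snd z" for z
    by (simp add: correlated_pair_def algebra_simps)
  have 2: "(a + b * r)\<^sup>2 + (b * sqrt (1 - r\<^sup>2))\<^sup>2 = a\<^sup>2 + 2 * r * a * b + b\<^sup>2"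
    using r2 by (simp add: power_mult_distrib) (simp add: power2_eq_square algebra_simps)
  show ?thesis unfolding 1 integral_iexp_std_normal_pair 2 ..
qed

lemma measurable_coord [measurable]:
  "(\<lambda>z. coord i (correlated_pair r z)) \<in> borel_measurable std_normal_pair"
  unfolding coord_def by (cases "i = 1") simp_all

lemma sum_one_two: "sum f ({1, 2} \<times> A) = (\<Sum>k\<in>A. f (1, k) + f (2::nat, k))"
  if "finite A" for f :: "nat \<times> 'k \<Rightarrow> real"
proof -
  have "sum f ({1, 2} \<times> A) = (\<Sum>i\<in>{1, 2}. \<Sum>k\<in>A. f (i, k))" by (simp only: sum.cartesian_product case_prod_eta)
  then show ?thesis by (simp add: sum.distrib)
qed

lemma gaussian_family_comparison_array:
  assumes s: "\<bar>s\<bar> \<le> 1" and r: "\<bar>r\<bar> \<le> 1"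
  shows "gaussian_family (comparison_space n) ({1, 2} \<times> {1..n}) (comparison_array s r p q)
    (\<lambda>(i, k) (j, l). p i * p j * (if i = j then 1 else s) + (if k = l then q i * q j * (if i = j then 1 else r) else 0))"
    (is "gaussian_family _ ?I _ ?D")
proof -
  let ?G = "std_normal_pair"
  let ?Q = "\<Pi>\<^sub>M k\<in>{1..n}. ?G"
  interpret G: prob_space std_normal_distribution by (rule prob_space_std_normal)
  interpret GG: pair_prob_space std_normal_distribution std_normal_distribution ..
  interpret Q: prob_space ?Q by (intro prob_space_PiM GG.prob_space_axioms)
  interpret QP: pair_prob_space ?G ?Q ..
  have QS: "product_sigma_finite (\<lambda>_::nat. ?G)" ..
  have meas: "comparison_array s r p q ik \<in> borel_measurable (comparison_space n)" if I: "ik \<in> ?I" for ik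
  proof -
    obtain i k where ik: "ik = (i, k)" "k \<in> {1..n}" using I by (cases ik) auto
    have [measurable]: "(\<lambda>\<omega>. snd \<omega> k) \<in> comparison_space n \<rightarrow>\<^sub>M ?G"
      unfolding comparison_space_def using ik(2) by measurable
    have [measurable]: "fst \<in> comparison_space n \<rightarrow>\<^sub>M ?G" unfolding comparison_space_def by measurable
    show ?thesis unfolding ik comparison_array_def prod.case by measurable
  qed
  have "(\<integral>\<omega>. iexp (\<Sum>ik\<in>?I. t ik * comparison_array s r p q ik \<omega>) \<partial>comparison_space n) =
      complex_of_real (exp (- (\<Sum>ik\<in>?I. \<Sum>jl\<in>?I. t ik * t jl * ?D ik jl) / 2))" for t
  proof -
    \<comment> \<open>The common pair sees the coefficients of a component summed over the row, each
      residual pair only its own; hence the exponential factorises over the product space.\<close>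
    define T where "T i = p i * (\<Sum>k\<in>{1..n}. t (i, k))" for i
    define S where "S i k = q i * t (i, k)" for i k
    let ?f = "\<lambda>x. iexp (T 1 * fst (correlated_pair s x) + T 2 * snd (correlated_pair s x))"
    let ?h = "\<lambda>k z. iexp (S 1 k * fst (correlated_pair r z) + S 2 k * snd (correlated_pair r z))"
    let ?g = "\<lambda>y. \<Prod>k\<in>{1..n}. ?h k (y k)"
    have eq: "iexp (\<Sum>ik\<in>?I. t ik * comparison_array s r p q ik \<omega>) = ?f (fst \<omega>) * ?g (snd \<omega>)" for \<omega>
    proof -
      have "(\<Sum>ik\<in>?I. t ik * comparison_array s r p q ik \<omega>) =
         (T 1 * fst (correlated_pair s (fst \<omega>)) + T 2 * snd (correlated_pair s (fst \<omega>))) +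
         (\<Sum>k\<in>{1..n}. S 1 k * fst (correlated_pair r (snd \<omega> k)) + S 2 k * snd (correlated_pair r (snd \<omega> k)))"
        unfolding sum_one_two[OF finite_atLeastAtMost] comparison_array_def T_def S_def coord_def
        by (simp add: sum.distrib sum_distrib_left sum_distrib_right algebra_simps)
      then show ?thesis
        by (simp only: of_real_add distrib_left exp_add of_real_sum sum_distrib_left exp_sum finite_atLeastAtMost)
    qed
    have hm: "(\<lambda>z. S 1 k * fst (correlated_pair r z) + S 2 k * snd (correlated_pair r z)) \<in> borel_measurable ?G" for k
      by measurable
    have hint: "integrable ?G (?h k)" for k
      by (rule GG.integrable_iexp_real[OF hm])
    have "integrable (comparison_space n) (\<lambda>\<omega>. iexp (\<Sum>ik\<in>?I. t ik * comparison_array s r p q ik \<omega>))"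
      unfolding comparison_space_def
      by (rule QP.integrable_iexp_real) (use meas in \<open>auto simp: comparison_space_def\<close>)
    then have "integrable (?G \<Otimes>\<^sub>M ?Q) (\<lambda>(x, y). ?f x * ?g y)"
      unfolding eq comparison_space_def case_prod_unfold .
    from QP.integral_pair_mult[OF this]
    have "(\<integral>\<omega>. iexp (\<Sum>ik\<in>?I. t ik * comparison_array s r p q ik \<omega>) \<partial>comparison_space n) = integral\<^sup>L ?G ?f * integral\<^sup>L ?Q ?g"
      unfolding eq comparison_space_def .
    also have "integral\<^sup>L ?Q ?g = (\<Prod>k\<in>{1..n}. integral\<^sup>L ?G (?h k))"
      by (rule product_sigma_finite.product_integral_prod[OF QS _ hint]) simp
    also have "integral\<^sup>L ?G ?f * (\<Prod>k\<in>{1..n}. integral\<^sup>L ?G (?h k)) =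
      complex_of_real (exp (- ((T 1)\<^sup>2 + 2 * s * T 1 * T 2 + (T 2)\<^sup>2) / 2) *
        (\<Prod>k\<in>{1..n}. exp (- ((S 1 k)\<^sup>2 + 2 * r * S 1 k * S 2 k + (S 2 k)\<^sup>2) / 2)))"
      unfolding integral_iexp_correlated_pair[OF s] integral_iexp_correlated_pair[OF r]
      by (simp only: of_real_mult of_real_prod)
    also have "exp (- ((T 1)\<^sup>2 + 2 * s * T 1 * T 2 + (T 2)\<^sup>2) / 2) *
        (\<Prod>k\<in>{1..n}. exp (- ((S 1 k)\<^sup>2 + 2 * r * S 1 k * S 2 k + (S 2 k)\<^sup>2) / 2)) =
      exp (- (\<Sum>ik\<in>?I. \<Sum>jl\<in>?I. t ik * t jl * ?D ik jl) / 2)"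
    proof -
      let ?W = "\<lambda>i j. \<Sum>k\<in>{1..n}. \<Sum>l\<in>{1..n}. t (i, k) * t (j, l)"
      have diag: "(\<Sum>l\<in>{1..n}. a l * (if k = l then c else 0)) = a k * c" if "k \<in> {1..n}" for a :: "nat \<Rightarrow> real" and c k
        using that by (subst sum.remove[of _ k]) (auto intro!: sum.neutral)
      have "(\<Sum>ik\<in>?I. \<Sum>jl\<in>?I. t ik * t jl * ?D ik jl) =
        (\<Sum>k\<in>{1..n}. \<Sum>l\<in>{1..n}.
          (t (1, k) * t (1, l) * (p 1 * p 1) + t (1, k) * t (1, l) * (if k = l then q 1 * q 1 else 0)) +
          (t (1, k) * t (2, l) * (p 1 * p 2 * s) + t (1, k) * t (2, l) * (if k = l then q 1 * q 2 * r else 0)) +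
          (t (2, k) * t (1, l) * (p 2 * p 1 * s) + t (2, k) * t (1, l) * (if k = l then q 2 * q 1 * r else 0)) +
          (t (2, k) * t (2, l) * (p 2 * p 2) + t (2, k) * t (2, l) * (if k = l then q 2 * q 2 else 0)))"
        unfolding sum_one_two[OF finite_atLeastAtMost] sum.distrib[symmetric]
        by (intro sum.cong refl) (auto simp: algebra_simps)
      also have "\<dots> = ?W 1 1 * (p 1 * p 1) + (\<Sum>k\<in>{1..n}. t (1, k) * t (1, k) * (q 1 * q 1)) +
          (?W 1 2 * (p 1 * p 2 * s) + (\<Sum>k\<in>{1..n}. t (1, k) * t (2, k) * (q 1 * q 2 * r))) +
          (?W 2 1 * (p 2 * p 1 * s) + (\<Sum>k\<in>{1..n}. t (2, k) * t (1, k) * (q 2 * q 1 * r))) +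
          (?W 2 2 * (p 2 * p 2) + (\<Sum>k\<in>{1..n}. t (2, k) * t (2, k) * (q 2 * q 2)))"
        unfolding sum.distrib sum_distrib_right
        by (intro arg_cong2[where f="(+)"] refl sum.cong diag)
      also have "\<dots> = (T 1)\<^sup>2 + 2 * s * T 1 * T 2 + (T 2)\<^sup>2 + (\<Sum>k\<in>{1..n}. (S 1 k)\<^sup>2 + 2 * r * S 1 k * S 2 k + (S 2 k)\<^sup>2)"
      proof -
        have W: "?W i j * (p i * p j * c) = c * T i * T j" for i j c
          unfolding T_def sum_product[symmetric] by (simp add: mult_ac)
        have S: "t (i, k) * t (j, k) * (q i * q j * c) = c * S i k * S j k" for i j k c
          unfolding S_def by (simp add: mult_ac)
        have W1: "?W i j * (p i * p j) = T i * T j" for i j using W[of i j 1] by simp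
        have S1: "t (i, k) * t (j, k) * (q i * q j) = S i k * S j k" for i j k using S[of i k j 1] by simp
        show ?thesis
          unfolding W W1 S S1 sum.distrib
          by (simp add: power2_eq_square mult_ac sum.distrib sum_distrib_left)
      qed
      finally have quad: "(\<Sum>ik\<in>?I. \<Sum>jl\<in>?I. t ik * t jl * ?D ik jl) =
        (T 1)\<^sup>2 + 2 * s * T 1 * T 2 + (T 2)\<^sup>2 + (\<Sum>k\<in>{1..n}. (S 1 k)\<^sup>2 + 2 * r * S 1 k * S 2 k + (S 2 k)\<^sup>2)" .
      have prod_exp: "(\<Prod>k\<in>{1..n}. exp (- a k / 2)) = exp (- (\<Sum>k\<in>{1..n}. a k) / 2)" for a :: "nat \<Rightarrow> real"
        by (simp add: exp_sum[symmetric] sum_negf sum_divide_distrib)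
      have mult_exp: "exp (- x / 2) * exp (- y / 2) = exp (- (x + y) / 2)" for x y :: real
        by (simp add: exp_add[symmetric] add_divide_distrib)
      show ?thesis unfolding quad prod_exp mult_exp ..
    qed
    finally show ?thesis .
  qed
  then show ?thesis
    unfolding gaussian_family_def using meas QP.prob_space_axioms
    by (simp add: comparison_space_def)
qed

lemma borel_measurable_binormal_cdf:
  fixes f g :: "'a \<Rightarrow> real"
  assumes [measurable]: "f \<in> borel_measurable M" "g \<in> borel_measurable M"
  shows "(\<lambda>x. binormal_cdf r (f x) (g x)) \<in> borel_measurable M"
proof -
  let ?P = "std_normal_pair"
  interpret G: prob_space std_normal_distribution by (rule prob_space_std_normal)
  interpret P: pair_prob_space std_normal_distribution std_normal_distribution ..
  have "(\<lambda>x. measure ?P {z \<in> space ?P. fst (correlated_pair r z) \<le> f x \<and> snd (correlated_pair r z) \<le> g x}) \<in> borel_measurable M"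
    by measurable
  then show ?thesis unfolding binormal_cdf_def by (simp add: space_std_normal_pair)
qed

text \<open>Given the common pair, the event says that \<open>n\<close> independent pairs lie in one
  and the same quadrant, whence the n-th power.\<close>

lemma comparison_array_box:
  assumes q: "0 < q 1" "0 < q (2::nat)"
  shows "measure (comparison_space n) {\<omega> \<in> space (comparison_space n).
      \<forall>ik\<in>{1, 2} \<times> {1..n}. comparison_array s r p q ik \<omega> \<le> u (fst ik)} =
    (\<integral>z. binormal_cdf r ((u 1 - p 1 * fst (correlated_pair s z)) / q 1) ((u 2 - p 2 * snd (correlated_pair s z)) / q 2) ^ n
      \<partial>std_normal_pair)"
proof -
  let ?G = "std_normal_pair"
  let ?Q = "\<Pi>\<^sub>M k\<in>{1..n}. ?G"
  interpret G: prob_space std_normal_distribution by (rule prob_space_std_normal)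
  interpret GG: pair_prob_space std_normal_distribution std_normal_distribution ..
  interpret Q: prob_space ?Q by (intro prob_space_PiM GG.prob_space_axioms)
  interpret QP: pair_prob_space ?G ?Q ..
  have QS: "product_sigma_finite (\<lambda>_::nat. ?G)" ..
  let ?A = "{\<omega> \<in> space (comparison_space n). \<forall>ik\<in>{1, 2} \<times> {1..n}. comparison_array s r p q ik \<omega> \<le> u (fst ik)}"
  define B where "B z = {z'. fst (correlated_pair r z') \<le> (u 1 - p 1 * fst (correlated_pair s z)) / q 1 \<and>
      snd (correlated_pair r z') \<le> (u 2 - p 2 * snd (correlated_pair s z)) / q 2}" for z
  have B: "B z \<in> sets ?G" for z unfolding B_def by (rule sets_correlated_pair_box)
  have A: "?A \<in> sets (?G \<Otimes>\<^sub>M ?Q)"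
  proof -
    have m: "comparison_array s r p q ik \<in> borel_measurable (?G \<Otimes>\<^sub>M ?Q)" if I: "ik \<in> {1, 2} \<times> {1..n}" for ik
    proof -
      obtain i k where ik: "ik = (i, k)" "k \<in> {1..n}" using I by (cases ik) auto
      have [measurable]: "(\<lambda>\<omega>. snd \<omega> k) \<in> ?G \<Otimes>\<^sub>M ?Q \<rightarrow>\<^sub>M ?G" using ik(2) by measurable
      show ?thesis unfolding ik comparison_array_def prod.case by measurable
    qed
    have "countable ({1, 2} \<times> {1..n} :: (nat \<times> nat) set)" by (rule countable_finite) simp
    then show ?thesis unfolding comparison_space_def
      by (intro sets.sets_Collect_countable_All' borel_measurable_le m borel_measurable_const)
  qed
  have "measure (comparison_space n) ?A = (\<integral>\<omega>. indicator ?A \<omega> \<partial>(?G \<Otimes>\<^sub>M ?Q))"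
    using sets.Int_space_eq2[OF A] unfolding comparison_space_def by simp
  also have "\<dots> = (\<integral>z. (\<integral>y. indicator ?A (z, y) \<partial>?Q) \<partial>?G)"
    by (rule QP.integral_fst'[symmetric], rule integrable_real_indicator[OF A])
      (simp only: infinity_ennreal_def less_top[symmetric] QP.emeasure_finite simp_thms)
  also have "\<dots> = (\<integral>z. measure ?G (B z) ^ n \<partial>?G)"
  proof (rule Bochner_Integration.integral_cong[OF refl])
    fix z assume z: "z \<in> space ?G"
    have "(\<integral>y. indicat_real ?A (z, y) \<partial>?Q) = (\<integral>y. indicat_real (\<Pi>\<^sub>E k\<in>{1..n}. B z) y \<partial>?Q)"
    proof (rule Bochner_Integration.integral_cong[OF refl])
      fix y assume y: "y \<in> space ?Q"
      have "(z, y) \<in> ?A \<longleftrightarrow> (\<forall>k\<in>{1..n}. y k \<in> B z)"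
      proof -
        have "(z, y) \<in> space (comparison_space n)"
          using y z unfolding comparison_space_def by (simp add: space_pair_measure)
        then have "(z, y) \<in> ?A \<longleftrightarrow> (\<forall>k\<in>{1..n}. comparison_array s r p q (1, k) (z, y) \<le> u 1 \<and> comparison_array s r p q (2, k) (z, y) \<le> u 2)"
          by auto
        also have "\<dots> \<longleftrightarrow> (\<forall>k\<in>{1..n}. y k \<in> B z)"
          unfolding comparison_array_def B_def coord_def using q by (auto simp: field_simps)
        finally show ?thesis .
      qed
      moreover have "y \<in> (\<Pi>\<^sub>E k\<in>{1..n}. B z) \<longleftrightarrow> (\<forall>k\<in>{1..n}. y k \<in> B z)"
        using y by (auto simp: space_PiM PiE_def)
      ultimately show "indicat_real ?A (z, y) = indicat_real (\<Pi>\<^sub>E k\<in>{1..n}. B z) y"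
        unfolding indicator_def by simp
    qed
    also have "\<dots> = measure ?Q ((\<Pi>\<^sub>E k\<in>{1..n}. B z) \<inter> space ?Q)" by simp
    also have "(\<Pi>\<^sub>E k\<in>{1..n}. B z) \<inter> space ?Q = (\<Pi>\<^sub>E k\<in>{1..n}. B z)"
      by (rule sets.Int_space_eq2, rule sets_PiM_I_finite, rule finite_atLeastAtMost, rule B)
    also have "measure ?Q (\<Pi>\<^sub>E k\<in>{1..n}. B z) = measure ?G (B z) ^ n"
    proof -
      have "emeasure ?Q (\<Pi>\<^sub>E k\<in>{1..n}. B z) = (\<Prod>k\<in>{1..n}. emeasure ?G (B z))"
        by (rule product_sigma_finite.emeasure_PiM[OF QS finite_atLeastAtMost B])
      then show ?thesis by (intro measure_eq_emeasure_eq_ennreal) (simp_all add: GG.emeasure_eq_measure ennreal_power)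
    qed
    finally show "(\<integral>y. indicat_real ?A (z, y) \<partial>?Q) = measure ?G (B z) ^ n" .
  qed
  finally show ?thesis unfolding B_def binormal_cdf_def .
qed

section \<open>Levels conditional on the common pair\<close>

text \<open>The conditional level is expressed as a value of \<open>norm_u n\<close>, so that the
  limit for moving levels applies.\<close>

definition rescaled_level :: "nat \<Rightarrow> real \<Rightarrow> real \<Rightarrow> real \<Rightarrow> real" where
  "rescaled_level n x v z = ((norm_u n x - sqrt v * z) / sqrt (1 - v) - norm_b n) / norm_a n"

lemma norm_u_rescaled_level:
  "2 \<le> n \<Longrightarrow> norm_u n (rescaled_level n x v z) = (norm_u n x - sqrt v * z) / sqrt (1 - v)"
  unfolding rescaled_level_def norm_u_def[of n "_ / _"] norm_a_def by simp

text \<open>The shift by \<tau> comes from dividing by q = sqrt (1 - v): the ratio of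
  \<open>norm_b\<close> to \<open>norm_a\<close> is \<open>B n\<close>, about 2 ln n, and 1 / q - 1
  = v / (q (1 + q)) is about v / 2, so their product tends to \<tau>. The standard deviation of the
  common part in units of \<open>norm_a\<close> is sqrt (2 v ln n), which tends to
  \<open>sqrt (2 * \<tau>)\<close>.\<close>

lemma rescaled_level_tendsto:
  assumes v: "(\<lambda>n. v n * ln (real n)) \<longlonglongrightarrow> \<tau>" and v0: "\<forall>\<^sub>F n in sequentially. 0 < v n \<and> v n < 1"
    and z: "z \<longlonglongrightarrow> \<zeta>"
  shows "(\<lambda>n. rescaled_level n x (v n) (z n)) \<longlonglongrightarrow> x + \<tau> - sqrt (2 * \<tau>) * \<zeta>"
proof -
  define B where "B n = 2 * ln (real n) - ln (4 * pi * ln n) / 2" for n :: nat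
  define q where "q n = sqrt (1 - v n)" for n
  note vlim = tendsto_0_if_mult_ln[OF v]
  have q: "q \<longlonglongrightarrow> sqrt (1 - 0)" unfolding q_def by (intro tendsto_intros vlim)
  have Bl: "(\<lambda>n. B n / ln n) \<longlonglongrightarrow> 2" unfolding B_def by real_asymp
  have "(\<lambda>n. (B n / ln n) * (v n * ln n) / (q n * (1 + q n)) + x / q n - sqrt (2 * (v n * ln n)) * z n / q n) \<longlonglongrightarrow>
      2 * \<tau> / (sqrt (1 - 0) * (1 + sqrt (1 - 0))) + x / sqrt (1 - 0) - sqrt (2 * \<tau>) * \<zeta> / sqrt (1 - 0)"
    by (intro tendsto_intros Bl v q z) auto
  moreover have "\<forall>\<^sub>F n in sequentially. (B n / ln n) * (v n * ln n) / (q n * (1 + q n)) + x / q n - sqrt (2 * (v n * ln n)) * z n / q n =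
      rescaled_level n x (v n) (z n)"
    using v0 eventually_ge_at_top[of 2]
  proof eventually_elim
    case (elim n)
    have ln: "0 < ln (real n)" using elim by simp
    define l where "l = sqrt (2 * ln n)"
    have l: "0 < l" "l * l = 2 * ln n" unfolding l_def using ln by auto
    have q0: "0 < q n" "q n * q n = 1 - v n" unfolding q_def using elim by auto
    have a: "norm_a n = 1 / l" unfolding norm_a_def l_def ..
    have b: "norm_b n = B n / l"
      unfolding norm_b_def B_def l_def[symmetric] l(2)[symmetric] using l(1) by (simp add: field_simps)
    have "sqrt (2 * (v n * ln n)) = l * sqrt (v n)" unfolding l_def real_sqrt_mult[symmetric] by (simp add: mult_ac)
    moreover have "(B n / ln n) * (v n * ln n) / (q n * (1 + q n)) = B n * (1 / q n - 1)"
    proof -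
      have "v n = (1 - q n) * (1 + q n)" using q0 by (simp add: algebra_simps)
      then have "(B n / ln n) * (v n * ln n) / (q n * (1 + q n)) = B n * (1 - q n) * (1 + q n) / (q n * (1 + q n))"
        using ln by simp
      also have "\<dots> = B n * (1 - q n) / q n" using q0(1) by (subst mult_divide_mult_cancel_right) auto
      also have "\<dots> = B n * (1 / q n - 1)" using q0(1) by (simp add: field_simps)
      finally show ?thesis .
    qed
    moreover have "rescaled_level n x (v n) (z n) = B n * (1 / q n - 1) + x / q n - l * sqrt (v n) * z n / q n"
      unfolding rescaled_level_def norm_u_def a b q_def[symmetric] using l q0(1) by (simp add: field_simps)
    ultimately show ?case by simp
  qed
  ultimately have "(\<lambda>n. rescaled_level n x (v n) (z n)) \<longlonglongrightarrow>
      2 * \<tau> / (sqrt (1 - 0) * (1 + sqrt (1 - 0))) + x / sqrt (1 - 0) - sqrt (2 * \<tau>) * \<zeta> / sqrt (1 - 0)"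
    by (rule Lim_transform_eventually)
  then show ?thesis by (simp add: add.commute)
qed

text \<open>All common pairs are functions of the same point \<open>z\<close>, so convergence of
  \<open>s\<close> makes the integrands converge at each \<open>z\<close>; they are bounded by
  1.\<close>

lemma comparison_array_limit:
  assumes v1: "(\<lambda>n. v1 n * ln (real n)) \<longlonglongrightarrow> \<tau>1" "\<forall>\<^sub>F n in sequentially. 0 < v1 n \<and> v1 n < 1"
    and v2: "(\<lambda>n. v2 n * ln (real n)) \<longlonglongrightarrow> \<tau>2" "\<forall>\<^sub>F n in sequentially. 0 < v2 n \<and> v2 n < 1"
    and s: "s \<longlonglongrightarrow> s0"
    and r: "\<And>n. \<bar>r n\<bar> \<le> 1" and L: "0 \<le> L"
    and lim: "(\<lambda>n. ereal ((1 - r n) * ln (real n))) \<longlonglongrightarrow> L\<^sup>2"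
  shows "(\<lambda>n. \<integral>z. binormal_cdf (r n) ((norm_u n x - sqrt (v1 n) * fst (correlated_pair (s n) z)) / sqrt (1 - v1 n))
        ((norm_u n y - sqrt (v2 n) * snd (correlated_pair (s n) z)) / sqrt (1 - v2 n)) ^ n
      \<partial>std_normal_pair) \<longlonglongrightarrow>
    (\<integral>z. huesler_reiss L (x + \<tau>1 - sqrt (2 * \<tau>1) * fst (correlated_pair s0 z)) (y + \<tau>2 - sqrt (2 * \<tau>2) * snd (correlated_pair s0 z))
      \<partial>std_normal_pair)"
proof -
  let ?G = "std_normal_pair"
  interpret G: prob_space std_normal_distribution by (rule prob_space_std_normal)
  interpret GG: pair_prob_space std_normal_distribution std_normal_distribution ..
  show ?thesis
  proof (rule integral_dominated_convergence[where w="\<lambda>_. 1"])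
    show "AE z in ?G. (\<lambda>n. binormal_cdf (r n) ((norm_u n x - sqrt (v1 n) * fst (correlated_pair (s n) z)) / sqrt (1 - v1 n))
        ((norm_u n y - sqrt (v2 n) * snd (correlated_pair (s n) z)) / sqrt (1 - v2 n)) ^ n) \<longlonglongrightarrow>
      huesler_reiss L (x + \<tau>1 - sqrt (2 * \<tau>1) * fst (correlated_pair s0 z)) (y + \<tau>2 - sqrt (2 * \<tau>2) * snd (correlated_pair s0 z))"
    proof (intro AE_I2)
      fix z :: "real \<times> real"
      have c: "(\<lambda>n. fst (correlated_pair (s n) z)) \<longlonglongrightarrow> fst (correlated_pair s0 z)"
        "(\<lambda>n. snd (correlated_pair (s n) z)) \<longlonglongrightarrow> snd (correlated_pair s0 z)"
        unfolding correlated_pair_def by (auto intro!: tendsto_intros s)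
      have "(\<lambda>n. binormal_cdf (r n) (norm_u n (rescaled_level n x (v1 n) (fst (correlated_pair (s n) z))))
          (norm_u n (rescaled_level n y (v2 n) (snd (correlated_pair (s n) z)))) ^ n) \<longlonglongrightarrow>
        huesler_reiss L (x + \<tau>1 - sqrt (2 * \<tau>1) * fst (correlated_pair s0 z)) (y + \<tau>2 - sqrt (2 * \<tau>2) * snd (correlated_pair s0 z))"
        by (intro binormal_power_tendsto r L lim rescaled_level_tendsto v1 v2 c)
      then show "(\<lambda>n. binormal_cdf (r n) ((norm_u n x - sqrt (v1 n) * fst (correlated_pair (s n) z)) / sqrt (1 - v1 n))
        ((norm_u n y - sqrt (v2 n) * snd (correlated_pair (s n) z)) / sqrt (1 - v2 n)) ^ n) \<longlonglongrightarrow>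
      huesler_reiss L (x + \<tau>1 - sqrt (2 * \<tau>1) * fst (correlated_pair s0 z)) (y + \<tau>2 - sqrt (2 * \<tau>2) * snd (correlated_pair s0 z))"
        by (rule Lim_transform_eventually)
          (use eventually_ge_at_top[of 2] in \<open>eventually_elim, simp add: norm_u_rescaled_level\<close>)
    qed
    show "(\<lambda>z. huesler_reiss L (x + \<tau>1 - sqrt (2 * \<tau>1) * fst (correlated_pair s0 z)) (y + \<tau>2 - sqrt (2 * \<tau>2) * snd (correlated_pair s0 z)))
      \<in> borel_measurable ?G"
      using measurable_compose[OF _ borel_measurable_huesler_reiss, of
        "\<lambda>z. (x + \<tau>1 - sqrt (2 * \<tau>1) * fst (correlated_pair s0 z), y + \<tau>2 - sqrt (2 * \<tau>2) * snd (correlated_pair s0 z))" ?G L]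
      by simp
    show "(\<lambda>z. binormal_cdf (r n) ((norm_u n x - sqrt (v1 n) * fst (correlated_pair (s n) z)) / sqrt (1 - v1 n))
        ((norm_u n y - sqrt (v2 n) * snd (correlated_pair (s n) z)) / sqrt (1 - v2 n)) ^ n) \<in> borel_measurable ?G" for n
      by (intro borel_measurable_power borel_measurable_binormal_cdf) measurable
    show "AE z in ?G. norm (binormal_cdf (r n) ((norm_u n x - sqrt (v1 n) * fst (correlated_pair (s n) z)) / sqrt (1 - v1 n))
        ((norm_u n y - sqrt (v2 n) * snd (correlated_pair (s n) z)) / sqrt (1 - v2 n)) ^ n) \<le> 1" for n
      using binormal_cdf_bounds by (intro AE_I2) (simp add: power_le_one)
  qed simp
qed

section \<open>Row means and mixtures of Huesler--Reiss distributions\<close>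

text \<open>The form is tested at (sqrt r, sqrt p) and (sqrt r, - sqrt p).\<close>

lemma psd_correlation_bound:
  fixes p q r :: real
  assumes psd: "\<And>a b. 0 \<le> a\<^sup>2 * p + 2 * a * b * q + b\<^sup>2 * r" and "0 < p" "0 < r"
  shows "\<bar>q / sqrt (p * r)\<bar> \<le> 1"
proof -
  have 1: "\<bar>q\<bar> \<le> sqrt p * sqrt r"
  proof -
    have sq: "sqrt p * sqrt p = p" "sqrt r * sqrt r = r" using assms by auto
    define c where "c = sqrt p * sqrt r"
    have c: "0 < c" "c * c = p * r" unfolding c_def using assms sq by (auto simp: algebra_simps)
    have "0 \<le> r * p + 2 * c * q + p * r" "0 \<le> r * p - 2 * c * q + p * r"
      using psd[of "sqrt r" "sqrt p"] psd[of "sqrt r" "- sqrt p"] assms unfolding c_def by (simp_all add: mult_ac)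
    moreover have "r * p = c * c" "p * r = c * c" "2 * c * q = 2 * (c * q)" using c(2) by (simp_all add: mult_ac)
    ultimately have "c * q \<le> c * c" "- (c * q) \<le> c * c" by linarith+
    then have "c * q \<le> c * c" "c * (- q) \<le> c * c" by (simp_all only: mult_minus_right)
    then have "q \<le> c" "- q \<le> c" using c(1) by (simp_all only: mult_le_cancel_left_pos)
    then show ?thesis unfolding c_def[symmetric] by linarith
  qed
  define S where "S = sqrt (p * r)"
  have "0 < S" "\<bar>q\<bar> \<le> S" unfolding S_def using assms 1 by (simp_all add: real_sqrt_mult)
  then show ?thesis unfolding S_def[symmetric] by simp
qed

text \<open>With g the square root, 1 - (r0 - v12) / g = ((1 - r0) + v12 - (1 - g)) / g and 1 - g =
  (v1 + v2 - v1 v2) / (1 + g). Multiplied by ln n, the terms v12 and 1 - g tend to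
  \<open>\<tau>12\<close> and \<open>(\<tau>1 + \<tau>2) / 2\<close>, which is the shift by
  \<open>\<tau>'\<close>. Equality in \<open>ge\<close> is allowed and leads to
  \<open>L' = 0\<close>.\<close>

lemma residual_correlation_tendsto:
  fixes r0 v1 v2 v12 :: "nat \<Rightarrow> real"
  assumes v1: "(\<lambda>n. v1 n * ln (real n)) \<longlonglongrightarrow> \<tau>1" "\<forall>\<^sub>F n in sequentially. 0 < v1 n \<and> v1 n < 1"
    and v2: "(\<lambda>n. v2 n * ln (real n)) \<longlonglongrightarrow> \<tau>2" "\<forall>\<^sub>F n in sequentially. 0 < v2 n \<and> v2 n < 1"
    and v12: "(\<lambda>n. v12 n * ln (real n)) \<longlonglongrightarrow> \<tau>12"
    and L: "0 \<le> L" and lim: "(\<lambda>n. ereal ((1 - r0 n) * ln (real n))) \<longlonglongrightarrow> L\<^sup>2"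
    and \<tau>': "\<tau>' = \<tau>12 - (\<tau>1 + \<tau>2) / 2" and ge: "L\<^sup>2 \<ge> ereal (- \<tau>')"
    and L': "L' = (if L = \<infinity> then \<infinity> else ereal (sqrt ((real_of_ereal L)\<^sup>2 + \<tau>')))"
  shows "(\<lambda>n. ereal ((1 - (r0 n - v12 n) / sqrt ((1 - v1 n) * (1 - v2 n))) * ln (real n))) \<longlonglongrightarrow> L'\<^sup>2" "0 \<le> L'"
proof -
  define g where "g n = sqrt ((1 - v1 n) * (1 - v2 n))" for n
  define b where "b n = v12 n * ln n - (v1 n * ln n + v2 n * ln n - v1 n * (v2 n * ln n)) / (1 + g n)" for n
  have "g \<longlonglongrightarrow> sqrt ((1 - 0) * (1 - 0))" unfolding g_def[abs_def]
    by (intro tendsto_intros tendsto_0_if_mult_ln[OF v1(1)] tendsto_0_if_mult_ln[OF v2(1)])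
  then have g: "g \<longlonglongrightarrow> 1" by simp
  have "b \<longlonglongrightarrow> \<tau>12 - (\<tau>1 + \<tau>2 - 0 * \<tau>2) / (1 + 1)" unfolding b_def[abs_def]
    by (intro tendsto_intros v12 v1(1) v2(1) g tendsto_0_if_mult_ln[OF v1(1)]) auto
  then have b: "b \<longlonglongrightarrow> \<tau>'" unfolding \<tau>' by simp
  have ev: "\<forall>\<^sub>F n in sequentially. ((1 - r0 n) * ln (real n) + b n) * (1 / g n) =
      (1 - (r0 n - v12 n) / sqrt ((1 - v1 n) * (1 - v2 n))) * ln (real n)"
    using v1(2) v2(2)
  proof eventually_elim
    case (elim n)
    have g0: "0 < g n" "g n * g n = (1 - v1 n) * (1 - v2 n)" unfolding g_def using elim by auto
    have "v1 n * ln n + v2 n * ln n - v1 n * (v2 n * ln n) = (1 - g n * g n) * ln n"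
      unfolding g0(2) by (simp add: algebra_simps)
    also have "\<dots> = (1 - g n) * ln n * (1 + g n)" by (simp add: algebra_simps)
    finally have "b n = v12 n * ln n - (1 - g n) * ln n" unfolding b_def using g0(1) by simp
    then show ?case unfolding g_def[symmetric] using g0(1) by (simp add: field_simps)
  qed
  have g1: "(\<lambda>n. 1 / g n) \<longlonglongrightarrow> 1 / 1" by (intro tendsto_intros g) simp
  have main: "(\<lambda>n. ereal ((1 - (r0 n - v12 n) / sqrt ((1 - v1 n) * (1 - v2 n))) * ln (real n))) \<longlonglongrightarrow> L'\<^sup>2 \<and> 0 \<le> L'"
  proof (cases L)
    case (real l)
    then have "(\<lambda>n. (1 - r0 n) * ln (real n)) \<longlonglongrightarrow> l\<^sup>2" using lim by simp
    then have "(\<lambda>n. ((1 - r0 n) * ln (real n) + b n) * (1 / g n)) \<longlonglongrightarrow> (l\<^sup>2 + \<tau>') * (1 / 1)"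
      by (intro tendsto_mult tendsto_add b g1)
    then have "(\<lambda>n. (1 - (r0 n - v12 n) / sqrt ((1 - v1 n) * (1 - v2 n))) * ln (real n)) \<longlonglongrightarrow> (l\<^sup>2 + \<tau>') * (1 / 1)"
      using ev by (rule Lim_transform_eventually)
    moreover have pos: "0 \<le> l\<^sup>2 + \<tau>'" using ge real by simp
    then have "L'\<^sup>2 = ereal (l\<^sup>2 + \<tau>')" unfolding L' real by simp
    ultimately show ?thesis using pos unfolding L' real by simp
  next
    case PInf
    then have "filterlim (\<lambda>n. (1 - r0 n) * ln (real n)) at_top sequentially"
      using lim by (simp add: tendsto_PInfty_eq_at_top power2_eq_square)
    from filterlim_tendsto_add_at_top[OF b this]
    have "filterlim (\<lambda>n. (1 - r0 n) * ln (real n) + b n) at_top sequentially" by (simp add: add.commute)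
    from filterlim_tendsto_pos_mult_at_top[OF g1 _ this]
    have "filterlim (\<lambda>n. ((1 - r0 n) * ln (real n) + b n) * (1 / g n)) at_top sequentially" by (simp add: mult.commute)
    then have "filterlim (\<lambda>n. (1 - (r0 n - v12 n) / sqrt ((1 - v1 n) * (1 - v2 n))) * ln (real n)) at_top sequentially"
      by (subst (asm) filterlim_cong[OF refl refl ev])
    then show ?thesis unfolding L' using PInf by (simp add: tendsto_PInfty_eq_at_top power2_eq_square)
  qed (use L in simp)
  from main show "(\<lambda>n. ereal ((1 - (r0 n - v12 n) / sqrt ((1 - v1 n) * (1 - v2 n))) * ln (real n))) \<longlonglongrightarrow> L'\<^sup>2" "0 \<le> L'"
    by auto
qed

lemma huesler_reiss_commute: "huesler_reiss L x y = huesler_reiss L y x"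
  unfolding huesler_reiss_eq huesler_reiss_exponent_def Let_def by (simp add: max.commute add.commute)

text \<open>By \<open>huesler_reiss_integral\<close> the exponent minus \<open>exp (- y)\<close> is
  the integral of a nonnegative function; the two extreme parameters are immediate.\<close>

lemma huesler_reiss_le_gumbel:
  assumes L: "0 \<le> L"
  shows "huesler_reiss L x y \<le> exp (- exp (- y))"
proof -
  have "exp (- y) \<le> huesler_reiss_exponent L x y"
  proof (cases "L = 0 \<or> L = \<infinity>")
    case False
    define l where "l = real_of_ereal L"
    have l: "0 < l" unfolding l_def using L False by (cases L) (auto simp: zero_ereal_def le_less)
    have "0 \<le> (\<integral>s. exp (- s) * indicator {x<..} s * std_normal_cdf (l + (y - s) / (2 * l)) \<partial>lborel)"
      by (intro integral_nonneg_AE AE_I2 mult_nonneg_nonneg std_normal_cdf_bounds) auto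
    then show ?thesis using False unfolding huesler_reiss_integral[OF l] huesler_reiss_exponent_def
      by (simp add: Let_def l_def)
  qed (auto simp: huesler_reiss_exponent_def)
  then show ?thesis unfolding huesler_reiss_eq by simp
qed

section \<open>Regularity of the mixture\<close>

text \<open>Realised on the standard pair instead of on the space of \<open>Z\<close> and
  \<open>W\<close>, so that it is directly comparable with integrals over the common pair.\<close>

definition huesler_reiss_mixture :: "ereal \<Rightarrow> real \<Rightarrow> real \<Rightarrow> real \<Rightarrow> real \<Rightarrow> real \<Rightarrow> real" where
  "huesler_reiss_mixture L t1 t2 s x y =
    (\<integral>z. huesler_reiss L (x + t1 - sqrt (2 * t1) * fst (correlated_pair s z)) (y + t2 - sqrt (2 * t2) * snd (correlated_pair s z))
      \<partial>std_normal_pair)"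

lemma borel_measurable_huesler_reiss_comp:
  assumes [measurable]: "f \<in> borel_measurable M" "g \<in> borel_measurable M"
  shows "(\<lambda>z. huesler_reiss L (f z) (g z)) \<in> borel_measurable M"
  using measurable_compose[OF _ borel_measurable_huesler_reiss, of "\<lambda>z. (f z, g z)" M L] by simp

lemma huesler_reiss_mixture_tendsto:
  assumes L: "0 \<le> L"
    and lim: "\<And>z. (\<lambda>n. huesler_reiss L (xs n + t1 - sqrt (2 * t1) * fst (correlated_pair s z)) (ys n + t2 - sqrt (2 * t2) * snd (correlated_pair s z)))
      \<longlonglongrightarrow> h z"
    and [measurable]: "h \<in> borel_measurable std_normal_pair"
  shows "(\<lambda>n. huesler_reiss_mixture L t1 t2 s (xs n) (ys n)) \<longlonglongrightarrow> integral\<^sup>L std_normal_pair h"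
proof -
  interpret G: prob_space std_normal_distribution by (rule prob_space_std_normal)
  interpret GG: pair_prob_space std_normal_distribution std_normal_distribution ..
  show ?thesis unfolding huesler_reiss_mixture_def
  proof (rule integral_dominated_convergence[where w="\<lambda>_. 1"])
    show "(\<lambda>z. huesler_reiss L (xs n + t1 - sqrt (2 * t1) * fst (correlated_pair s z)) (ys n + t2 - sqrt (2 * t2) * snd (correlated_pair s z)))
      \<in> borel_measurable std_normal_pair" for n
      by (intro borel_measurable_huesler_reiss_comp) measurable
  qed (auto simp: lim huesler_reiss_bounds[OF L])
qed

lemma continuous_huesler_reiss_mixture:
  assumes L: "0 \<le> L"
  shows "continuous_on UNIV (\<lambda>z. huesler_reiss_mixture L t1 t2 s (fst z) (snd z))"
  unfolding continuous_on_sequentially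
proof (intro allI ballI impI)
  fix f and a :: "real \<times> real" assume "(\<forall>n. f n \<in> UNIV) \<and> f \<longlonglongrightarrow> a"
  then have f: "f \<longlonglongrightarrow> a" by simp
  have "(\<lambda>n. huesler_reiss_mixture L t1 t2 s (fst (f n)) (snd (f n))) \<longlonglongrightarrow> huesler_reiss_mixture L t1 t2 s (fst a) (snd a)"
    unfolding huesler_reiss_mixture_def[of L t1 t2 s "fst a" "snd a"]
    by (intro huesler_reiss_mixture_tendsto[OF L] tendsto_huesler_reiss L tendsto_intros f
        borel_measurable_huesler_reiss_comp) measurable
  then show "((\<lambda>z. huesler_reiss_mixture L t1 t2 s (fst z) (snd z)) \<circ> f) \<longlonglongrightarrow> huesler_reiss_mixture L t1 t2 s (fst a) (snd a)"
    by (simp add: comp_def)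
qed

text \<open>The distribution function is at most the Gumbel function of either argument, which
  vanishes as that argument tends to minus infinity; dominated convergence carries this through the
  mixture.\<close>

lemma huesler_reiss_mixture_small:
  assumes L: "0 \<le> L" and e: "0 < e"
  shows "\<exists>a. huesler_reiss_mixture L t1 t2 s a B \<le> e \<and> huesler_reiss_mixture L t1 t2 s B a \<le> e"
proof -
  have g: "(\<lambda>k. exp (- exp (- (- real k + c)))) \<longlonglongrightarrow> 0" for c by real_asymp
  have "(\<lambda>k. huesler_reiss_mixture L t1 t2 s B (- real k)) \<longlonglongrightarrow> integral\<^sup>L std_normal_pair (\<lambda>_. 0)"
  proof (rule huesler_reiss_mixture_tendsto[OF L])
    fix z
    show "(\<lambda>n. huesler_reiss L (B + t1 - sqrt (2 * t1) * fst (correlated_pair s z)) (- real n + t2 - sqrt (2 * t2) * snd (correlated_pair s z))) \<longlonglongrightarrow> 0"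
    proof (rule Lim_null_comparison[OF _ g[of "t2 - sqrt (2 * t2) * snd (correlated_pair s z)"]], intro always_eventually allI)
      fix n
      show "norm (huesler_reiss L (B + t1 - sqrt (2 * t1) * fst (correlated_pair s z)) (- real n + t2 - sqrt (2 * t2) * snd (correlated_pair s z))) \<le>
          exp (- exp (- (- real n + (t2 - sqrt (2 * t2) * snd (correlated_pair s z)))))"
        unfolding add_diff_eq real_norm_def abs_of_nonneg[OF huesler_reiss_bounds(1)[OF L]]
        by (rule huesler_reiss_le_gumbel[OF L])
    qed
  qed simp
  then have 1: "\<forall>\<^sub>F k in sequentially. huesler_reiss_mixture L t1 t2 s B (- real k) < e"
    using e by (intro order_tendstoD(2)) auto
  have "(\<lambda>k. huesler_reiss_mixture L t1 t2 s (- real k) B) \<longlonglongrightarrow> integral\<^sup>L std_normal_pair (\<lambda>_. 0)"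
  proof (rule huesler_reiss_mixture_tendsto[OF L])
    fix z
    show "(\<lambda>n. huesler_reiss L (- real n + t1 - sqrt (2 * t1) * fst (correlated_pair s z)) (B + t2 - sqrt (2 * t2) * snd (correlated_pair s z))) \<longlonglongrightarrow> 0"
      unfolding huesler_reiss_commute[of L _ "B + _ - _"]
    proof (rule Lim_null_comparison[OF _ g[of "t1 - sqrt (2 * t1) * fst (correlated_pair s z)"]], intro always_eventually allI)
      fix n
      show "norm (huesler_reiss L (B + t2 - sqrt (2 * t2) * snd (correlated_pair s z)) (- real n + t1 - sqrt (2 * t1) * fst (correlated_pair s z))) \<le>
          exp (- exp (- (- real n + (t1 - sqrt (2 * t1) * fst (correlated_pair s z)))))"
        unfolding add_diff_eq real_norm_def abs_of_nonneg[OF huesler_reiss_bounds(1)[OF L]]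
        by (rule huesler_reiss_le_gumbel[OF L])
    qed
  qed simp
  then have 2: "\<forall>\<^sub>F k in sequentially. huesler_reiss_mixture L t1 t2 s (- real k) B < e"
    using e by (intro order_tendstoD(2)) auto
  from eventually_conj[OF 1 2] show ?thesis
    unfolding eventually_sequentially by (meson less_imp_le order_refl)
qed

text \<open>The double sum is the second moment of the sum of the \<open>T k\<close>, and the second
  moment of \<open>T k - T l\<close> being nonnegative bounds each mixed moment by the common value
  \<open>V\<close>.\<close>

lemma (in prob_space) covariance_sum_bounds:
  fixes T :: "'k \<Rightarrow> 'a \<Rightarrow> real"
  assumes int: "\<And>k l. k \<in> A \<Longrightarrow> l \<in> A \<Longrightarrow> integrable M (\<lambda>\<omega>. T k \<omega> * T l \<omega>)"
    and V: "\<And>k. k \<in> A \<Longrightarrow> expectation (\<lambda>\<omega>. T k \<omega> * T k \<omega>) = V"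
  shows "0 \<le> (\<Sum>k\<in>A. \<Sum>l\<in>A. expectation (\<lambda>\<omega>. T k \<omega> * T l \<omega>))"
    "(\<Sum>k\<in>A. \<Sum>l\<in>A. expectation (\<lambda>\<omega>. T k \<omega> * T l \<omega>)) \<le> (real (card A))\<^sup>2 * V"
proof -
  have "(\<Sum>k\<in>A. \<Sum>l\<in>A. expectation (\<lambda>\<omega>. T k \<omega> * T l \<omega>)) = expectation (\<lambda>\<omega>. \<Sum>k\<in>A. \<Sum>l\<in>A. T k \<omega> * T l \<omega>)"
    using int by (simp add: Bochner_Integration.integral_sum)
  also have "\<dots> = expectation (\<lambda>\<omega>. (\<Sum>k\<in>A. T k \<omega>)\<^sup>2)" by (simp add: power2_eq_square sum_product)
  also have "0 \<le> \<dots>" by simp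
  finally show "0 \<le> (\<Sum>k\<in>A. \<Sum>l\<in>A. expectation (\<lambda>\<omega>. T k \<omega> * T l \<omega>))" .
  have "expectation (\<lambda>\<omega>. T k \<omega> * T l \<omega>) \<le> V" if k: "k \<in> A" and l: "l \<in> A" for k l
  proof -
    note i = int[OF k k] int[OF k l] int[OF l l]
    have "0 \<le> expectation (\<lambda>\<omega>. (T k \<omega> - T l \<omega>)\<^sup>2)" by simp
    also have "(\<lambda>\<omega>. (T k \<omega> - T l \<omega>)\<^sup>2) = (\<lambda>\<omega>. T k \<omega> * T k \<omega> - 2 * (T k \<omega> * T l \<omega>) + T l \<omega> * T l \<omega>)"
      by (auto simp: power2_eq_square algebra_simps)
    also have "expectation \<dots> = V - 2 * expectation (\<lambda>\<omega>. T k \<omega> * T l \<omega>) + V"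
      using i V[OF k] V[OF l] by simp
    finally show ?thesis by simp
  qed
  then have "(\<Sum>k\<in>A. \<Sum>l\<in>A. expectation (\<lambda>\<omega>. T k \<omega> * T l \<omega>)) \<le> (\<Sum>k\<in>A. \<Sum>l\<in>A. V)"
    by (intro sum_mono)
  then show "(\<Sum>k\<in>A. \<Sum>l\<in>A. expectation (\<lambda>\<omega>. T k \<omega> * T l \<omega>)) \<le> (real (card A))\<^sup>2 * V"
    by (simp add: power2_eq_square)
qed

section \<open>Covariances of a row and of its means\<close>

locale gaussian_array = prob_space M for M :: "'a measure" +
  fixes X :: "nat \<Rightarrow> nat \<Rightarrow> nat \<Rightarrow> 'a \<Rightarrow> real" and \<rho>\<^sub>0 :: "nat \<Rightarrow> real" and \<rho> :: "nat \<Rightarrow> nat \<Rightarrow> nat \<Rightarrow> nat \<Rightarrow> real"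
  assumes array: "bivariate_gaussian_array M X \<rho>\<^sub>0 \<rho>"
begin

definition row_cov :: "nat \<Rightarrow> nat \<times> nat \<Rightarrow> nat \<times> nat \<Rightarrow> real" where
  "row_cov n = (\<lambda>(i, k) (j, l). \<integral>\<omega>. X n i k \<omega> * X n j l \<omega> \<partial>M)"

lemma
  assumes n: "1 \<le> n"
  shows row_family: "gaussian_family M ({1, 2} \<times> {1..n}) (\<lambda>(i, k). X n i k) (row_cov n)"
    and row_integrable: "\<And>i j k l. i \<in> {1, 2} \<Longrightarrow> j \<in> {1, 2} \<Longrightarrow> k \<in> {1..n} \<Longrightarrow> l \<in> {1..n} \<Longrightarrow>
      integrable M (\<lambda>\<omega>. X n i k \<omega> * X n j l \<omega>)"
    and row_cov_diag: "\<And>i k. i \<in> {1, 2} \<Longrightarrow> k \<in> {1..n} \<Longrightarrow> row_cov n (i, k) (i, k) = 1"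
    and row_cov_same: "\<And>k. k \<in> {1..n} \<Longrightarrow> row_cov n (1, k) (2, k) = \<rho>\<^sub>0 n"
    and row_cov_lag: "\<And>i j k l. i \<in> {1, 2} \<Longrightarrow> j \<in> {1, 2} \<Longrightarrow> k \<in> {1..n} \<Longrightarrow> l \<in> {1..n} \<Longrightarrow> k \<noteq> l \<Longrightarrow>
      row_cov n (i, k) (j, l) = \<rho> i j (nat \<bar>int k - int l\<bar>) n"
proof -
  let ?I = "{1, 2} \<times> {1..n}" and ?X = "\<lambda>(i, k). X n i k"
  have J: "jointly_gaussian M ?I ?X"
    and mv: "\<And>i k. i \<in> {1, 2} \<Longrightarrow> k \<in> {1..n} \<Longrightarrow> expectation (X n i k) = 0 \<and> variance (X n i k) = 1"
    and same: "\<And>k. k \<in> {1..n} \<Longrightarrow> correlation M (X n 1 k) (X n 2 k) = \<rho>\<^sub>0 n"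
    and lag: "\<And>i j k l. i \<in> {1, 2} \<Longrightarrow> j \<in> {1, 2} \<Longrightarrow> k \<in> {1..n} \<Longrightarrow> l \<in> {1..n} \<Longrightarrow> k \<noteq> l \<Longrightarrow>
      correlation M (X n i k) (X n j l) = \<rho> i j (nat \<bar>int k - int l\<bar>) n"
    using array[unfolded bivariate_gaussian_array_def, rule_format, OF n] by blast+
  have mean: "expectation (?X ik) = 0" and var: "variance (?X ik) = 1" if I: "ik \<in> ?I" for ik
  proof -
    obtain i k where ik: "ik = (i, k)" "i \<in> {1, 2}" "k \<in> {1..n}" using I by (cases ik) auto
    show "expectation (?X ik) = 0" "variance (?X ik) = 1"
      using mv[OF ik(2,3)] unfolding ik(1) prod.case by (rule conjunct1, rule conjunct2)
  qed
  note G = jointly_gaussian_imp_gaussian_family[OF prob_space_axioms J mean var]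
  have C: "(\<lambda>ik jl. \<integral>\<omega>. ?X ik \<omega> * ?X jl \<omega> \<partial>M) = row_cov n"
    unfolding row_cov_def by (auto simp: fun_eq_iff)
  show "gaussian_family M ?I ?X (row_cov n)" using G(1) unfolding C .
  show "integrable M (\<lambda>\<omega>. X n i k \<omega> * X n j l \<omega>)" if "i \<in> {1, 2}" "j \<in> {1, 2}" "k \<in> {1..n}" "l \<in> {1..n}" for i j k l
    using G(2)[of "(i, k)" "(j, l)"] that by simp
  show "row_cov n (i, k) (i, k) = 1" if "i \<in> {1, 2}" "k \<in> {1..n}" for i k
    using G(3)[of "(i, k)"] that by (simp add: row_cov_def)
  have corr: "row_cov n (i, k) (j, l) = correlation M (X n i k) (X n j l)"
    if "i \<in> {1, 2}" "j \<in> {1, 2}" "k \<in> {1..n}" "l \<in> {1..n}" for i j k l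
    using G(4)[of "(i, k)" "(j, l)"] that by (simp add: row_cov_def)
  show "row_cov n (1, k) (2, k) = \<rho>\<^sub>0 n" if "k \<in> {1..n}" for k
    using corr[of 1 2 k k] same[OF that] that by simp
  show "row_cov n (i, k) (j, l) = \<rho> i j (nat \<bar>int k - int l\<bar>) n"
    if "i \<in> {1, 2}" "j \<in> {1, 2}" "k \<in> {1..n}" "l \<in> {1..n}" "k \<noteq> l" for i j k l
    using corr[OF that(1-4)] lag[OF that] by simp
qed

lemma row_cov_commute: "row_cov n ik jl = row_cov n jl ik"
  unfolding row_cov_def by (cases ik, cases jl) (simp add: mult.commute)

definition mean_cov :: "nat \<Rightarrow> nat \<Rightarrow> nat \<Rightarrow> real" where
  "mean_cov n i j = (\<Sum>k=1..n. \<Sum>l=1..n. row_cov n (i, k) (j, l)) / (real n)\<^sup>2"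

lemma mean_cov_commute: "mean_cov n i j = mean_cov n j i"
  unfolding mean_cov_def by (subst sum.swap) (simp add: row_cov_commute)

text \<open>Averaging is a contraction, so the covariance matrix of the row means is dominated by that of
  a single pair.\<close>

lemma mean_cov_psd:
  assumes n: "1 \<le> n"
  shows "0 \<le> a\<^sup>2 * mean_cov n 1 1 + 2 * a * b * mean_cov n 1 2 + b\<^sup>2 * mean_cov n 2 2"
    "0 \<le> a\<^sup>2 * (1 - mean_cov n 1 1) + 2 * a * b * (\<rho>\<^sub>0 n - mean_cov n 1 2) + b\<^sup>2 * (1 - mean_cov n 2 2)"
proof -
  \<comment> \<open>A fixed linear functional of each pair, with second moment a^2 + 2 a b
    \<open>\<rho>\<^sub>0 n\<close> + b^2. The two bounds of \<open>covariance_sum_bounds\<close>,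
    divided by n^2, are the two quadratic forms claimed.\<close>
  define T where "T k \<omega> = a * X n 1 k \<omega> + b * X n 2 k \<omega>" for k \<omega>
  define Q where "Q = a\<^sup>2 * mean_cov n 1 1 + 2 * a * b * mean_cov n 1 2 + b\<^sup>2 * mean_cov n 2 2"
  have TT: "T k \<omega> * T l \<omega> = a\<^sup>2 * (X n 1 k \<omega> * X n 1 l \<omega>) + a * b * (X n 1 k \<omega> * X n 2 l \<omega>) +
      a * b * (X n 2 k \<omega> * X n 1 l \<omega>) + b\<^sup>2 * (X n 2 k \<omega> * X n 2 l \<omega>)" for k l \<omega>
    unfolding T_def by (simp add: power2_eq_square algebra_simps)
  have int: "integrable M (\<lambda>\<omega>. T k \<omega> * T l \<omega>)" if "k \<in> {1..n}" "l \<in> {1..n}" for k l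
    unfolding TT using that by (intro Bochner_Integration.integrable_add integrable_mult_right row_integrable[OF n]) auto
  have ET: "expectation (\<lambda>\<omega>. T k \<omega> * T l \<omega>) = a\<^sup>2 * row_cov n (1, k) (1, l) + a * b * row_cov n (1, k) (2, l) +
      a * b * row_cov n (2, k) (1, l) + b\<^sup>2 * row_cov n (2, k) (2, l)" if kl: "k \<in> {1..n}" "l \<in> {1..n}" for k l
  proof -
    have i: "integrable M (\<lambda>\<omega>. X n i k \<omega> * X n j l \<omega>)" if "i \<in> {1, 2}" "j \<in> {1, 2}" for i j
      using that kl by (intro row_integrable[OF n]) auto
    note [simp] = i[of 1 1] i[of 1 2] i[of 2 1] i[of 2 2]
    show ?thesis unfolding TT row_cov_def by (simp del: One_nat_def)
  qed
  have V: "expectation (\<lambda>\<omega>. T k \<omega> * T k \<omega>) = a\<^sup>2 + 2 * a * b * \<rho>\<^sub>0 n + b\<^sup>2" if "k \<in> {1..n}" for k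
    using ET[OF that that] row_cov_diag[OF n _ that] row_cov_same[OF n that] row_cov_commute[of n "(2, k)" "(1, k)"] by simp
  have n2: "0 < (real n)\<^sup>2" using n by simp
  have sum: "(\<Sum>k=1..n. \<Sum>l=1..n. expectation (\<lambda>\<omega>. T k \<omega> * T l \<omega>)) = (real n)\<^sup>2 * Q"
  proof -
    have mc: "(\<Sum>k=1..n. \<Sum>l=1..n. row_cov n (i, k) (j, l)) = (real n)\<^sup>2 * mean_cov n i j" for i j
      using n2 unfolding mean_cov_def by simp
    have "(\<Sum>k=1..n. \<Sum>l=1..n. expectation (\<lambda>\<omega>. T k \<omega> * T l \<omega>)) =
        a\<^sup>2 * ((real n)\<^sup>2 * mean_cov n 1 1) + a * b * ((real n)\<^sup>2 * mean_cov n 1 2) +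
        a * b * ((real n)\<^sup>2 * mean_cov n 2 1) + b\<^sup>2 * ((real n)\<^sup>2 * mean_cov n 2 2)"
      unfolding mc[symmetric] sum_distrib_left sum.distrib[symmetric] by (intro sum.cong refl ET)
    also have "\<dots> = (real n)\<^sup>2 * (a\<^sup>2 * mean_cov n 1 1 + a * b * mean_cov n 1 2 + a * b * mean_cov n 2 1 + b\<^sup>2 * mean_cov n 2 2)"
      by (simp add: algebra_simps)
    finally have "(\<Sum>k=1..n. \<Sum>l=1..n. expectation (\<lambda>\<omega>. T k \<omega> * T l \<omega>)) = \<dots>" .
    then show ?thesis unfolding Q_def using mean_cov_commute[of n 2 1] by simp
  qed
  have "0 \<le> (real n)\<^sup>2 * Q" "(real n)\<^sup>2 * Q \<le> (real n)\<^sup>2 * (a\<^sup>2 + 2 * a * b * \<rho>\<^sub>0 n + b\<^sup>2)"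
    using covariance_sum_bounds[where A="{1..n}" and T=T, OF int V] unfolding sum by simp_all
  then have "0 \<le> Q" "Q \<le> a\<^sup>2 + 2 * a * b * \<rho>\<^sub>0 n + b\<^sup>2"
    using n2 by (simp_all add: zero_le_mult_iff)
  then show "0 \<le> a\<^sup>2 * mean_cov n 1 1 + 2 * a * b * mean_cov n 1 2 + b\<^sup>2 * mean_cov n 2 2"
    "0 \<le> a\<^sup>2 * (1 - mean_cov n 1 1) + 2 * a * b * (\<rho>\<^sub>0 n - mean_cov n 1 2) + b\<^sup>2 * (1 - mean_cov n 2 2)"
    unfolding Q_def by (simp_all add: algebra_simps)
qed

lemma mean_cov_eq:
  assumes n: "1 \<le> n" and ij: "i \<in> {1, 2}" "j \<in> {1, 2}"
  shows "mean_cov n i j = (if i = j then 1 else \<rho>\<^sub>0 n) / n + 2 / n\<^sup>2 * (\<Sum>m\<in>{1..<n}. (real n - real m) * \<rho> i j m n)"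
proof -
  have d: "row_cov n (i, k) (j, k) = (if i = j then 1 else \<rho>\<^sub>0 n)" if "k \<in> {1..n}" for k
    using ij row_cov_diag[OF n _ that] row_cov_same[OF n that] row_cov_commute[of n "(2, k)" "(1, k)"] by auto
  have "(\<Sum>k=1..n. \<Sum>l=1..n. row_cov n (i, k) (j, l)) =
      (\<Sum>k=1..n. (if i = j then 1 else \<rho>\<^sub>0 n) + (\<Sum>l\<in>{1..n} - {k}. \<rho> i j (nat \<bar>int k - int l\<bar>) n))"
  proof (rule sum.cong[OF refl])
    fix k assume k: "k \<in> {1..n}"
    have "(\<Sum>l=1..n. row_cov n (i, k) (j, l)) = row_cov n (i, k) (j, k) + (\<Sum>l\<in>{1..n} - {k}. row_cov n (i, k) (j, l))"
      using k by (intro sum.remove) auto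
    also have "(\<Sum>l\<in>{1..n} - {k}. row_cov n (i, k) (j, l)) = (\<Sum>l\<in>{1..n} - {k}. \<rho> i j (nat \<bar>int k - int l\<bar>) n)"
      using k ij by (intro sum.cong refl row_cov_lag[OF n]) auto
    finally show "(\<Sum>l=1..n. row_cov n (i, k) (j, l)) = (if i = j then 1 else \<rho>\<^sub>0 n) + (\<Sum>l\<in>{1..n} - {k}. \<rho> i j (nat \<bar>int k - int l\<bar>) n)"
      unfolding d[OF k] .
  qed
  also have "\<dots> = n * (if i = j then 1 else \<rho>\<^sub>0 n) + 2 * (\<Sum>m\<in>{1..<n}. (real n - real m) * \<rho> i j m n)"
    unfolding sum.distrib sum_over_lags[of "\<lambda>m. \<rho> i j m n"] by simp
  finally show ?thesis unfolding mean_cov_def using n by (simp add: add_divide_distrib power2_eq_square)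
qed

lemma \<rho>\<^sub>0_bound: "1 \<le> n \<Longrightarrow> \<bar>\<rho>\<^sub>0 n\<bar> \<le> 1"
proof -
  assume n: "1 \<le> n"
  \<comment> \<open>The two forms of \<open>mean_cov_psd\<close> add up to the form of the pair
    itself.\<close>
  have 1: "0 \<le> a\<^sup>2 * 1 + 2 * a * b * \<rho>\<^sub>0 n + b\<^sup>2 * 1" for a b
    using mean_cov_psd[OF n, of a b] by (simp add: algebra_simps)
  from psd_correlation_bound[OF 1] show ?thesis by simp
qed

text \<open>Guarantees that the set over which \<open>\<delta>\<close> is a supremum is bounded
  above, without which the supremum would say nothing about its members. Lag \<open>k\<close> is
  realised by the entries 1 and \<open>Suc k\<close>.\<close>

lemma \<rho>_bound:
  assumes "1 \<le> k" "k < n" "i \<in> {1, 2}" "j \<in> {1, 2}"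
  shows "\<bar>\<rho> i j k n\<bar> \<le> 1"
proof -
  have n: "1 \<le> n" using assms by simp
  have quad: "0 \<le> a\<^sup>2 * 1 + 2 * a * b * row_cov n (i, p) (j, l) + b\<^sup>2 * 1" if p: "p \<in> {1..n}" and l: "l \<in> {1..n}" for a b p l
  proof -
    note [simp] = row_integrable[OF n assms(3,3) p p] row_integrable[OF n assms(3,4) p l] row_integrable[OF n assms(4,4) l l]
    have e: "(a * X n i p \<omega> + b * X n j l \<omega>)\<^sup>2 = a\<^sup>2 * (X n i p \<omega> * X n i p \<omega>) +
        2 * a * b * (X n i p \<omega> * X n j l \<omega>) + b\<^sup>2 * (X n j l \<omega> * X n j l \<omega>)" for \<omega>
      by (simp add: power2_eq_square algebra_simps)
    have "0 \<le> expectation (\<lambda>\<omega>. (a * X n i p \<omega> + b * X n j l \<omega>)\<^sup>2)" by simp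
    also have "\<dots> = a\<^sup>2 * row_cov n (i, p) (i, p) + 2 * a * b * row_cov n (i, p) (j, l) + b\<^sup>2 * row_cov n (j, l) (j, l)"
      unfolding e row_cov_def by simp
    finally show ?thesis using row_cov_diag[OF n assms(3) p] row_cov_diag[OF n assms(4) l] by simp
  qed
  have k: "1 \<in> {1..n}" "Suc k \<in> {1..n}" using assms by auto
  have "row_cov n (i, 1) (j, Suc k) = \<rho> i j k n"
    using row_cov_lag[OF n assms(3,4) k] assms(1) by simp
  with quad[OF k] have "0 \<le> a\<^sup>2 * 1 + 2 * a * b * \<rho> i j k n + b\<^sup>2 * 1" for a b by simp
  from psd_correlation_bound[OF this] show ?thesis by simp
qed

end

text \<open>Lag zero contributes nothing, also between the two components, because the arrays agree
  there; for a pair of components lag \<open>m\<close> occurs 2 (n - m) times, at most 2 n.\<close>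

lemma sum_array_lags_le:
  fixes h :: "nat \<times> nat \<Rightarrow> nat \<times> nat \<Rightarrow> real"
  assumes h: "\<And>i j k l. i \<in> {1, 2} \<Longrightarrow> j \<in> {1, 2} \<Longrightarrow> k \<in> {1..n} \<Longrightarrow> l \<in> {1..n} \<Longrightarrow>
      h (i, k) (j, l) = (if k = l then 0 else g i j (nat \<bar>int k - int l\<bar>))"
    and g: "\<And>i j m. 0 \<le> g i j m"
  shows "(\<Sum>ik\<in>{1, 2} \<times> {1..n}. \<Sum>jl\<in>{1, 2} \<times> {1..n} - {ik}. h ik jl) \<le>
    2 * (\<Sum>i\<in>{1, 2}. \<Sum>j\<in>{1, 2}. n * (\<Sum>m\<in>{1..<n}. g i j m))"
proof -
  let ?I = "{1, 2} \<times> {1..n}"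
  have "(\<Sum>ik\<in>?I. \<Sum>jl\<in>?I - {ik}. h ik jl) = (\<Sum>ik\<in>?I. \<Sum>jl\<in>?I. h ik jl)"
    using h by (intro sum.cong[OF refl] sum.mono_neutral_left) auto
  also have "\<dots> = (\<Sum>i\<in>{1, 2}. \<Sum>k=1..n. \<Sum>j\<in>{1, 2}. \<Sum>l=1..n. h (i, k) (j, l))"
    unfolding sum.cartesian_product' by simp
  also have "\<dots> = (\<Sum>i\<in>{1, 2}. \<Sum>j\<in>{1, 2}. \<Sum>k=1..n. \<Sum>l=1..n. h (i, k) (j, l))"
    by (intro sum.cong refl sum.swap)
  also have "\<dots> \<le> (\<Sum>i\<in>{1, 2}. \<Sum>j\<in>{1, 2}. 2 * (n * (\<Sum>m\<in>{1..<n}. g i j m)))"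
  proof (intro sum_mono)
    fix i j :: nat assume ij: "i \<in> {1, 2}" "j \<in> {1, 2}"
    have "(\<Sum>k=1..n. \<Sum>l=1..n. h (i, k) (j, l)) = (\<Sum>k=1..n. \<Sum>l\<in>{1..n} - {k}. g i j (nat \<bar>int k - int l\<bar>))"
    proof (rule sum.cong[OF refl])
      fix k assume k: "k \<in> {1..n}"
      have "(\<Sum>l=1..n. h (i, k) (j, l)) = (\<Sum>l\<in>{1..n} - {k}. h (i, k) (j, l))"
        using h[OF ij k k] by (intro sum.mono_neutral_right) auto
      also have "\<dots> = (\<Sum>l\<in>{1..n} - {k}. g i j (nat \<bar>int k - int l\<bar>))"
        using h[OF ij k] by (intro sum.cong) auto
      finally show "(\<Sum>l=1..n. h (i, k) (j, l)) = \<dots>" .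
    qed
    also have "\<dots> = 2 * (\<Sum>m\<in>{1..<n}. (real n - real m) * g i j m)" by (rule sum_over_lags)
    also have "\<dots> \<le> 2 * (\<Sum>m\<in>{1..<n}. n * g i j m)"
      using g by (intro mult_left_mono sum_mono mult_right_mono) auto
    finally show "(\<Sum>k=1..n. \<Sum>l=1..n. h (i, k) (j, l)) \<le> 2 * (n * (\<Sum>m\<in>{1..<n}. g i j m))"
      by (simp add: sum_distrib_left)
  qed
  finally show ?thesis by (simp only: sum_distrib_left)
qed

section \<open>Comparison, mixture limit and monotonicity combined\<close>

text \<open>\<open>Z\<close> and \<open>W\<close> live on a space \<open>N\<close> of their own and
  are indexed by \<open>bool\<close> to fit \<open>jointly_gaussian\<close>. \<open>L\<close> is an
  extended real, so one limit condition covers the infinite case. Small \<open>n\<close>, where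
  \<open>Max\<close> may range over the empty set or \<open>ln n\<close> is not positive, do not
  affect the limits.\<close>

theorem theorem1p2:
  fixes M :: "'a measure"
    and X :: "nat \<Rightarrow> nat \<Rightarrow> nat \<Rightarrow> 'a \<Rightarrow> real"
    and \<rho>\<^sub>0 :: "nat \<Rightarrow> real"
    and \<rho> :: "nat \<Rightarrow> nat \<Rightarrow> nat \<Rightarrow> nat \<Rightarrow> real"
    and L L' :: ereal
    and \<tau> \<delta> \<theta> :: "nat \<Rightarrow> nat \<Rightarrow> real"
    and K :: "nat \<Rightarrow> nat \<Rightarrow> nat \<Rightarrow> nat"
    and \<tau>' :: real
    and N :: "'b measure"
    and Z W :: "'b \<Rightarrow> real"
  assumes "prob_space M"
    and "bivariate_gaussian_array M X \<rho>\<^sub>0 \<rho>"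
    and "0 \<le> L"
    and "(\<lambda>n. ereal ((1 - \<rho>\<^sub>0 n) * ln (real n))) \<longlonglongrightarrow> L\<^sup>2"
    and "\<And>i j. i \<in> {1, 2} \<Longrightarrow> j \<in> {1, 2} \<Longrightarrow> 0 < \<tau> i j"
    and "\<And>i j. i \<in> {1, 2} \<Longrightarrow> j \<in> {1, 2} \<Longrightarrow>
           \<delta> i j = (SUP (n, k) \<in> {(n, k). 2 \<le> n \<and> 1 \<le> k \<and> k < n}. \<bar>\<rho> i j k n\<bar>)"
    and "\<And>i j. i \<in> {1, 2} \<Longrightarrow> j \<in> {1, 2} \<Longrightarrow> \<delta> i j < 1"
    and "\<And>i j. i \<in> {1, 2} \<Longrightarrow> j \<in> {1, 2} \<Longrightarrow>
           \<theta> i j \<in> {0 <..< (1 - \<delta> i j) / (1 + \<delta> i j)}"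
    and "\<And>i j n. i \<in> {1, 2} \<Longrightarrow> j \<in> {1, 2} \<Longrightarrow>
           K i j n = nat \<lfloor>real n powr \<theta> i j\<rfloor>"
    and "\<And>i j. i \<in> {1, 2} \<Longrightarrow> j \<in> {1, 2} \<Longrightarrow>
           (\<lambda>n. Max ((\<lambda>k. \<bar>\<rho> i j k n * ln (real k) - \<tau> i j\<bar>) ` {K i j n ..< n})) \<longlonglongrightarrow> 0"
    and "\<tau>' = \<tau> 1 2 - (\<tau> 1 1 + \<tau> 2 2) / 2"
    and "\<tau> 1 2 \<le> sqrt (\<tau> 1 1 * \<tau> 2 2)"
    and "L\<^sup>2 \<ge> ereal (- \<tau>')"
    and "L' = (if L = \<infinity> then \<infinity> else ereal (sqrt ((real_of_ereal L)\<^sup>2 + \<tau>')))"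
    and "prob_space N"
    and "jointly_gaussian N UNIV (case_bool Z W)"
    and "prob_space.expectation N Z = 0" and "prob_space.expectation N W = 0"
    and "prob_space.variance N Z = 1" and "prob_space.variance N W = 1"
    and "correlation N Z W = \<tau> 1 2 / sqrt (\<tau> 1 1 * \<tau> 2 2)"
  shows "(\<lambda>n. SUP (x, y) \<in> UNIV.
            \<bar>prob_space.prob M
                {\<omega> \<in> space M. row_max X n 1 \<omega> \<le> norm_u n x \<and> row_max X n 2 \<omega> \<le> norm_u n y}
             - prob_space.expectation N
                (\<lambda>\<omega>. huesler_reiss L' (x + \<tau> 1 1 - sqrt (2 * \<tau> 1 1) * Z \<omega>)
                                      (y + \<tau> 2 2 - sqrt (2 * \<tau> 2 2) * W \<omega>))\<bar>) \<longlonglongrightarrow> 0"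
proof -
  interpret gaussian_array M X \<rho>\<^sub>0 \<rho>
    using assms(1,2) by (simp add: gaussian_array_def gaussian_array_axioms_def)
  interpret N: prob_space N by fact
  let ?GG = "std_normal_pair"
  define s0 where "s0 = \<tau> 1 2 / sqrt (\<tau> 1 1 * \<tau> 2 2)"
  have \<tau>pos: "0 < \<tau> 1 1" "0 < \<tau> 2 2" "0 < \<tau> 1 2" using assms(5) by auto
  have s0: "\<bar>s0\<bar> \<le> 1" unfolding s0_def using assms(12) \<tau>pos by (auto simp: abs_le_iff divide_le_eq)
  have rho_le: "\<bar>\<rho> i j k n\<bar> \<le> \<delta> i j" if ij: "i \<in> {1, 2}" "j \<in> {1, 2}" and k: "2 \<le> n" "1 \<le> k" "k < n" for i j k n
  proof -
    have "bdd_above ((\<lambda>(n, k). \<bar>\<rho> i j k n\<bar>) ` {(n, k). 2 \<le> n \<and> 1 \<le> k \<and> k < n})"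
      using \<rho>_bound ij by (intro bdd_aboveI2[of _ _ 1]) auto
    from cSUP_upper[OF _ this, of "(n, k)"] show ?thesis
      unfolding assms(6)[OF ij] using k by simp
  qed
  have decay: "slowly_decaying_correlation (\<rho> i j) (\<tau> i j) (\<delta> i j) (\<theta> i j) (K i j)"
    if "i \<in> {1, 2}" "j \<in> {1, 2}" for i j
    using rho_le[OF that] assms(5,7,8,9,10)[OF that] by unfold_locales auto
  have mean_lim: "(\<lambda>n. mean_cov n i j * ln (real n)) \<longlonglongrightarrow> \<tau> i j" if ij: "i \<in> {1, 2}" "j \<in> {1, 2}" for i j
  proof -
    \<comment> \<open>The \<open>n\<close> pairs at lag zero contribute at most 1 / n in modulus to
      the mean covariance, negligible even after multiplication by ln n.\<close>
    have "(\<lambda>n. (if i = j then 1 else \<rho>\<^sub>0 n) * (ln (real n) / n)) \<longlonglongrightarrow> 0"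
    proof (rule Lim_null_comparison)
      show "\<forall>\<^sub>F n in sequentially. norm ((if i = j then 1 else \<rho>\<^sub>0 n) * (ln (real n) / n)) \<le> ln (real n) / n"
        using eventually_ge_at_top[of 1]
      proof eventually_elim
        case (elim n)
        have "\<bar>if i = j then 1 else \<rho>\<^sub>0 n\<bar> * (ln (real n) / n) \<le> 1 * (ln (real n) / n)"
          using \<rho>\<^sub>0_bound[OF elim] elim by (intro mult_right_mono) auto
        then show ?case using elim by (simp add: abs_mult)
      qed
      show "(\<lambda>n. ln (real n) / real n) \<longlonglongrightarrow> 0" by real_asymp
    qed
    from tendsto_add[OF this slowly_decaying_correlation.mean_tendsto[OF decay[OF ij]]]
    have "(\<lambda>n. (if i = j then 1 else \<rho>\<^sub>0 n) * (ln (real n) / n) +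
        ln n * (2 / n\<^sup>2 * (\<Sum>k\<in>{1..<n}. (real n - real k) * \<rho> i j k n))) \<longlonglongrightarrow> \<tau> i j" by simp
    then show ?thesis
    proof (rule Lim_transform_eventually)
      show "\<forall>\<^sub>F n in sequentially. (if i = j then 1 else \<rho>\<^sub>0 n) * (ln (real n) / n) +
        ln n * (2 / n\<^sup>2 * (\<Sum>k\<in>{1..<n}. (real n - real k) * \<rho> i j k n)) = mean_cov n i j * ln (real n)"
        using eventually_ge_at_top[of 1]
        by eventually_elim (simp only: mean_cov_eq[OF _ ij] distrib_right, simp)
    qed
  qed
  have mean_lim0: "(\<lambda>n. mean_cov n i j) \<longlonglongrightarrow> 0" if "i \<in> {1, 2}" "j \<in> {1, 2}" for i j
    by (rule tendsto_0_if_mult_ln[OF mean_lim[OF that]])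
  define v1 where "v1 n = mean_cov n 1 1" for n
  define v2 where "v2 n = mean_cov n 2 2" for n
  define v12 where "v12 n = mean_cov n 1 2" for n
  \<comment> \<open>From some \<open>n\<close> on the mean variances lie strictly between 0 and 1,
    and only then can the correlations of the two parts be formed.\<close>
  define good where "good n \<longleftrightarrow> 2 \<le> n \<and> (0 < v1 n \<and> v1 n < 1) \<and> (0 < v2 n \<and> v2 n < 1)" for n
  have mean_pos: "\<forall>\<^sub>F n in sequentially. 0 < mean_cov n i i \<and> mean_cov n i i < 1" if i: "i \<in> {1, 2}" for i
  proof -
    have "\<forall>\<^sub>F n in sequentially. 0 < mean_cov n i i * ln (real n)"
      by (rule order_tendstoD(1)[OF mean_lim[OF i i] assms(5)[OF i i]])
    moreover have "\<forall>\<^sub>F n in sequentially. mean_cov n i i < 1"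
      by (rule order_tendstoD(2)[OF mean_lim0[OF i i]]) simp
    ultimately show ?thesis using eventually_ge_at_top[of 2]
      by eventually_elim (auto simp: zero_less_mult_iff)
  qed
  have pos1: "\<forall>\<^sub>F n in sequentially. 0 < v1 n \<and> v1 n < 1" and pos2: "\<forall>\<^sub>F n in sequentially. 0 < v2 n \<and> v2 n < 1"
    using mean_pos[of 1] mean_pos[of 2] unfolding v1_def v2_def by auto
  have good: "\<forall>\<^sub>F n in sequentially. good n"
    using pos1 pos2 eventually_ge_at_top[of 2] unfolding good_def by eventually_elim auto
  have lim1: "(\<lambda>n. v1 n * ln (real n)) \<longlonglongrightarrow> \<tau> 1 1" and lim2: "(\<lambda>n. v2 n * ln (real n)) \<longlonglongrightarrow> \<tau> 2 2"
    and lim12: "(\<lambda>n. v12 n * ln (real n)) \<longlonglongrightarrow> \<tau> 1 2"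
    unfolding v1_def v2_def v12_def by (auto intro!: mean_lim)
  \<comment> \<open>The value 1 is a default for the finitely many other \<open>n\<close>; with it
    \<open>s_le\<close> and \<open>r_le\<close> hold for all \<open>n\<close>, as the limit lemmas
    demand.\<close>
  define s where "s n = (if good n then v12 n / sqrt (v1 n * v2 n) else 1)" for n
  define r where "r n = (if good n then (\<rho>\<^sub>0 n - v12 n) / sqrt ((1 - v1 n) * (1 - v2 n)) else 1)" for n
  have s_le: "\<bar>s n\<bar> \<le> 1" for n
  proof (cases "good n")
    case True
    then have "1 \<le> n" by (simp add: good_def)
    from mean_cov_psd(1)[OF this] True show ?thesis
      unfolding s_def good_def v1_def v2_def v12_def
      by (simp only: simp_thms if_True) (intro psd_correlation_bound, auto)
  qed (simp add: s_def)
  have r_le: "\<bar>r n\<bar> \<le> 1" for n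
  proof (cases "good n")
    case True
    then have "1 \<le> n" by (simp add: good_def)
    from mean_cov_psd(2)[OF this] True show ?thesis
      unfolding r_def good_def v1_def v2_def v12_def
      by (simp only: simp_thms if_True) (intro psd_correlation_bound, auto)
  qed (simp add: r_def)
  have s_lim: "s \<longlonglongrightarrow> s0"
  proof -
    \<comment> \<open>Numerator and root are both multiplied by \<open>ln n\<close>, which leaves
      the quotient unchanged and makes each of them converge to a positive number.\<close>
    have "(\<lambda>n. (v12 n * ln n) / sqrt ((v1 n * ln n) * (v2 n * ln n))) \<longlonglongrightarrow> \<tau> 1 2 / sqrt (\<tau> 1 1 * \<tau> 2 2)"
      using \<tau>pos by (intro tendsto_intros lim1 lim2 lim12) auto
    then show ?thesis unfolding s0_def
    proof (rule Lim_transform_eventually)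
      show "\<forall>\<^sub>F n in sequentially. (v12 n * ln n) / sqrt ((v1 n * ln n) * (v2 n * ln n)) = s n"
        using good
      proof eventually_elim
        case (elim n)
        then have "0 < ln (real n)" by (simp add: good_def)
        moreover from this have "sqrt ((v1 n * ln n) * (v2 n * ln n)) = sqrt (v1 n * v2 n) * ln n"
          by (simp add: real_sqrt_mult)
        ultimately show ?case using elim by (simp add: s_def)
      qed
    qed
  qed
  note res = residual_correlation_tendsto[OF lim1 pos1 lim2 pos2 lim12 assms(3,4,11,13,14)]
  have L'0: "0 \<le> L'" by (rule res(2))
  have r_lim: "(\<lambda>n. ereal ((1 - r n) * ln (real n))) \<longlonglongrightarrow> L'\<^sup>2"
    by (rule Lim_transform_eventually[OF res(1)]) (use good in \<open>eventually_elim, simp add: r_def\<close>)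
  define F where "F n x y = prob {\<omega> \<in> space M. row_max X n 1 \<omega> \<le> norm_u n x \<and> row_max X n 2 \<omega> \<le> norm_u n y}" for n x y
  define G where "G = huesler_reiss_mixture L' (\<tau> 1 1) (\<tau> 2 2) s0"
  let ?I = "\<lambda>n::nat. {1::nat, 2} \<times> {1..n}"
  let ?u = "\<lambda>n x y (i::nat). norm_u n (if i = 1 then x else y)"
  have F_eq: "F n x y = prob {\<omega> \<in> space M. \<forall>ik\<in>?I n. (\<lambda>(i, k). X n i k) ik \<omega> \<le> ?u n x y (fst ik)}" if n: "1 \<le> n" for n x y
  proof -
    have "row_max X n i \<omega> \<le> t \<longleftrightarrow> (\<forall>k\<in>{1..n}. X n i k \<omega> \<le> t)" for i t \<omega>
      unfolding row_max_def using n by (subst Max_le_iff) auto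
    then have "{\<omega> \<in> space M. row_max X n 1 \<omega> \<le> norm_u n x \<and> row_max X n 2 \<omega> \<le> norm_u n y} =
        {\<omega> \<in> space M. \<forall>ik\<in>?I n. (\<lambda>(i, k). X n i k) ik \<omega> \<le> ?u n x y (fst ik)}" by auto
    then show ?thesis unfolding F_def by simp
  qed
  have meas: "X n i k \<in> borel_measurable M" if "1 \<le> n" "i \<in> {1, 2}" "k \<in> {1..n}" for n i k
    using gaussian_familyD(3)[OF row_family[OF that(1)], of "(i, k)"] that by simp
  have box_meas: "{\<omega> \<in> space M. \<forall>ik\<in>?I n. (\<lambda>(i, k). X n i k) ik \<omega> \<le> f ik} \<in> events" if n: "1 \<le> n" for n f
  proof -
    have "countable (?I n)" by (rule countable_finite) simp
    then show ?thesis
      by (intro sets.sets_Collect_countable_All' borel_measurable_le borel_measurable_const)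
        (rule gaussian_familyD(3)[OF row_family[OF n]])
  qed
  have conv: "(\<lambda>n. F n x y) \<longlonglongrightarrow> G x y" for x y
  proof -
    define P where "P n = (\<integral>z. binormal_cdf (r n) ((norm_u n x - sqrt (v1 n) * fst (correlated_pair (s n) z)) / sqrt (1 - v1 n))
        ((norm_u n y - sqrt (v2 n) * snd (correlated_pair (s n) z)) / sqrt (1 - v2 n)) ^ n \<partial>?GG)" for n
    have P_lim: "P \<longlonglongrightarrow> G x y"
      unfolding P_def[abs_def] G_def huesler_reiss_mixture_def
      by (rule comparison_array_limit[OF lim1 pos1 lim2 pos2 s_lim r_le L'0 r_lim])
    \<comment> \<open>A common lower bound for the two levels, since the comparison inequality uses
      a single \<open>w\<close>.\<close>
    define m where "m = min x y"
    \<comment> \<open>The entry 1 / 2 keeps \<open>d\<close> away from 0, so that the mean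
      covariances, which tend to 0, fall below it as well.\<close>
    define d where "d = Max {1 / 2, \<delta> 1 1, \<delta> 1 2, \<delta> 2 1, \<delta> 2 2}"
    have d: "d < 1" "1 / 2 \<le> d" "\<And>i j. i \<in> {1, 2} \<Longrightarrow> j \<in> {1, 2} \<Longrightarrow> \<delta> i j \<le> d"
      unfolding d_def using assms(7) by (auto simp: Max_less_iff)
    define o' where "o' n = (\<lambda>(i, k) (j, l). max \<bar>\<rho> i j (nat \<bar>int k - int l\<bar>) n\<bar> \<bar>mean_cov n i j\<bar>)" for n
    define g where "g n i j k = \<bar>\<rho> i j k n - mean_cov n i j\<bar> * exp (- (norm_u n m)\<^sup>2 / (1 + max \<bar>\<rho> i j k n\<bar> \<bar>mean_cov n i j\<bar>))" for n i j k
    define B where "B n = 8 * (2 * (\<Sum>i\<in>{1, 2}. \<Sum>j\<in>{1, 2}. n * (\<Sum>k\<in>{1..<n}. g n i j k)) / sqrt (1 - d\<^sup>2))" for n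
    have B_lim: "B \<longlonglongrightarrow> 0"
    proof -
      have "(\<lambda>n. n * (\<Sum>k\<in>{1..<n}. g n i j k)) \<longlonglongrightarrow> 0" if "i \<in> {1, 2}" "j \<in> {1, 2}" for i j
        unfolding g_def
        by (rule slowly_decaying_correlation.comparison_sum_tendsto[OF decay[OF that] mean_lim[OF that]])
      then have "B \<longlonglongrightarrow> 8 * (2 * (\<Sum>i\<in>{1, 2::nat}. \<Sum>j\<in>{1, 2::nat}. 0) / sqrt (1 - d\<^sup>2))"
        unfolding B_def[abs_def] divide_inverse by (intro tendsto_mult tendsto_sum tendsto_const) auto
      then show ?thesis by simp
    qed
    have w_pos: "\<forall>\<^sub>F n in sequentially. 0 \<le> norm_u n m"
    proof -
      have "\<forall>\<^sub>F n::nat in sequentially. 0 \<le> sqrt (2 * ln n) + (m - ln (4 * pi * ln n) / 2) / sqrt (2 * ln n)"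
        by real_asymp
      then show ?thesis using eventually_ge_at_top[of 2] by eventually_elim (simp add: norm_u_eq)
    qed
    have small: "\<forall>\<^sub>F n in sequentially. \<forall>i\<in>{1, 2}. \<forall>j\<in>{1, 2}. \<bar>mean_cov n i j\<bar> < d"
    proof (intro eventually_ball_finite ballI)
      fix i j :: nat assume "i \<in> {1, 2}" "j \<in> {1, 2}"
      from tendsto_rabs[OF mean_lim0[OF this]] show "\<forall>\<^sub>F n in sequentially. \<bar>mean_cov n i j\<bar> < d"
        using d(2) by (intro order_tendstoD(2)) auto
    qed auto
    have "\<forall>\<^sub>F n in sequentially. norm (F n x y - P n) \<le> B n"
      using good w_pos small
    proof eventually_elim
      case (elim n)
      then have n: "2 \<le> n" "1 \<le> n" and v: "0 < v1 n" "v1 n < 1" "0 < v2 n" "v2 n < 1" by (auto simp: good_def)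
      define p where "p i = sqrt (mean_cov n i i)" for i
      define q where "q i = sqrt (1 - mean_cov n i i)" for i
      define D where "D = (\<lambda>(i, k::nat) (j, l). p i * p j * (if i = j then 1 else s n) + (if k = l then q i * q j * (if i = j then 1 else r n) else 0))"
      have fam: "gaussian_family (comparison_space n) (?I n) (comparison_array (s n) (r n) p q) D"
        unfolding D_def by (rule gaussian_family_comparison_array[OF s_le r_le])
      \<comment> \<open>With these standard deviations and correlations the common part has
        covariance exactly \<open>mean_cov\<close> and the residual part exactly the remainder, so
        \<open>D\<close> agrees with the row at lag zero.\<close>
      have pp: "p 1 * p 1 = v1 n" "p 2 * p 2 = v2 n" "p 1 * p 2 * s n = v12 n" "p 2 * p 1 * s n = v12 n"
        using elim(1) v unfolding p_def s_def v1_def v2_def by (auto simp: real_sqrt_mult)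
      have qq: "q 1 * q 1 = 1 - v1 n" "q 2 * q 2 = 1 - v2 n" "q 1 * q 2 * r n = \<rho>\<^sub>0 n - v12 n" "q 2 * q 1 * r n = \<rho>\<^sub>0 n - v12 n"
        using elim(1) v unfolding q_def r_def v1_def v2_def by (auto simp: real_sqrt_mult)
      have D_same: "D (i, k) (j, k) = (if i = j then 1 else \<rho>\<^sub>0 n)" and D_lag: "k \<noteq> l \<Longrightarrow> D (i, k) (j, l) = mean_cov n i j"
        if "i \<in> {1, 2}" "j \<in> {1, 2}" for i j k l
        using that pp qq mean_cov_commute[of n 2 1] unfolding D_def v1_def v2_def v12_def by auto
      have C_same: "row_cov n (i, k) (j, k) = (if i = j then 1 else \<rho>\<^sub>0 n)" if "i \<in> {1, 2}" "j \<in> {1, 2}" "k \<in> {1..n}" for i j k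
        using that row_cov_diag[OF n(2)] row_cov_same[OF n(2)] row_cov_commute[of n "(2, k)" "(1, k)"] by auto
      have C_lag: "row_cov n (i, k) (j, l) = \<rho> i j (nat \<bar>int k - int l\<bar>) n"
        if "i \<in> {1, 2}" "j \<in> {1, 2}" "k \<in> {1..n}" "l \<in> {1..n}" "k \<noteq> l" for i j k l
        by (rule row_cov_lag[OF n(2) that])
      have cmp: "\<bar>prob {\<omega> \<in> space M. \<forall>ik\<in>?I n. (\<lambda>(i, k). X n i k) ik \<omega> \<le> ?u n x y (fst ik)} -
          measure (comparison_space n) {\<omega> \<in> space (comparison_space n). \<forall>ik\<in>?I n. comparison_array (s n) (r n) p q ik \<omega> \<le> ?u n x y (fst ik)}\<bar>
        \<le> 8 * (\<Sum>ik\<in>?I n. \<Sum>jl\<in>?I n - {ik}. \<bar>row_cov n ik jl - D ik jl\<bar> * (exp (- (norm_u n m)\<^sup>2 / (1 + o' n ik jl)) / sqrt (1 - d\<^sup>2)))"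
      proof (rule normal_comparison[OF row_family[OF n(2)] fam])
        show "row_cov n ik ik = 1" "D ik ik = 1" if "ik \<in> ?I n" for ik
          using that C_same D_same by (cases ik, auto)+
        show "row_cov n ik jl = row_cov n jl ik" for ik jl by (rule row_cov_commute)
        show "D ik jl = D jl ik" if "ik \<in> ?I n" "jl \<in> ?I n" for ik jl
          unfolding D_def by (cases ik, cases jl) (simp add: mult.commute)
        show "norm_u n m \<le> ?u n x y (fst ik)" for ik
          unfolding m_def using n by (intro norm_u_mono) auto
        show "\<bar>row_cov n ik jl\<bar> \<le> o' n ik jl \<and> \<bar>D ik jl\<bar> \<le> o' n ik jl \<and> o' n ik jl \<le> d"
          if ikjl: "ik \<in> ?I n" "jl \<in> ?I n" "ik \<noteq> jl" "row_cov n ik jl \<noteq> D ik jl" for ik jl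
        proof -
          obtain i k j l where e: "ik = (i, k)" "jl = (j, l)" "i \<in> {1, 2}" "j \<in> {1, 2}" "k \<in> {1..n}" "l \<in> {1..n}"
            using ikjl(1,2) by (cases ik, cases jl) auto
          \<comment> \<open>A discrepancy occurs only at a positive lag, where the strict bound
            \<open>\<delta> i j < 1\<close> is available; the correlation within a pair never has to
            stay away from one.\<close>
          have kl: "k \<noteq> l" using ikjl(4) C_same[OF e(3,4,5)] D_same[OF e(3,4)] unfolding e(1,2) by auto
          have "\<bar>\<rho> i j (nat \<bar>int k - int l\<bar>) n\<bar> \<le> d"
          proof (rule order_trans[OF rho_le[OF e(3,4) n(1)] d(3)[OF e(3,4)]])
            show "1 \<le> nat \<bar>int k - int l\<bar>" "nat \<bar>int k - int l\<bar> < n"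
              using e(5,6) kl unfolding atLeastAtMost_iff by linarith+
          qed
          moreover have "\<bar>mean_cov n i j\<bar> \<le> d" using elim(3) e(3,4) by (auto intro: less_imp_le)
          ultimately show ?thesis
            unfolding e(1,2) C_lag[OF e(3-6) kl] D_lag[OF e(3,4) kl] o'_def prod.case
            by (intro conjI max.cobounded1 max.cobounded2 max.boundedI)
        qed
      qed (use elim d in auto)
      also have "(\<Sum>ik\<in>?I n. \<Sum>jl\<in>?I n - {ik}. \<bar>row_cov n ik jl - D ik jl\<bar> * (exp (- (norm_u n m)\<^sup>2 / (1 + o' n ik jl)) / sqrt (1 - d\<^sup>2))) =
          (\<Sum>ik\<in>?I n. \<Sum>jl\<in>?I n - {ik}. \<bar>row_cov n ik jl - D ik jl\<bar> * exp (- (norm_u n m)\<^sup>2 / (1 + o' n ik jl))) / sqrt (1 - d\<^sup>2)"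
        by (simp add: sum_divide_distrib)
      also have "\<dots> \<le> 2 * (\<Sum>i\<in>{1, 2}. \<Sum>j\<in>{1, 2}. n * (\<Sum>k\<in>{1..<n}. g n i j k)) / sqrt (1 - d\<^sup>2)"
      proof (intro divide_right_mono sum_array_lags_le)
        show "0 \<le> sqrt (1 - d\<^sup>2)" using d by (simp add: power_le_one)
        show "0 \<le> g n i j k" for i j k unfolding g_def by simp
        fix i j k l :: nat assume ijkl: "i \<in> {1, 2}" "j \<in> {1, 2}" "k \<in> {1..n}" "l \<in> {1..n}"
        show "\<bar>row_cov n (i, k) (j, l) - D (i, k) (j, l)\<bar> * exp (- (norm_u n m)\<^sup>2 / (1 + o' n (i, k) (j, l))) =
          (if k = l then 0 else g n i j (nat \<bar>int k - int l\<bar>))"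
        proof (cases "k = l")
          case True
          then show ?thesis using C_same[OF ijkl(1-3)] D_same[OF ijkl(1,2), of k] by simp
        next
          case False
          then show ?thesis unfolding C_lag[OF ijkl False] D_lag[OF ijkl(1,2) False] g_def o'_def by simp
        qed
      qed
      finally have "\<bar>F n x y - measure (comparison_space n) {\<omega> \<in> space (comparison_space n). \<forall>ik\<in>?I n. comparison_array (s n) (r n) p q ik \<omega> \<le> ?u n x y (fst ik)}\<bar> \<le> B n"
        unfolding F_eq[OF n(2)] B_def by simp
      moreover have "measure (comparison_space n) {\<omega> \<in> space (comparison_space n). \<forall>ik\<in>?I n. comparison_array (s n) (r n) p q ik \<omega> \<le> ?u n x y (fst ik)} = P n"
      proof -
        have "0 < q 1" "0 < q 2" unfolding q_def using v by (auto simp: v1_def v2_def)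
        from comparison_array_box[OF this, of n "s n" "r n" p "?u n x y"] show ?thesis
          unfolding P_def p_def q_def v1_def v2_def by simp
      qed
      ultimately show ?case by simp
    qed
    from Lim_null_comparison[OF this B_lim] have "(\<lambda>n. F n x y - P n) \<longlonglongrightarrow> 0" .
    from tendsto_add[OF this P_lim] show ?thesis by simp
  qed
  have F_mono: "F n x y \<le> F n x' y'" if n: "2 \<le> n" and le: "x \<le> x'" "y \<le> y'" for n x x' y y'
  proof -
    have n1: "1 \<le> n" using n by simp
    have u: "?u n x y i \<le> ?u n x' y' i" for i
      using norm_u_mono[OF n le(1)] norm_u_mono[OF n le(2)] by simp
    show ?thesis unfolding F_eq[OF n1]
      by (rule finite_measure_mono[OF _ box_meas[OF n1]]) (blast intro: order_trans[OF _ u])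
  qed
  have F_upper: "\<exists>B. \<forall>\<^sub>F n in sequentially. \<forall>x y. F n x y \<le> F n (min x B) (min y B) + e" if e: "0 < e" for e
  proof -
    \<comment> \<open>Union bound: one of the 2 n entries exceeds \<open>norm_u n B\<close> with
      probability at most 2 n times the normal tail, which tends to 2 exp (- B) and does not involve
      \<open>x\<close> and \<open>y\<close>.\<close>
    have "((\<lambda>B::real. 2 * exp (- B)) \<longlongrightarrow> 0) at_top" by real_asymp
    from eventually_happens'[OF _ order_tendstoD(2)[OF this e]]
    obtain B :: real where B: "2 * exp (- B) < e" by auto
    have "(\<lambda>n. 2 * (n * (1 - std_normal_cdf (norm_u n B)))) \<longlonglongrightarrow> 2 * exp (- B)"
      by (intro tendsto_intros std_normal_tail_tendsto)
    from order_tendstoD(2)[OF this B] eventually_ge_at_top[of 2]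
    have "\<forall>\<^sub>F n in sequentially. \<forall>x y. F n x y \<le> F n (min x B) (min y B) + e"
    proof eventually_elim
      case (elim n)
      then have n: "1 \<le> n" by simp
      define T where "T ik = {\<omega> \<in> space M. norm_u n B < (\<lambda>(i, k). X n i k) ik \<omega>}" for ik
      have T_meas: "T ik \<in> events" if "ik \<in> ?I n" for ik
        unfolding T_def by (intro borel_measurable_less borel_measurable_const gaussian_familyD(3)[OF row_family[OF n] that])
      have T: "prob (T ik) = 1 - std_normal_cdf (norm_u n B)" if ik: "ik \<in> ?I n" for ik
      proof -
        have m: "(\<lambda>(i, k). X n i k) ik \<in> borel_measurable M" by (rule gaussian_familyD(3)[OF row_family[OF n] ik])
        have "row_cov n ik ik = 1" using ik row_cov_diag[OF n] by (cases ik) auto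
        from gaussian_marginal_law[OF row_family[OF n] ik this]
        have "measure std_normal_distribution {norm_u n B<..} = measure (distr M borel ((\<lambda>(i, k). X n i k) ik)) {norm_u n B<..}" by simp
        also have "\<dots> = prob (((\<lambda>(i, k). X n i k) ik) -` {norm_u n B<..} \<inter> space M)" by (rule measure_distr[OF m]) simp
        also have "((\<lambda>(i, k). X n i k) ik) -` {norm_u n B<..} \<inter> space M = T ik" unfolding T_def by auto
        finally have "prob (T ik) = measure std_normal_distribution {norm_u n B<..}" ..
        moreover have "{norm_u n B<..} = UNIV - {..norm_u n B}" by auto
        ultimately show ?thesis
          unfolding std_normal_cdf_def cdf_def using prob_space.prob_compl[OF prob_space_std_normal, of "{..norm_u n B}"] by simp
      qed
      show ?case
      proof (intro allI)
        fix x y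
        let ?S = "\<lambda>x y. {\<omega> \<in> space M. \<forall>ik\<in>?I n. (\<lambda>(i, k). X n i k) ik \<omega> \<le> ?u n x y (fst ik)}"
        have un: "(\<Union>ik\<in>?I n. T ik) \<in> events" using T_meas by (intro sets.finite_UN) auto
        have min_u: "norm_u n (min a B) = min (norm_u n a) (norm_u n B)" for a
          using norm_u_mono[OF elim(2), of a B] norm_u_mono[OF elim(2), of B a] by (auto simp: min_def)
        have "?S x y \<subseteq> ?S (min x B) (min y B) \<union> (\<Union>ik\<in>?I n. T ik)"
        proof
          fix \<omega> assume w: "\<omega> \<in> ?S x y"
          show "\<omega> \<in> ?S (min x B) (min y B) \<union> (\<Union>ik\<in>?I n. T ik)"
          proof (cases "\<exists>ik\<in>?I n. \<omega> \<in> T ik")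
            case False
            then have "(\<lambda>(i, k). X n i k) ik \<omega> \<le> ?u n (min x B) (min y B) (fst ik)" if "ik \<in> ?I n" for ik
              using w that unfolding T_def by (auto simp: min_u not_less)
            then show ?thesis using w by blast
          qed auto
        qed
        then have "F n x y \<le> prob (?S (min x B) (min y B) \<union> (\<Union>ik\<in>?I n. T ik))"
          unfolding F_eq[OF n] by (intro finite_measure_mono sets.Un box_meas n un)
        also have "\<dots> \<le> F n (min x B) (min y B) + prob (\<Union>ik\<in>?I n. T ik)"
          unfolding F_eq[OF n] by (rule measure_Un_le[OF box_meas[OF n] un])
        also have "prob (\<Union>ik\<in>?I n. T ik) \<le> (\<Sum>ik\<in>?I n. prob (T ik))"
          using T_meas by (intro finite_measure_subadditive_finite) auto
        also have "\<dots> = (\<Sum>ik\<in>?I n. 1 - std_normal_cdf (norm_u n B))" by (intro sum.cong refl T)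
        also have "\<dots> = 2 * (n * (1 - std_normal_cdf (norm_u n B)))" by (simp add: card_cartesian_product)
        finally show "F n x y \<le> F n (min x B) (min y B) + e" using elim(1) by linarith
      qed
    qed
    then show ?thesis by blast
  qed
  have "(\<lambda>n. SUP (x, y)\<in>UNIV. \<bar>F n x y - G x y\<bar>) \<longlonglongrightarrow> 0"
  proof (rule bivariate_cdf_uniform_convergence[OF F_mono _ conv _ F_upper])
    show "0 \<le> F n x y" for n x y unfolding F_def by simp
    show "continuous_on UNIV (\<lambda>z. G (fst z) (snd z))" unfolding G_def by (rule continuous_huesler_reiss_mixture[OF L'0])
    show "\<exists>a. G a B \<le> e \<and> G B a \<le> e" if "0 < e" for e B
      unfolding G_def by (rule huesler_reiss_mixture_small[OF L'0 that])
  qed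
  moreover have "N.expectation (\<lambda>\<omega>. huesler_reiss L' (x + \<tau> 1 1 - sqrt (2 * \<tau> 1 1) * Z \<omega>) (y + \<tau> 2 2 - sqrt (2 * \<tau> 2 2) * W \<omega>)) = G x y" for x y
  proof -
    let ?ZW = "case_bool Z W"
    have m: "N.expectation (?ZW b) = 0" and v: "N.variance (?ZW b) = 1" for b
      using assms(17-20) by (cases b; simp)+
    note fam = jointly_gaussian_imp_gaussian_family[OF assms(15,16) m v]
    have corr: "(\<integral>\<omega>. Z \<omega> * W \<omega> \<partial>N) = s0" using fam(4)[of True False] assms(21) by (simp add: s0_def)
    \<comment> \<open>This fixes the joint law of \<open>Z\<close> and \<open>W\<close> as that of a
      correlated pair, including the degenerate case \<open>s0 = 1\<close>.\<close>
    have law: "distr N borel (\<lambda>\<omega>. (?ZW True \<omega>, ?ZW False \<omega>)) = distr ?GG borel (correlated_pair s0)"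
      using fam(3)[of True] fam(3)[of False] corr s0
      by (intro gaussian_pair_law[OF fam(1)]) (auto simp: mult.commute)
    then have law': "distr N borel (\<lambda>\<omega>. (Z \<omega>, W \<omega>)) = distr ?GG borel (correlated_pair s0)" by simp
    have Zm: "Z \<in> borel_measurable N" "W \<in> borel_measurable N"
      using gaussian_familyD(3)[OF fam(1), of True] gaussian_familyD(3)[OF fam(1), of False] by auto
    let ?h = "\<lambda>z. huesler_reiss L' (x + \<tau> 1 1 - sqrt (2 * \<tau> 1 1) * fst z) (y + \<tau> 2 2 - sqrt (2 * \<tau> 2 2) * snd z)"
    have h: "?h \<in> borel_measurable borel"
      unfolding borel_prod[symmetric] by (intro borel_measurable_huesler_reiss_comp) measurable
    have "N.expectation (\<lambda>\<omega>. ?h (Z \<omega>, W \<omega>)) = integral\<^sup>L (distr N borel (\<lambda>\<omega>. (Z \<omega>, W \<omega>))) ?h"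
      using Zm by (intro integral_distr[symmetric] h) (simp add: borel_prod[symmetric])
    also have "\<dots> = (\<integral>z. ?h (correlated_pair s0 z) \<partial>?GG)"
      unfolding law' by (rule integral_distr[OF measurable_correlated_pair h])
    finally show ?thesis unfolding G_def huesler_reiss_mixture_def by simp
  qed
  ultimately show ?thesis unfolding F_def by simp
qed

end
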